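(* Let $G$ be a finite group and $p$ a fixed prime divisor of $|G|$. Then every subgroup of $G$ is a TI-subgroup of $G$ or subnormal in $G$ or has $p'$-order if and only if one of the following statements holds: (1) every subgroup of $G$ of order divisible by $p$ is subnormal in $G$; (2) $p=2$ and $G=Z_q\rtimes\langle a\rangle$ is a Frobenius group with kernel $Z_q$ and complement $\langle a\rangle$, where $q$ is an odd prime and the order $o(a)$ of $a$ is even; (3) $p>2$ and $G=(Z_q)^r\rtimes(P\times H)$ is a Frobenius group with kernel $(Z_q)^r$ and complement $P\times H$, where $q$ is a prime with $q\neq p$ and $r\geq 1$, $P$ is a Sylow $p$-subgroup of $G$ and $P$ is cyclic, $H$ is either a cyclic group or a direct product of the quaternion group $Q_8$ and a cyclic group of odd order, and every non-identity subgroup of $P$ acts irreducibly (by conjugation) on $(Z_q)^r$; (4) $p>2$ and $G=(Z_q)^r\rtimes(Z_p\rtimes H)$ is a Frobenius group with kernel $(Z_q)^r$ and complement $Z_p\rtimes H$, where $q$ is a prime with $q\neq p$ and $r>1$, $Z_p$ is a Sylow $p$-subgroup of $G$, $H$ is either a cyclic group or a direct product of the quaternion group $Q_8$ and a cyclic group of odd order such that $[Z_p,H]\neq 1$, and $Z_p$ acts irreducibly (by conjugation) on $(Z_q)^r$.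
   Context: All groups are finite. A subgroup $H$ of a group $G$ is a TI-subgroup of $G$ if for every $g\in G$, $H^g\cap H=1$ or $H^g\cap H=H$. A subgroup has $p'$-order if its order is not divisible by $p$. $Z_n$ denotes the cyclic group of order $n$, $(Z_q)^r$ the elementary abelian group of order $q^r$, and $Q_8$ the quaternion group of order $8$. *)

theory Defs
  imports "HOL-Algebra.Algebra"
begin

definition conjugate :: "('a, 'b) monoid_scheme \<Rightarrow> 'a set \<Rightarrow> 'a \<Rightarrow> 'a set" where
  "conjugate G H g = {inv\<^bsub>G\<^esub> g \<otimes>\<^bsub>G\<^esub> h \<otimes>\<^bsub>G\<^esub> g | h. h \<in> H}"

definition TI_subgroup :: "('a, 'b) monoid_scheme \<Rightarrow> 'a set \<Rightarrow> bool" where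
  "TI_subgroup G H \<longleftrightarrow> subgroup H G \<and>
     (\<forall>g \<in> carrier G. conjugate G H g \<inter> H = {\<one>\<^bsub>G\<^esub>} \<or> conjugate G H g \<inter> H = H)"

inductive subnormal :: "('a, 'b) monoid_scheme \<Rightarrow> 'a set \<Rightarrow> bool" for G where
  top: "subnormal G (carrier G)"
| step: "\<lbrakk>subnormal G K; subgroup H G; H \<subseteq> K; normal H (G\<lparr>carrier := K\<rparr>)\<rbrakk> \<Longrightarrow> subnormal G H"

definition cyclic_sub :: "('a, 'b) monoid_scheme \<Rightarrow> 'a set \<Rightarrow> bool" where
  "cyclic_sub G H \<longleftrightarrow> subgroup H G \<and> cyclic_group (G\<lparr>carrier := H\<rparr>)"

definition elem_abelian_sub :: "('a, 'b) monoid_scheme \<Rightarrow> nat \<Rightarrow> nat \<Rightarrow> 'a set \<Rightarrow> bool" where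
  "elem_abelian_sub G q r V \<longleftrightarrow> subgroup V G \<and>
     (\<forall>x\<in>V. \<forall>y\<in>V. x \<otimes>\<^bsub>G\<^esub> y = y \<otimes>\<^bsub>G\<^esub> x) \<and>
     (\<forall>x\<in>V. x [^]\<^bsub>G\<^esub> q = \<one>\<^bsub>G\<^esub>) \<and> card V = q ^ r"

definition sylow_sub :: "('a, 'b) monoid_scheme \<Rightarrow> nat \<Rightarrow> 'a set \<Rightarrow> bool" where
  "sylow_sub G p P \<longleftrightarrow> subgroup P G \<and> card P = p ^ Factorial_Ring.multiplicity p (order G)"

definition int_semidirect :: "('a, 'b) monoid_scheme \<Rightarrow> 'a set \<Rightarrow> 'a set \<Rightarrow> 'a set \<Rightarrow> bool" where
  "int_semidirect G U K C \<longleftrightarrow> subgroup U G \<and> subgroup K G \<and> subgroup C G \<and>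
     K \<subseteq> U \<and> C \<subseteq> U \<and> normal K (G\<lparr>carrier := U\<rparr>) \<and>
     K \<inter> C = {\<one>\<^bsub>G\<^esub>} \<and> set_mult G K C = U"

definition int_direct :: "('a, 'b) monoid_scheme \<Rightarrow> 'a set \<Rightarrow> 'a set \<Rightarrow> 'a set \<Rightarrow> bool" where
  "int_direct G U A B \<longleftrightarrow> subgroup A G \<and> subgroup B G \<and>
     (\<forall>a\<in>A. \<forall>b\<in>B. a \<otimes>\<^bsub>G\<^esub> b = b \<otimes>\<^bsub>G\<^esub> a) \<and>
     A \<inter> B = {\<one>\<^bsub>G\<^esub>} \<and> set_mult G A B = U"

definition frobenius :: "('a, 'b) monoid_scheme \<Rightarrow> 'a set \<Rightarrow> 'a set \<Rightarrow> bool" where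
  "frobenius G K C \<longleftrightarrow> subgroup C G \<and> C \<noteq> {\<one>\<^bsub>G\<^esub>} \<and> C \<noteq> carrier G \<and>
     (\<forall>g \<in> carrier G - C. C \<inter> conjugate G C g = {\<one>\<^bsub>G\<^esub>}) \<and>
     K = (carrier G - (\<Union>g\<in>carrier G. conjugate G C g)) \<union> {\<one>\<^bsub>G\<^esub>}"

(* the quaternion group Q_8 = <i, j | i^4 = 1, j^2 = i^2, j^-1 i j = i^-1>,
   element (a,b) representing i^a j^b, a < 4, b < 2 *)
definition quaternion_group :: "(nat \<times> nat) monoid" where
  "quaternion_group = \<lparr>carrier = {0..<4} \<times> {0..<2},
     monoid.mult = (\<lambda>(a, b) (c, d).
        ((a + (if b = 1 then 3 * c else c) + (if b = 1 \<and> d = 1 then 2 else 0)) mod 4,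
         (b + d) mod 2)),
     monoid.one = (0, 0)\<rparr>"

definition cyc_or_Q8_odd :: "('a, 'b) monoid_scheme \<Rightarrow> 'a set \<Rightarrow> bool" where
  "cyc_or_Q8_odd G H \<longleftrightarrow> cyclic_sub G H \<or>
     (\<exists>Q C. int_direct G H Q C \<and> G\<lparr>carrier := Q\<rparr> \<cong> quaternion_group \<and>
            cyclic_sub G C \<and> odd (card C))"

definition acts_irreducibly :: "('a, 'b) monoid_scheme \<Rightarrow> 'a set \<Rightarrow> 'a set \<Rightarrow> bool" where
  "acts_irreducibly G S V \<longleftrightarrow> V \<noteq> {\<one>\<^bsub>G\<^esub>} \<and>
     (\<forall>W. subgroup W G \<and> W \<subseteq> V \<and> (\<forall>s\<in>S. conjugate G W s \<subseteq> W) \<longrightarrow>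
          W = {\<one>\<^bsub>G\<^esub>} \<or> W = V)"

end

theory Submission
  imports Defs "HOL-Number_Theory.Cong"
begin

text \<open>
  If \<open>G\<close> has a nontrivial normal \<open>p\<close>-subgroup, a maximal non-subnormal subgroup of order divisible
  by \<open>p\<close> would be TI and self-normalizing, hence would contain that subgroup and be normal; so (1)
  holds. Otherwise the normalizer \<open>C\<close> of a Sylow \<open>p\<close>-subgroup \<open>P\<close> is TI, self-normalizing and not
  normal, that is, a Frobenius complement. All subgroups between \<open>P\<close> and \<open>C\<close> are normal in \<open>C\<close>, so
  \<open>C\<close> is soluble and iterated transfer into abelian quotients of \<open>C\<close> produces the Frobenius kernel
  \<open>K\<close>; the general theorem of Frobenius is not needed. For \<open>x \<in> C\<close> of order \<open>p\<close>, a proper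
  nontrivial \<open>x\<close>-invariant subgroup \<open>L\<close> of \<open>K\<close> makes \<open>L\<langle>x\<rangle>\<close> a TI-subgroup, which forces \<open>L\<close> to be
  malnormal in \<open>K\<close>; applied to an invariant Sylow subgroup, to the centre and to \<open>\<Omega>\<^sub>1\<close>, this makes \<open>K\<close>
  elementary abelian with \<open>x\<close> acting irreducibly. By Schur's lemma the centralizer of \<open>x\<close> in \<open>C\<close>
  is abelian, every subgroup of \<open>C\<close> of order divisible by \<open>p\<close> is normal in \<open>C\<close>, and the possible
  \<open>C\<close> are read off from the structure of Dedekind groups without subgroups \<open>Z\<^sub>r \<times> Z\<^sub>r\<close>.
\<close>

section \<open>Conjugation and subgroups\<close>

text \<open>Two points left open by the sketch shape the development. A complement obtained by
  iterated transfer is at first only a subgroup; it becomes normal through a count that identifies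
  it with the set of elements conjugate to no non-identity element of \<open>C\<close>, a set
  depending on no choice. This is used twice: for \<open>C\<close> in \<open>G\<close>, and for an
  \<open>x\<close>-invariant Sylow subgroup of \<open>K\<close>, where the same independence makes
  the complement invariant under \<open>x\<close>. The second tool is the map k -> [k,x], injective
  on \<open>K\<close> because \<open>x\<close> fixes no non-identity element of \<open>K\<close>: it
  shows that a subnormal subgroup meeting \<open>C\<close> nontrivially contains \<open>K\<close>,
  and that L<x> being TI makes L malnormal. For the converse, in (2) to (4) a subgroup of order
  divisible by \<open>p\<close> contains, up to conjugacy, the only subgroup of order
  \<open>p\<close> of the complement. By irreducibility it meets the kernel trivially or contains
  it. In the first case it lies in a conjugate of the complement, which normalizes it, and
  malnormality makes it TI; in the second it is normal.\<close>

definition cj :: "('a, 'b) monoid_scheme \<Rightarrow> 'a \<Rightarrow> 'a \<Rightarrow> 'a" where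
  "cj G g h = inv\<^bsub>G\<^esub> g \<otimes>\<^bsub>G\<^esub> h \<otimes>\<^bsub>G\<^esub> g"

text \<open>Inclusion is enough: for a subgroup \<open>K\<close> it yields equality, applied to k
  and its inverse. \<open>H\<close> need not lie in \<open>K\<close>, so that products of two
  subgroups are covered as well as normal subgroups.\<close>

definition normalizes :: "('a, 'b) monoid_scheme \<Rightarrow> 'a set \<Rightarrow> 'a set \<Rightarrow> bool" where
  "normalizes G K H \<longleftrightarrow> (\<forall>k\<in>K. \<forall>h\<in>H. cj G k h \<in> H)"

lemma conjugate_eq_image: "conjugate G H g = cj G g ` H"
  by (auto simp: conjugate_def cj_def)

lemmas subgroup_closed = subgroup.m_closed subgroup.m_inv_closed

context group
begin

lemma inv_cancel_left [simp]:
  "x \<in> carrier G \<Longrightarrow> y \<in> carrier G \<Longrightarrow> x \<otimes> (inv x \<otimes> y) = y"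
  "x \<in> carrier G \<Longrightarrow> y \<in> carrier G \<Longrightarrow> inv x \<otimes> (x \<otimes> y) = y"
  by (simp_all flip: m_assoc)

lemma cj_closed [simp]: "g \<in> carrier G \<Longrightarrow> h \<in> carrier G \<Longrightarrow> cj G g h \<in> carrier G"
  by (simp add: cj_def)

lemma cj_one_left [simp]: "h \<in> carrier G \<Longrightarrow> cj G \<one> h = h"
  by (simp add: cj_def)

lemma cj_one_right [simp]: "g \<in> carrier G \<Longrightarrow> cj G g \<one> = \<one>"
  by (simp add: cj_def)

text \<open>Conjugation is a right action, the left factor acting first; all actions below follow
  this order.\<close>

lemma cj_mult_left:
  "g \<in> carrier G \<Longrightarrow> k \<in> carrier G \<Longrightarrow> h \<in> carrier G \<Longrightarrow> cj G (g \<otimes> k) h = cj G k (cj G g h)"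
  by (simp add: cj_def inv_mult_group m_assoc)

lemma cj_mult_right:
  "g \<in> carrier G \<Longrightarrow> k \<in> carrier G \<Longrightarrow> h \<in> carrier G \<Longrightarrow> cj G g (h \<otimes> k) = cj G g h \<otimes> cj G g k"
  by (simp add: cj_def inv_mult_group m_assoc)

lemma cj_inv_right: "g \<in> carrier G \<Longrightarrow> h \<in> carrier G \<Longrightarrow> cj G g (inv h) = inv (cj G g h)"
  by (simp add: cj_def inv_mult_group m_assoc)

lemma cj_pow_right:
  "g \<in> carrier G \<Longrightarrow> h \<in> carrier G \<Longrightarrow> cj G g (h [^] (n::nat)) = cj G g h [^] n"
  by (induction n) (simp_all add: cj_mult_right)

lemma cj_cancel [simp]:
  "g \<in> carrier G \<Longrightarrow> h \<in> carrier G \<Longrightarrow> cj G (inv g) (cj G g h) = h"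
  "g \<in> carrier G \<Longrightarrow> h \<in> carrier G \<Longrightarrow> cj G g (cj G (inv g) h) = h"
  by (simp_all add: cj_def m_assoc)

lemma inj_on_cj: "g \<in> carrier G \<Longrightarrow> H \<subseteq> carrier G \<Longrightarrow> inj_on (cj G g) H"
  by (rule inj_on_inverseI[where g = "cj G (inv g)"]) auto

lemma cj_eq_one_iff [simp]: "g \<in> carrier G \<Longrightarrow> h \<in> carrier G \<Longrightarrow> cj G g h = \<one> \<longleftrightarrow> h = \<one>"
  by (metis cj_cancel(1) cj_one_right inv_closed)

lemma cj_eq_self_iff:
  assumes "g \<in> carrier G" "h \<in> carrier G"
  shows "cj G g h = h \<longleftrightarrow> g \<otimes> h = h \<otimes> g"
proof -
  have "cj G g h = h \<longleftrightarrow> h = inv g \<otimes> (h \<otimes> g)"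
    using assms by (auto simp: cj_def m_assoc)
  also have "\<dots> \<longleftrightarrow> g \<otimes> h = h \<otimes> g"
    using assms inv_solve_left[of h g "h \<otimes> g"] by auto
  finally show ?thesis .
qed

lemma ord_cj [simp]:
  assumes "g \<in> carrier G" "h \<in> carrier G"
  shows "ord (cj G g h) = ord h"
  using assms by (simp add: ord_unique pow_eq_id flip: cj_pow_right)

lemma subgroup_cj_closed:
  "subgroup H G \<Longrightarrow> g \<in> H \<Longrightarrow> h \<in> H \<Longrightarrow> cj G g h \<in> H"
  by (simp add: cj_def subgroup_closed)

lemma subgroup_pow_closed:
  "subgroup H G \<Longrightarrow> h \<in> H \<Longrightarrow> h [^] (n::nat) \<in> H"
  by (induction n) (simp_all add: subgroup.m_closed subgroup.one_closed)

lemma subgroup_cj_image: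
  assumes "subgroup H G" "g \<in> carrier G"
  shows "subgroup (cj G g ` H) G"
proof (rule subgroupI)
  show "cj G g ` H \<subseteq> carrier G" using assms subgroup.subset by fastforce
  show "cj G g ` H \<noteq> {}" using assms subgroup.one_closed by blast
  show "inv a \<in> cj G g ` H" if "a \<in> cj G g ` H" for a
    using that assms by (auto simp: subgroup.mem_carrier subgroup.m_inv_closed simp flip: cj_inv_right)
  show "a \<otimes> b \<in> cj G g ` H" if "a \<in> cj G g ` H" "b \<in> cj G g ` H" for a b
    using that assms by (auto simp: subgroup.mem_carrier subgroup.m_closed simp flip: cj_mult_right)
qed

lemma card_cj_image: "g \<in> carrier G \<Longrightarrow> H \<subseteq> carrier G \<Longrightarrow> card (cj G g ` H) = card H"
  by (rule card_image) (rule inj_on_cj)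

lemma cj_consistent: "subgroup U G \<Longrightarrow> g \<in> U \<Longrightarrow> cj (G\<lparr>carrier := U\<rparr>) g h = cj G g h"
  by (simp add: cj_def)

lemma normal_in_iff:
  assumes "subgroup K G" "subgroup H G" "H \<subseteq> K"
  shows "normal H (G\<lparr>carrier := K\<rparr>) \<longleftrightarrow> normalizes G K H"
proof
  interpret K: group "G\<lparr>carrier := K\<rparr>" using assms subgroup_imp_group by blast
  show "normalizes G K H" if "normal H (G\<lparr>carrier := K\<rparr>)"
    unfolding normalizes_def cj_def
  proof clarify
    fix k h assume kh: "k \<in> K" "h \<in> H"
    show "inv k \<otimes> h \<otimes> k \<in> H"
      using normal.inv_op_closed1[OF that, of k h] kh assms by simp
  qed
  show "normal H (G\<lparr>carrier := K\<rparr>)" if n: "normalizes G K H"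
  proof (rule K.normal_invI)
    show "subgroup H (G\<lparr>carrier := K\<rparr>)" using assms by (simp add: subgroup_incl)
    fix x h assume "x \<in> carrier (G\<lparr>carrier := K\<rparr>)" and h: "h \<in> H"
    then have x: "x \<in> K" by simp
    then have "cj G (inv x) h \<in> H"
      using n h assms by (simp add: normalizes_def subgroup.m_inv_closed)
    then show "x \<otimes>\<^bsub>G\<lparr>carrier := K\<rparr>\<^esub> h \<otimes>\<^bsub>G\<lparr>carrier := K\<rparr>\<^esub> inv\<^bsub>G\<lparr>carrier := K\<rparr>\<^esub> x \<in> H"
      using x h assms by (simp add: cj_def subgroup.mem_carrier)
  qed
qed

lemma set_mult_memI: "a \<in> A \<Longrightarrow> b \<in> B \<Longrightarrow> a \<otimes> b \<in> A <#> B"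
  by (auto simp: set_mult_def)

lemma set_mult_memE: "x \<in> A <#> B \<Longrightarrow> (\<And>a b. a \<in> A \<Longrightarrow> b \<in> B \<Longrightarrow> x = a \<otimes> b \<Longrightarrow> thesis) \<Longrightarrow> thesis"
  by (auto simp: set_mult_def)

lemma subset_set_mult:
  assumes "subgroup A G" "subgroup B G"
  shows "A \<subseteq> A <#> B" "B \<subseteq> A <#> B"
proof -
  show "A \<subseteq> A <#> B"
    using assms set_mult_memI[of _ A \<one> B] by (force simp: subgroup.one_closed subgroup.mem_carrier)
  show "B \<subseteq> A <#> B"
    using assms set_mult_memI[of \<one> A _ B] by (force simp: subgroup.one_closed subgroup.mem_carrier)
qed

lemma subgroup_set_mult:
  assumes A: "subgroup A G" and B: "subgroup B G" and n: "normalizes G B A"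
  shows "subgroup (A <#> B) G"
proof (rule subgroupI)
  show "A <#> B \<subseteq> carrier G"
    using A B by (auto simp: set_mult_def subgroup.mem_carrier)
  show "A <#> B \<noteq> {}" using subset_set_mult[OF A B] A subgroup.one_closed by blast
  show "inv x \<in> A <#> B" if "x \<in> A <#> B" for x
    using that
  proof (rule set_mult_memE)
    fix a b assume ab: "a \<in> A" "b \<in> B" "x = a \<otimes> b"
    have c: "a \<in> carrier G" "b \<in> carrier G" using ab by (simp_all add: subgroup.mem_carrier[OF A] subgroup.mem_carrier[OF B])
    have "inv x = inv (cj G (inv (inv b)) a) \<otimes> inv b"
      using c ab by (simp add: cj_def m_assoc inv_mult_group)
    moreover have "cj G (inv (inv b)) a \<in> A"
      using ab c n by (simp add: normalizes_def)
    ultimately show ?thesis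
      using ab A B by (metis set_mult_memI subgroup.m_inv_closed)
  qed
  show "x \<otimes> y \<in> A <#> B" if xy: "x \<in> A <#> B" "y \<in> A <#> B" for x y
  proof -
    obtain a b c d where e: "a \<in> A" "b \<in> B" "x = a \<otimes> b" "c \<in> A" "d \<in> B" "y = c \<otimes> d"
      using xy by (auto simp: set_mult_def)
    have m: "a \<in> carrier G" "b \<in> carrier G" "c \<in> carrier G" "d \<in> carrier G"
      using e by (simp_all add: subgroup.mem_carrier[OF A] subgroup.mem_carrier[OF B])
    have "x \<otimes> y = (a \<otimes> cj G (inv b) c) \<otimes> (b \<otimes> d)"
      using m e by (simp add: cj_def m_assoc)
    moreover have "cj G (inv b) c \<in> A"
      using e B n by (simp add: normalizes_def subgroup.m_inv_closed)
    ultimately show ?thesis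
      using e A B by (simp add: set_mult_memI subgroup.m_closed)
  qed
qed

lemma generate_subset: "subgroup H G \<Longrightarrow> x \<in> H \<Longrightarrow> generate G {x} \<subseteq> H"
  by (simp add: generate_subgroup_incl)

lemma subgroup_generate: "x \<in> carrier G \<Longrightarrow> subgroup (generate G {x}) G"
  by (simp add: generate_is_subgroup)

lemma mem_generate [simp]: "x \<in> generate G {x}"
  by (simp add: generate.incl)

lemma subgroup_Int: "subgroup A G \<Longrightarrow> subgroup B G \<Longrightarrow> subgroup (A \<inter> B) G"
  using subgroups_Inter_pair by blast

end

section \<open>Finite groups: orders, normalizers, the product formula, Sylow and Cauchy inside a
  subgroup\<close>

locale finite_group = group +
  assumes finite_carrier [simp]: "finite (carrier G)"
begin

lemma finite_subgroup: "subgroup H G \<Longrightarrow> finite H"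
  using finite_carrier finite_subset subgroup.subset by metis

lemma subgroup_card_pos: "subgroup H G \<Longrightarrow> card H > 0"
  by (simp add: subgroup.finite_imp_card_positive)

lemma finite_group_subgroup: "subgroup H G \<Longrightarrow> finite_group (G\<lparr>carrier := H\<rparr>)"
  by (simp add: finite_group_def finite_group_axioms_def subgroup_imp_group finite_subgroup)

lemma ord_pos: "x \<in> carrier G \<Longrightarrow> ord x > 0"
  using ord_ge_1[OF finite_carrier, of x] by simp

lemma mem_generate_iff: "x \<in> carrier G \<Longrightarrow> y \<in> generate G {x} \<longleftrightarrow> (\<exists>k::nat. y = x [^] k)"
  using generate_pow_nat[of x] ord_pos[of x] by auto

lemma card_subgroup_dvd:
  assumes "subgroup H G" "subgroup K G" "H \<subseteq> K"
  shows "card H dvd card K"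
proof -
  interpret K: group "G\<lparr>carrier := K\<rparr>" using assms subgroup_imp_group by blast
  have "card (rcosets\<^bsub>G\<lparr>carrier := K\<rparr>\<^esub> H) * card H = order (G\<lparr>carrier := K\<rparr>)"
    by (rule K.lagrange) (simp add: assms subgroup_incl)
  then have "card (rcosets\<^bsub>G\<lparr>carrier := K\<rparr>\<^esub> H) * card H = card K"
    by (simp add: order_def)
  then show ?thesis by (metis dvd_triv_right)
qed

lemma card_subgroup_dvd_order: "subgroup H G \<Longrightarrow> card H dvd order G"
  unfolding order_def by (rule card_subgroup_dvd) (auto simp: subgroup_self subgroup.subset)

lemma ord_dvd_card: "subgroup H G \<Longrightarrow> x \<in> H \<Longrightarrow> ord x dvd card H"
  using card_subgroup_dvd[of "generate G {x}" H] generate_subset subgroup_generate generate_pow_card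
  by (metis subgroup.mem_carrier)

lemma pow_card_eq_one: "subgroup H G \<Longrightarrow> x \<in> H \<Longrightarrow> x [^] card H = \<one>"
  by (metis ord_dvd_card pow_eq_id subgroup.mem_carrier)

lemma subgroup_card_eq_one: "subgroup H G \<Longrightarrow> card H = 1 \<longleftrightarrow> H = {\<one>}"
  by (metis card_1_singletonE is_singletonI is_singleton_altdef singletonD subgroup.one_closed)

lemma subgroup_nontrivial: "subgroup H G \<Longrightarrow> H \<noteq> {\<one>} \<longleftrightarrow> (\<exists>x\<in>H. x \<noteq> \<one>)"
  using subgroup.one_closed by blast

text \<open>By finiteness an inverse is a positive power.\<close>

lemma subgroup_of_closed:
  assumes "H \<subseteq> carrier G" "H \<noteq> {}" "\<And>a b. a \<in> H \<Longrightarrow> b \<in> H \<Longrightarrow> a \<otimes> b \<in> H"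
  shows "subgroup H G"
proof (rule subgroupI[OF assms(1,2)])
  fix a assume a: "a \<in> H"
  then have ac: "a \<in> carrier G" using assms by blast
  have pw: "a [^] Suc n \<in> H" for n
    by (induction n) (use a ac assms(3) in auto)
  show "inv a \<in> H"
  proof (cases "a = \<one>")
    case False
    \<comment> \<open>Excluding a = 1 makes the order at least 2, so that the inverse is the power
      with exponent \<open>Suc m\<close>, which is covered by \<open>pw\<close>.\<close>
    then obtain m where m: "ord a = Suc (Suc m)"
      using ord_pos[OF ac] ord_eq_1[OF ac] by (metis One_nat_def less_numeral_extra(3) nat.exhaust)
    have "a [^] Suc m \<otimes> a = \<one>"
      using pow_ord_eq_1[OF ac] m by simp
    then have "a [^] Suc m = inv a"
      using ac by (metis inv_equality nat_pow_closed)
    then show ?thesis using pw[of m] by simp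
  qed (use a in simp)
qed (use assms in auto)

lemma cj_image_eq_if_subset:
  assumes "H \<subseteq> carrier G" "g \<in> carrier G" "cj G g ` H \<subseteq> H"
  shows "cj G g ` H = H"
  using assms by (meson card_cj_image card_subset_eq finite_carrier finite_subset)

lemma normalizes_generate:
  assumes H: "H \<subseteq> carrier G" and g: "g \<in> carrier G" and n: "\<And>h. h \<in> H \<Longrightarrow> cj G g h \<in> H"
  shows "normalizes G (generate G {g}) H"
proof -
  have "cj G (g [^] (k::nat)) h \<in> H" if "h \<in> H" for k h
    by (induction k) (use that n H g in \<open>auto simp: cj_mult_left\<close>)
  then show ?thesis using g by (auto simp: normalizes_def mem_generate_iff)
qed

text \<open>This is the normalizer N_K(H). The one-sided condition suffices because conjugation is
  injective and the group is finite.\<close>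

definition normalizer_in :: "'a set \<Rightarrow> 'a set \<Rightarrow> 'a set" where
  "normalizer_in K H = {k \<in> K. \<forall>h\<in>H. cj G k h \<in> H}"

lemma subgroup_normalizer_in:
  assumes K: "subgroup K G" and H: "H \<subseteq> carrier G"
  shows "subgroup (normalizer_in K H) G"
proof (rule subgroup_of_closed)
  show "normalizer_in K H \<subseteq> carrier G"
    using K by (auto simp: normalizer_in_def subgroup.mem_carrier)
  have "\<one> \<in> normalizer_in K H"
    using K H by (auto simp: normalizer_in_def subgroup.one_closed)
  then show "normalizer_in K H \<noteq> {}" by blast
  show "a \<otimes> b \<in> normalizer_in K H" if "a \<in> normalizer_in K H" "b \<in> normalizer_in K H" for a b
    using that K H by (auto simp: normalizer_in_def subgroup.m_closed cj_mult_left subgroup.mem_carrier subsetD)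
qed

lemma normalizes_normalizer_in: "normalizes G (normalizer_in K H) H"
  by (auto simp: normalizes_def normalizer_in_def)

text \<open>Count the pairs (a,b) by their product: the fibre over ab consists of the pairs (ad,
  d^-1 b) with d in the intersection.\<close>

lemma card_set_mult:
  assumes A: "subgroup A G" and B: "subgroup B G"
  shows "card (A <#> B) * card (A \<inter> B) = card A * card B"
proof -
  have fin: "finite (A \<times> B)" using A B finite_subgroup by blast
  let ?f = "\<lambda>(a, b). a \<otimes> b"
  have img: "?f ` (A \<times> B) = A <#> B" by (force simp: set_mult_def)
  have fib: "card {z \<in> A \<times> B. ?f z = y} = card (A \<inter> B)" if y: "y \<in> A <#> B" for y
  proof -
    obtain a b where ab: "a \<in> A" "b \<in> B" "y = a \<otimes> b" using y by (auto simp: set_mult_def)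
    have c: "a \<in> carrier G" "b \<in> carrier G" using ab by (simp_all add: subgroup.mem_carrier[OF A] subgroup.mem_carrier[OF B])
    have "bij_betw (\<lambda>d. (a \<otimes> d, inv d \<otimes> b)) (A \<inter> B) {z \<in> A \<times> B. ?f z = y}"
    proof (rule bij_betw_byWitness[where f' = "\<lambda>z. inv a \<otimes> fst z"])
      show "\<forall>d\<in>A \<inter> B. inv a \<otimes> fst (a \<otimes> d, inv d \<otimes> b) = d"
        using c A by (auto simp: subgroup.mem_carrier)
      show "\<forall>z\<in>{z \<in> A \<times> B. ?f z = y}. (a \<otimes> (inv a \<otimes> fst z), inv (inv a \<otimes> fst z) \<otimes> b) = z"
      proof
        fix z assume "z \<in> {z \<in> A \<times> B. ?f z = y}"
        then obtain u v where uv: "z = (u, v)" "u \<in> A" "v \<in> B" "u \<otimes> v = y" by auto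
        have m: "u \<in> carrier G" "v \<in> carrier G"
          using uv by (simp_all add: subgroup.mem_carrier[OF A] subgroup.mem_carrier[OF B])
        have "inv u \<otimes> (u \<otimes> v) = inv u \<otimes> (a \<otimes> b)" using uv ab by simp
        then show "(a \<otimes> (inv a \<otimes> fst z), inv (inv a \<otimes> fst z) \<otimes> b) = z"
          using m c uv(1) by (simp add: inv_mult_group m_assoc)
      qed
      show "(\<lambda>d. (a \<otimes> d, inv d \<otimes> b)) ` (A \<inter> B) \<subseteq> {z \<in> A \<times> B. ?f z = y}"
        using ab c A B by (auto simp: subgroup_closed m_assoc subgroup.mem_carrier)
      show "(\<lambda>z. inv a \<otimes> fst z) ` {z \<in> A \<times> B. ?f z = y} \<subseteq> A \<inter> B"
      proof
        fix w assume "w \<in> (\<lambda>z. inv a \<otimes> fst z) ` {z \<in> A \<times> B. ?f z = y}"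
        then obtain u v where uv: "w = inv a \<otimes> u" "u \<in> A" "v \<in> B" "u \<otimes> v = y" by auto
        have m: "u \<in> carrier G" "v \<in> carrier G"
          using uv by (simp_all add: subgroup.mem_carrier[OF A] subgroup.mem_carrier[OF B])
        have "inv a \<otimes> (u \<otimes> v) \<otimes> inv v = inv a \<otimes> (a \<otimes> b) \<otimes> inv v" using uv ab by simp
        then have "inv a \<otimes> u = b \<otimes> inv v" using m c by (simp add: m_assoc)
        moreover have "inv a \<otimes> u \<in> A" "b \<otimes> inv v \<in> B"
          using uv ab A B by (simp_all add: subgroup_closed)
        ultimately show "w \<in> A \<inter> B" using uv by simp
      qed
    qed
    then show ?thesis by (rule bij_betw_same_card[symmetric])
  qed
  have "card (A \<times> B) = (\<Sum>y\<in>?f ` (A \<times> B). \<Sum>z | z \<in> A \<times> B \<and> ?f z = y. 1)"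
    using sum.image_gen[OF fin, of "\<lambda>_. 1::nat" ?f] by simp
  also have "\<dots> = (\<Sum>y\<in>A <#> B. card (A \<inter> B))"
    unfolding img using fib by (intro sum.cong) auto
  finally show ?thesis by (simp add: card_cartesian_product)
qed

lemma card_set_mult_disjoint:
  assumes "subgroup A G" "subgroup B G" "A \<inter> B = {\<one>}"
  shows "card (A <#> B) = card A * card B"
  using card_set_mult[OF assms(1,2)] assms(3) by simp

text \<open>The power need not be the full p-part, since the cofactor \<open>m\<close> may itself be
  divisible by \<open>p\<close>; k = 1 gives Cauchy's theorem.\<close>

lemma sylow_in:
  assumes p: "Factorial_Ring.prime p" and A: "subgroup A G" and d: "p ^ k dvd card A"
  shows "\<exists>S. subgroup S G \<and> S \<subseteq> A \<and> card S = p ^ k"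
proof -
  obtain m where m: "card A = p ^ k * m" using d by blast
  interpret A: finite_group "G\<lparr>carrier := A\<rparr>" using A finite_group_subgroup by blast
  have "\<exists>S. subgroup S (G\<lparr>carrier := A\<rparr>) \<and> card S = p ^ k"
    by (rule Sylow.sylow_thm[OF p, where m = m]) (use m A.finite_carrier in \<open>auto simp: order_def\<close>)
  then show ?thesis
    using A incl_subgroup subgroup.subset by fastforce
qed

lemma cauchy_in:
  assumes p: "Factorial_Ring.prime p" and A: "subgroup A G" and d: "p dvd card A"
  shows "\<exists>x\<in>A. ord x = p"
proof -
  obtain S where S: "subgroup S G" "S \<subseteq> A" "card S = p"
    using sylow_in[OF p A, of 1] d by auto
  have "card S \<noteq> 1" using S p by auto
  then obtain x where x: "x \<in> S" "x \<noteq> \<one>"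
    using S subgroup_card_eq_one subgroup_nontrivial by blast
  then have xc: "x \<in> carrier G" using S subgroup.mem_carrier by auto
  have "ord x dvd p" using ord_dvd_card[of S x] S x by simp
  then have "ord x = p" using x xc p ord_eq_1[OF xc] prime_nat_iff by blast
  then show ?thesis using x S by blast
qed

end

section \<open>Actions of p-groups\<close>

lemma card_eq_card_Diff_plus:
  assumes "finite A" "B \<subseteq> A"
  shows "card A = card (A - B) + card B"
  using assms by (simp add: card_Diff_subset card_mono finite_subset)

context finite_group
begin

text \<open>The fibre of g -> f g x over f k x is the coset of the stabilizer through k, so all
  fibres have the same size.\<close>

lemma orbit_stabilizer:
  assumes S: "subgroup S G"
    and act_one: "f \<one> x = x"
    and act_mult: "\<And>g h. g \<in> S \<Longrightarrow> h \<in> S \<Longrightarrow> f (g \<otimes> h) x = f h (f g x)"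
  shows "card S = card ((\<lambda>g. f g x) ` S) * card {g \<in> S. f g x = x}"
proof -
  have fin: "finite S" using S finite_subgroup by blast
  have fib: "card {g \<in> S. f g x = y} = card {g \<in> S. f g x = x}" if y: "y \<in> (\<lambda>g. f g x) ` S" for y
  proof -
    obtain k where k: "k \<in> S" "y = f k x" using y by blast
    have kc: "k \<in> carrier G" using S k(1) by (rule subgroup.mem_carrier)
    have undo: "f (inv k) y = x"
      using act_mult[OF k(1), of "inv k"] k S kc act_one by (simp add: subgroup.m_inv_closed)
    have "bij_betw (\<lambda>g. g \<otimes> k) {g \<in> S. f g x = x} {g \<in> S. f g x = y}"
    proof (rule bij_betw_byWitness[where f' = "\<lambda>g. g \<otimes> inv k"])
      show "\<forall>g\<in>{g \<in> S. f g x = x}. g \<otimes> k \<otimes> inv k = g"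
        using kc S by (auto simp: m_assoc subgroup.mem_carrier)
      show "\<forall>g\<in>{g \<in> S. f g x = y}. g \<otimes> inv k \<otimes> k = g"
        using kc S by (auto simp: m_assoc subgroup.mem_carrier)
      show "(\<lambda>g. g \<otimes> k) ` {g \<in> S. f g x = x} \<subseteq> {g \<in> S. f g x = y}"
        using k S by (auto simp: subgroup.m_closed act_mult)
      show "(\<lambda>g. g \<otimes> inv k) ` {g \<in> S. f g x = y} \<subseteq> {g \<in> S. f g x = x}"
        using k S undo by (auto simp: subgroup_closed act_mult)
    qed
    then show ?thesis by (rule bij_betw_same_card[symmetric])
  qed
  have "card S = (\<Sum>y\<in>(\<lambda>g. f g x) ` S. \<Sum>g | g \<in> S \<and> f g x = y. 1)"
    using sum.image_gen[OF fin, of "\<lambda>_. 1::nat" "\<lambda>g. f g x"] by simp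
  also have "\<dots> = (\<Sum>y\<in>(\<lambda>g. f g x) ` S. card {g \<in> S. f g x = x})"
    using fib by (intro sum.cong) auto
  finally show ?thesis by simp
qed

text \<open>The moved points split into orbits of size p^k with k > 0. Counting moved rather than
  fixed points serves both uses: a fixed point exists if p does not divide |E|, and a second one if
  p divides |E| and one is known.\<close>

lemma prime_dvd_card_non_fixed:
  assumes S: "subgroup S G" and card: "card S = p ^ n" and p: "Factorial_Ring.prime p"
    and fin: "finite E"
    and act_closed: "\<And>g x. g \<in> S \<Longrightarrow> x \<in> E \<Longrightarrow> f g x \<in> E"
    and act_one: "\<And>x. x \<in> E \<Longrightarrow> f \<one> x = x"
    and act_mult: "\<And>g h x. g \<in> S \<Longrightarrow> h \<in> S \<Longrightarrow> x \<in> E \<Longrightarrow> f (g \<otimes> h) x = f h (f g x)"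
  shows "p dvd card (E - {x \<in> E. \<forall>g\<in>S. f g x = x})"
proof -
  define Y where "Y = E - {x \<in> E. \<forall>g\<in>S. f g x = x}"
  define O' where "O' x = (\<lambda>g. f g x) ` S" for x
  have undo: "f (inv g) (f g x) = x" if "g \<in> S" "x \<in> E" for g x
    using act_mult[of g "inv g" x] that S act_one by (simp add: subgroup.m_inv_closed subgroup.mem_carrier)
  have self: "x \<in> O' x" if "x \<in> E" for x
    using that act_one S unfolding O'_def by (metis imageI subgroup.one_closed)
  have step: "O' (f g x) = O' x" if g: "g \<in> S" and x: "x \<in> E" for g x
  proof
    show "O' (f g x) \<subseteq> O' x"
    proof
      fix y assume "y \<in> O' (f g x)"
      then obtain h where h: "h \<in> S" "y = f h (f g x)" by (auto simp: O'_def)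
      then have "y = f (g \<otimes> h) x" using act_mult[OF g h(1) x] by simp
      moreover have "g \<otimes> h \<in> S" using S g h(1) by (rule subgroup.m_closed)
      ultimately show "y \<in> O' x" unfolding O'_def by (rule image_eqI)
    qed
    show "O' x \<subseteq> O' (f g x)"
    proof
      fix y assume "y \<in> O' x"
      then obtain h where h: "h \<in> S" "y = f h x" by (auto simp: O'_def)
      have ig: "inv g \<in> S" using S g by (rule subgroup.m_inv_closed)
      then have "y = f (inv g \<otimes> h) (f g x)"
        using act_mult[OF ig h(1) act_closed[OF g x]] undo[OF g x] h by simp
      moreover have "inv g \<otimes> h \<in> S" using S ig h(1) by (rule subgroup.m_closed)
      ultimately show "y \<in> O' (f g x)" unfolding O'_def by (rule image_eqI)
    qed
  qed
  have clos: "f g x \<in> Y" if g: "g \<in> S" and x: "x \<in> Y" for g x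
  proof -
    have xX: "x \<in> E" using x by (simp add: Y_def)
    have "\<exists>h\<in>S. f h (f g x) \<noteq> f g x"
    proof (rule ccontr)
      assume "\<not> ?thesis"
      then have fx: "f h (f g x) = f g x" if "h \<in> S" for h using that by blast
      have e: "f g x = x" using fx[of "inv g"] g S undo xX by (simp add: subgroup.m_inv_closed)
      have "x \<in> {x \<in> E. \<forall>g\<in>S. f g x = x}" using fx e xX by simp
      then show False using x by (simp add: Y_def)
    qed
    then show ?thesis using act_closed g xX by (auto simp: Y_def)
  qed
  have "p dvd card (\<Union> (O' ` Y))"
  proof (rule dvd_partition)
    have sub: "\<Union> (O' ` Y) \<subseteq> Y" using clos by (auto simp: O'_def)
    then show "finite (\<Union> (O' ` Y))" by (rule finite_subset) (simp add: fin Y_def)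
    show "\<forall>c\<in>O' ` Y. p dvd card c"
    proof clarify
      fix x assume x: "x \<in> Y"
      have xX: "x \<in> E" using x by (simp add: Y_def)
      have "card S = card (O' x) * card {g \<in> S. f g x = x}"
        unfolding O'_def using S act_one act_mult xX by (intro orbit_stabilizer) auto
      then have "card (O' x) dvd p ^ n" using card by (metis dvd_triv_left)
      then obtain k where k: "card (O' x) = p ^ k"
        using divides_primepow_nat[OF p] by metis
      show "p dvd card (O' x)"
      proof (cases k)
        case 0
        then have "card (O' x) = 1" using k by simp
        then obtain z where z: "O' x = {z}" by (rule card_1_singletonE)
        then have "f g x = x" if "g \<in> S" for g
          using self[OF xX] that by (auto simp: O'_def)
        then show ?thesis using x by (auto simp: Y_def)
      qed (use k in simp)
    qed
    show "\<forall>c1\<in>O' ` Y. \<forall>c2\<in>O' ` Y. c1 \<noteq> c2 \<longrightarrow> c1 \<inter> c2 = {}"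
    proof clarify
      fix x y assume x: "x \<in> Y" and y: "y \<in> Y" and ne: "O' x \<noteq> O' y"
      have "x \<in> E" "y \<in> E" using x y by (auto simp: Y_def)
      then have "O' z = O' x" if "z \<in> O' x" for z
        using that step unfolding O'_def by force
      moreover have "O' z = O' y" if "z \<in> O' y" for z
        using that step \<open>y \<in> E\<close> unfolding O'_def by force
      ultimately show "O' x \<inter> O' y = {}" using ne by blast
    qed
  qed
  moreover have "\<Union> (O' ` Y) = Y"
  proof
    show "\<Union> (O' ` Y) \<subseteq> Y" using clos by (auto simp: O'_def)
    show "Y \<subseteq> \<Union> (O' ` Y)" using self by (auto simp: Y_def)
  qed
  ultimately show ?thesis by (simp add: Y_def)
qed

text \<open>Under conjugation by \<open>S\<close> the number of fixed points in \<open>N\<close> is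
  a multiple of p, and 1 is one of them. N = S gives a nontrivial centre; S generated by an element
  of order p gives a fixed point of that element in \<open>N\<close>.\<close>

lemma ex_central_fixed:
  assumes S: "subgroup S G" and card: "card S = p ^ n" and p: "Factorial_Ring.prime p"
    and N: "subgroup N G" and pN: "p dvd card N" and n: "normalizes G S N"
  shows "\<exists>z\<in>N. z \<noteq> \<one> \<and> (\<forall>s\<in>S. s \<otimes> z = z \<otimes> s)"
proof -
  let ?F = "{x \<in> N. \<forall>g\<in>S. cj G g x = x}"
  have sc: "x \<in> carrier G" if "x \<in> S" for x using S that by (rule subgroup.mem_carrier)
  have nc: "x \<in> carrier G" if "x \<in> N" for x using N that by (rule subgroup.mem_carrier)
  have finN: "finite N" using N finite_subgroup by blast
  have "p dvd card (N - ?F)"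
    by (rule prime_dvd_card_non_fixed[OF S card p finN])
      (use n sc nc in \<open>auto simp: normalizes_def cj_mult_left\<close>)
  moreover have "card N = card (N - ?F) + card ?F"
    using finN by (intro card_eq_card_Diff_plus) auto
  ultimately have pF: "p dvd card ?F" using pN by (simp add: dvd_add_right_iff)
  have "\<one> \<in> ?F" using N sc by (auto simp: subgroup.one_closed)
  have "?F \<noteq> {\<one>}" using pF p by auto
  then obtain z where "z \<in> ?F" "z \<noteq> \<one>" using \<open>\<one> \<in> ?F\<close> by blast
  then show ?thesis using cj_eq_self_iff sc nc by auto
qed

lemma prime_dvd_card_non_fixed_cosets:
  assumes S: "subgroup S G" and card: "card S = p ^ n" and p: "Factorial_Ring.prime p"
    and K: "subgroup K G" and SK: "S \<subseteq> K" and M: "subgroup M G" and MK: "M \<subseteq> K"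
  shows "p dvd card ((\<lambda>k. M #> k) ` K - {E \<in> (\<lambda>k. M #> k) ` K. \<forall>g\<in>S. E #> g = E})"
proof (rule prime_dvd_card_non_fixed[OF S card p])
  have sc: "x \<in> carrier G" if "x \<in> K" for x using K that by (rule subgroup.mem_carrier)
  have Mc: "M \<subseteq> carrier G" using M by (rule subgroup.subset)
  show "finite ((\<lambda>k. M #> k) ` K)" using K finite_subgroup by blast
  show "E #> g \<in> (\<lambda>k. M #> k) ` K" if "g \<in> S" "E \<in> (\<lambda>k. M #> k) ` K" for g E
    using that SK K sc Mc by (auto simp: coset_mult_assoc subgroup.m_closed subsetD)
  show "E #> \<one> = E" if "E \<in> (\<lambda>k. M #> k) ` K" for E
    using that sc Mc by (auto simp: r_coset_subset_G)
  show "E #> (g \<otimes> h) = E #> g #> h" if "g \<in> S" "h \<in> S" "E \<in> (\<lambda>k. M #> k) ` K" for E g h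
    using that sc Mc SK by (auto simp: coset_mult_assoc subsetD r_coset_subset_G m_assoc)
qed

lemma card_cosets_in:
  assumes K: "subgroup K G" and M: "subgroup M G" and MK: "M \<subseteq> K"
  shows "card ((\<lambda>k. M #> k) ` K) * card M = card K"
proof -
  interpret K: finite_group "G\<lparr>carrier := K\<rparr>" using K finite_group_subgroup by blast
  have "rcosets\<^bsub>G\<lparr>carrier := K\<rparr>\<^esub> M = (\<lambda>k. M #> k) ` K"
    by (auto simp: RCOSETS_def)
  then show ?thesis
    using K.lagrange[OF subgroup_incl[OF M K MK]] by (simp add: order_def)
qed

text \<open>\<open>cj G (inv k) g\<close> is k g k^-1. This turns fixed cosets of right
  multiplication into statements about conjugates.\<close>

lemma fixed_coset_iff:
  assumes M: "subgroup M G" and k: "k \<in> carrier G" and g: "g \<in> carrier G"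
  shows "M #> k #> g = M #> k \<longleftrightarrow> cj G (inv k) g \<in> M"
proof -
  have Mc: "M \<subseteq> carrier G" using M by (rule subgroup.subset)
  have "M #> k #> g = M #> k \<longleftrightarrow> M #> (k \<otimes> g) = M #> k"
    using k g Mc by (simp add: coset_mult_assoc)
  also have "\<dots> \<longleftrightarrow> k \<otimes> g \<in> M #> k"
  proof
    show "k \<otimes> g \<in> M #> k" if "M #> (k \<otimes> g) = M #> k"
      using rcos_self[of "k \<otimes> g" M] that k g M by simp
    show "M #> (k \<otimes> g) = M #> k" if "k \<otimes> g \<in> M #> k"
      using repr_independence[OF that k M] by simp
  qed
  also have "\<dots> \<longleftrightarrow> cj G (inv k) g \<in> M"
    using subgroup.rcos_module[OF M group_axioms, of k "k \<otimes> g"] k g by (simp add: cj_def)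
  finally show ?thesis .
qed

text \<open>\<open>R\<close> acts on the right cosets of \<open>Q\<close> in \<open>K\<close>, whose
  number is prime to p; a fixed coset Qk means that k R k^-1 lies in \<open>Q\<close>.\<close>

lemma sylow_conjugate:
  assumes p: "Factorial_Ring.prime p" and K: "subgroup K G"
    and Q: "subgroup Q G" "Q \<subseteq> K" "\<not> p dvd card ((\<lambda>k. Q #> k) ` K)"
    and R: "subgroup R G" "R \<subseteq> K" "card R = p ^ n"
  shows "\<exists>k\<in>K. \<forall>x\<in>R. cj G (inv k) x \<in> Q"
proof -
  let ?E = "(\<lambda>k. Q #> k) ` K"
  let ?F = "{E \<in> ?E. \<forall>g\<in>R. E #> g = E}"
  have "p dvd card (?E - ?F)"
    by (rule prime_dvd_card_non_fixed_cosets[OF R(1,3) p K R(2) Q(1,2)])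
  then have "?F \<noteq> {}" using Q(3) by (metis Diff_empty)
  then obtain k where k: "k \<in> K" "\<forall>g\<in>R. Q #> k #> g = Q #> k" by auto
  have "cj G (inv k) g \<in> Q" if "g \<in> R" for g
    using k that fixed_coset_iff[OF Q(1), of k g] K R by (auto simp: subgroup.mem_carrier)
  then show ?thesis using k(1) by blast
qed

text \<open>\<open>M\<close> acts on its own right cosets in the p-group \<open>S\<close>. Their
  number is divisible by p and the coset \<open>M\<close> is fixed, so another coset is fixed
  too.\<close>

lemma normalizer_grows:
  assumes S: "subgroup S G" "card S = p ^ n" and p: "Factorial_Ring.prime p"
    and M: "subgroup M G" "M \<subseteq> S" "M \<noteq> S"
  shows "\<exists>k\<in>S - M. \<forall>h\<in>M. cj G k h \<in> M"
proof -
  let ?E = "(\<lambda>k. M #> k) ` S"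
  let ?F = "{E \<in> ?E. \<forall>g\<in>M. E #> g = E}"
  have fin: "finite ?E" using S finite_subgroup by blast
  have eq: "card ?E * card M = p ^ n" using card_cosets_in[OF S(1) M(1,2)] S by simp
  then have "card M dvd p ^ n" "card ?E dvd p ^ n" by (metis dvd_triv_right, metis dvd_triv_left)
  then obtain m l where m: "card M = p ^ m" "card ?E = p ^ l"
    using divides_primepow_nat[OF p] by metis
  have "card ?E \<noteq> 1"
    using eq M S finite_subgroup[OF S(1)] by (metis card_subset_eq mult_1)
  then have pX: "p dvd card ?E" using m by (cases l) auto
  have "p dvd card (?E - ?F)"
    by (rule prime_dvd_card_non_fixed_cosets[OF M(1) m(1) p S(1) M(2) M(1) M(2)])
  moreover have "card ?E = card (?E - ?F) + card ?F"
    using fin by (intro card_eq_card_Diff_plus) auto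
  ultimately have pF: "p dvd card ?F" using pX by (simp add: dvd_add_right_iff)
  have Mc: "M \<subseteq> carrier G" using M(1) by (rule subgroup.subset)
  have MF: "M \<in> ?F"
  proof -
    have "M = M #> \<one>" using Mc by simp
    moreover have "M #> g = M" if "g \<in> M" for g
      using that M by (simp add: coset_join2 subgroup.mem_carrier)
    ultimately show ?thesis using S by (auto simp: subgroup.one_closed)
  qed
  have "?F \<noteq> {M}" using pF p by auto
  then obtain E where E: "E \<in> ?F" "E \<noteq> M" using MF by blast
  then obtain k where k: "k \<in> S" "E = M #> k" by auto
  have kc: "k \<in> carrier G" using S(1) k(1) by (rule subgroup.mem_carrier)
  have kM: "k \<notin> M" using E k M by (metis coset_join2 kc)
  have c: "cj G (inv k) h \<in> M" if "h \<in> M" for h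
    using E k that fixed_coset_iff[OF M(1) kc, of h] M by (auto simp: subgroup.mem_carrier)
  \<comment> \<open>A fixed coset Mk gives k M k^-1 inside \<open>M\<close>; in the convention of
    \<open>cj\<close> the witness is therefore the inverse of k.\<close>
  have "inv k \<in> S - M"
    using k kM S M kc by (metis DiffI inv_inv subgroup.m_inv_closed Diff_iff)
  then show ?thesis using c by blast
qed

text \<open>With ord x = p^e m and m prime to p, the Chinese remainder theorem gives exponents a =
  1, b = 0 modulo p^e and a = 0, b = 1 modulo m; then a + b = 1 modulo ord x.\<close>

lemma prime_part_decomposition:
  assumes x: "x \<in> carrier G" and p: "Factorial_Ring.prime p"
  shows "\<exists>(a::nat) (b::nat) k. x = x [^] a \<otimes> x [^] b \<and> ord (x [^] a) = p ^ k \<and> \<not> p dvd ord (x [^] b)"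
proof -
  have n: "ord x \<noteq> 0" using ord_pos[OF x] by simp
  obtain e m where m: "ord x = p ^ e * m" "\<not> p dvd m"
    using multiplicity_decompose'[of "ord x" p] n p
    by (metis not_prime_unit)
  have co: "coprime (p ^ e) m" using m(2) p by (simp add: prime_imp_coprime)
  obtain a where a: "[a = 1] (mod p ^ e)" "[a = 0] (mod m)"
    using binary_chinese_remainder_nat[OF co] by blast
  obtain b where b: "[b = 0] (mod p ^ e)" "[b = 1] (mod m)"
    using binary_chinese_remainder_nat[OF co] by blast
  have "[a + b = 1] (mod p ^ e)" using cong_add[OF a(1) b(1)] by simp
  moreover have "[a + b = 1] (mod m)" using cong_add[OF a(2) b(2)] by simp
  ultimately have "[a + b = 1] (mod ord x)"
    unfolding m(1) using co by (intro coprime_cong_mult_nat)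
  then have "x [^] (a + b) = x [^] (1::nat)"
    using x int_pow_eq[of x "int (a + b)" "int 1"] by (metis cong_iff_dvd_diff cong_int_iff cong_sym_eq int_pow_int)
  then have xe: "x = x [^] a \<otimes> x [^] b" using x by (simp add: nat_pow_mult)
  have "(x [^] a) [^] (p ^ e) = \<one>"
    using x a m by (simp add: nat_pow_pow pow_eq_id cong_0_iff mult.commute mult_dvd_mono)
  then have "ord (x [^] a) dvd p ^ e" using x by (simp add: pow_eq_id)
  then obtain k where k: "ord (x [^] a) = p ^ k" using divides_primepow_nat[OF p] by metis
  have "(x [^] b) [^] m = \<one>"
    using x b m by (simp add: nat_pow_pow pow_eq_id cong_0_iff mult_dvd_mono)
  then have "ord (x [^] b) dvd m" using x by (simp add: pow_eq_id)
  then have "\<not> p dvd ord (x [^] b)" using m(2) dvd_trans by blast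
  then show ?thesis using xe k by blast
qed

lemma subgroup_card_prime_power:
  assumes "subgroup A G" "subgroup B G" "A \<subseteq> B" "card B = p ^ n" "Factorial_Ring.prime p"
  shows "\<exists>m. card A = p ^ m"
  using card_subgroup_dvd[OF assms(1-3)] assms(4,5) divides_primepow_nat by metis

lemma card_sylow_max:
  assumes p: "Factorial_Ring.prime p" and P: "sylow_sub G p P" and R: "subgroup R G" "card R = p ^ n"
    and PR: "P \<subseteq> R"
  shows "R = P"
proof -
  have "p ^ n dvd order G" using card_subgroup_dvd_order[OF R(1)] R(2) by simp
  moreover have "order G \<noteq> 0" using order_gt_0_iff_finite by simp
  ultimately have "n \<le> multiplicity p (order G)"
    using p by (metis multiplicity_geI not_prime_unit)
  then have "card R \<le> card P" using R P p by (simp add: sylow_sub_def power_increasing Suc_le_eq prime_gt_0_nat)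
  then show ?thesis using PR finite_subgroup[OF R(1)] card_seteq by blast
qed

end

section \<open>Transfer\<close>

definition malnormal_in :: "('a, 'b) monoid_scheme \<Rightarrow> 'a set \<Rightarrow> 'a set \<Rightarrow> bool" where
  "malnormal_in G U C \<longleftrightarrow> subgroup C G \<and> C \<subseteq> U \<and>
     (\<forall>g\<in>U. \<forall>x\<in>C. x \<noteq> \<one>\<^bsub>G\<^esub> \<longrightarrow> cj G g x \<in> C \<longrightarrow> g \<in> C)"

lemma malnormal_inD:
  "malnormal_in G U C \<Longrightarrow> g \<in> U \<Longrightarrow> x \<in> C \<Longrightarrow> x \<noteq> \<one>\<^bsub>G\<^esub> \<Longrightarrow> cj G g x \<in> C \<Longrightarrow> g \<in> C"
  by (auto simp: malnormal_in_def)

text \<open>For normal \<open>N\<close> this says that C/N is abelian, without forming the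
  quotient.\<close>

definition abelian_mod :: "('a, 'b) monoid_scheme \<Rightarrow> 'a set \<Rightarrow> 'a set \<Rightarrow> bool" where
  "abelian_mod G C N \<longleftrightarrow> (\<forall>a\<in>C. \<forall>b\<in>C. \<exists>n\<in>N. a \<otimes>\<^bsub>G\<^esub> b = n \<otimes>\<^bsub>G\<^esub> (b \<otimes>\<^bsub>G\<^esub> a))"

text \<open>In the application \<open>G\<close> is a subgroup U of the ambient group,
  \<open>A\<close> is an abelian quotient C/N and \<phi> is the projection.\<close>

locale transfer_setup = finite_group G + A: comm_group A
  for G (structure) and A :: "('c, 'd) monoid_scheme" +
  fixes C :: "'a set" and \<phi> :: "'a \<Rightarrow> 'c"
  assumes C: "subgroup C G"
    and phi_closed [simp]: "c \<in> C \<Longrightarrow> \<phi> c \<in> carrier A"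
    and phi_mult: "c \<in> C \<Longrightarrow> d \<in> C \<Longrightarrow> \<phi> (c \<otimes> d) = \<phi> c \<otimes>\<^bsub>A\<^esub> \<phi> d"
begin

definition rep :: "('a set \<Rightarrow> 'a) \<Rightarrow> bool" where
  "rep r \<longleftrightarrow> (\<forall>E\<in>rcosets C. r E \<in> E)"

text \<open>The classical transfer homomorphism computed with the representatives \<open>r\<close>:
  the argument of \<phi> is the c in \<open>C\<close> with r(E) g = c r(Eg). The prefix records the
  dependence on \<open>r\<close>, which \<open>pre_transfer_indep\<close> removes.\<close>

definition pre_transfer :: "('a set \<Rightarrow> 'a) \<Rightarrow> 'a \<Rightarrow> 'c" where
  "pre_transfer r g =
     finprod A (\<lambda>E. \<phi> (r E \<otimes> g \<otimes> inv (r (E #> g)))) (rcosets C)"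

lemma C_carrier: "c \<in> C \<Longrightarrow> c \<in> carrier G"
  using C by (rule subgroup.mem_carrier)

lemma phi_one [simp]: "\<phi> \<one> = \<one>\<^bsub>A\<^esub>"
proof -
  have o: "\<one> \<in> C" using C by (rule subgroup.one_closed)
  then have "\<phi> \<one> \<otimes>\<^bsub>A\<^esub> \<phi> \<one> = \<phi> \<one>" using phi_mult[of "\<one>" "\<one>"] by simp
  then show ?thesis using o by simp
qed

lemma coset_subset: "E \<in> rcosets C \<Longrightarrow> E \<subseteq> carrier G"
  using C by (simp add: subgroup.rcosets_carrier[OF C group_axioms])

lemma finite_cosets: "finite (rcosets C)"
  using finite_carrier by (auto simp: RCOSETS_def)

lemma coset_move: "E \<in> rcosets C \<Longrightarrow> g \<in> carrier G \<Longrightarrow> E #> g \<in> rcosets C"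
  using subgroup.subset[OF C] by (auto simp: RCOSETS_def coset_mult_assoc)

lemma coset_move_mult:
  "E \<in> rcosets C \<Longrightarrow> g \<in> carrier G \<Longrightarrow> h \<in> carrier G \<Longrightarrow> E #> g #> h = E #> (g \<otimes> h)"
  using coset_subset by (simp add: coset_mult_assoc)

lemma coset_diff:
  assumes "E \<in> rcosets C" "x \<in> E" "y \<in> E"
  shows "x \<otimes> inv y \<in> C"
proof -
  obtain g where g: "g \<in> carrier G" "E = C #> g" using assms(1) by (auto simp: RCOSETS_def)
  obtain c d where "c \<in> C" "d \<in> C" "x = c \<otimes> g" "y = d \<otimes> g"
    using assms g by (auto simp: r_coset_def)
  then show ?thesis
    using g C C_carrier by (simp add: inv_mult_group m_assoc subgroup_closed)
qed

lemma rep_carrier: "rep r \<Longrightarrow> E \<in> rcosets C \<Longrightarrow> r E \<in> carrier G"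
  using coset_subset by (auto simp: rep_def)

lemma rep_term:
  assumes r: "rep r" and E: "E \<in> rcosets C" and g: "g \<in> carrier G"
  shows "r E \<otimes> g \<otimes> inv (r (E #> g)) \<in> C"
proof (rule coset_diff[OF coset_move[OF E g]])
  have "r E \<in> E" using r E by (simp add: rep_def)
  then show "r E \<otimes> g \<in> E #> g" by (auto simp: r_coset_def)
  show "r (E #> g) \<in> E #> g" using r coset_move[OF E g] by (simp add: rep_def)
qed

text \<open>Right multiplication by g permutes the cosets.\<close>

lemma finprod_move:
  assumes f: "f \<in> rcosets C \<rightarrow> carrier A" and g: "g \<in> carrier G"
  shows "finprod A (\<lambda>E. f (E #> g)) (rcosets C) = finprod A f (rcosets C)"
proof -
  let ?h = "\<lambda>E. E #> g"
  have undo: "E #> g #> inv g = E" "E #> inv g #> g = E" if "E \<in> rcosets C" for E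
    using that g coset_subset[OF that] by (simp_all add: coset_move_mult)
  have inj: "inj_on ?h (rcosets C)"
    by (rule inj_on_inverseI[where g = "\<lambda>E. E #> inv g"]) (simp add: undo)
  have img: "?h ` (rcosets C) = rcosets C"
  proof
    show "?h ` (rcosets C) \<subseteq> rcosets C" using g coset_move by blast
    show "rcosets C \<subseteq> ?h ` (rcosets C)"
    proof
      fix E assume E: "E \<in> rcosets C"
      then show "E \<in> ?h ` (rcosets C)"
        using undo(2)[OF E] coset_move[OF E, of "inv g"] g by (intro image_eqI[of _ _ "E #> inv g"]) auto
    qed
  qed
  show ?thesis using A.finprod_reindex[OF _ inj, of f] f img by simp
qed

lemma pre_transfer_closed: "rep r \<Longrightarrow> g \<in> carrier G \<Longrightarrow> pre_transfer r g \<in> carrier A"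
  unfolding pre_transfer_def using rep_term by (intro A.finprod_closed) auto

text \<open>The factor of gh at E is the factor of g at E times that of h at Eg; the second product
  is then reindexed along E -> Eg.\<close>

lemma pre_transfer_mult:
  assumes r: "rep r" and g: "g \<in> carrier G" and h: "h \<in> carrier G"
  shows "pre_transfer r (g \<otimes> h) = pre_transfer r g \<otimes>\<^bsub>A\<^esub> pre_transfer r h"
proof -
  let ?t = "\<lambda>g E. r E \<otimes> g \<otimes> inv (r (E #> g))"
  have "pre_transfer r (g \<otimes> h) = finprod A (\<lambda>E. \<phi> (?t g E) \<otimes>\<^bsub>A\<^esub> \<phi> (?t h (E #> g))) (rcosets C)"
    unfolding pre_transfer_def
  proof (rule A.finprod_cong')
    show "(\<lambda>E. \<phi> (?t g E) \<otimes>\<^bsub>A\<^esub> \<phi> (?t h (E #> g))) \<in> rcosets C \<rightarrow> carrier A"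
      using r g h rep_term coset_move by simp
    fix E assume E: "E \<in> rcosets C"
    have e: "?t (g \<otimes> h) E = ?t g E \<otimes> ?t h (E #> g)"
      using E g h rep_carrier[OF r] coset_move by (simp add: coset_move_mult m_assoc)
    show "\<phi> (?t (g \<otimes> h) E) = \<phi> (?t g E) \<otimes>\<^bsub>A\<^esub> \<phi> (?t h (E #> g))"
      unfolding e using r E g h by (intro phi_mult rep_term coset_move)
  qed simp
  also have "\<dots> = pre_transfer r g \<otimes>\<^bsub>A\<^esub> finprod A (\<lambda>E. \<phi> (?t h (E #> g))) (rcosets C)"
    unfolding pre_transfer_def using r g h rep_term coset_move by (intro A.finprod_multf) auto
  also have "finprod A (\<lambda>E. \<phi> (?t h (E #> g))) (rcosets C) = pre_transfer r h"
    unfolding pre_transfer_def using r g h rep_term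
    by (intro finprod_move[where f = "\<lambda>E. \<phi> (?t h E)"]) auto
  finally show ?thesis .
qed

text \<open>With u(E) = r(E) s(E)^-1 in \<open>C\<close>, the factor for r at E is u(E) times the
  factor for s times u(Eg)^-1. Reindexing the last terms cancels them against the first, since
  \<open>A\<close> is commutative.\<close>

lemma pre_transfer_indep:
  assumes r: "rep r" and s: "rep s" and g: "g \<in> carrier G"
  shows "pre_transfer r g = pre_transfer s g"
proof -
  let ?R = "rcosets C"
  let ?t = "\<lambda>r E. r E \<otimes> g \<otimes> inv (r (E #> g))"
  let ?u = "\<lambda>E. r E \<otimes> inv (s E)" and ?v = "\<lambda>E. s E \<otimes> inv (r E)"
  have u: "?u E \<in> C" and v: "?v E \<in> C" if "E \<in> ?R" for E
    using that r s coset_diff by (auto simp: rep_def)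
  have "pre_transfer r g = finprod A (\<lambda>E. \<phi> (?u E) \<otimes>\<^bsub>A\<^esub> \<phi> (?t s E) \<otimes>\<^bsub>A\<^esub> \<phi> (?v (E #> g))) ?R"
    unfolding pre_transfer_def
  proof (rule A.finprod_cong')
    show "(\<lambda>E. \<phi> (?u E) \<otimes>\<^bsub>A\<^esub> \<phi> (?t s E) \<otimes>\<^bsub>A\<^esub> \<phi> (?v (E #> g))) \<in> ?R \<rightarrow> carrier A"
      using s g u v rep_term coset_move by auto
    fix E assume E: "E \<in> ?R"
    have e: "?t r E = ?u E \<otimes> ?t s E \<otimes> ?v (E #> g)"
      using E g rep_carrier[OF r] rep_carrier[OF s] coset_move by (simp add: m_assoc)
    show "\<phi> (?t r E) = \<phi> (?u E) \<otimes>\<^bsub>A\<^esub> \<phi> (?t s E) \<otimes>\<^bsub>A\<^esub> \<phi> (?v (E #> g))"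
      unfolding e using s E g u v C rep_term[OF s E g] coset_move[OF E g]
      by (simp add: phi_mult subgroup.m_closed)
  qed simp
  also have "\<dots> = finprod A (\<lambda>E. \<phi> (?u E)) ?R \<otimes>\<^bsub>A\<^esub> pre_transfer s g
      \<otimes>\<^bsub>A\<^esub> finprod A (\<lambda>E. \<phi> (?v (E #> g))) ?R"
  proof -
    have "finprod A (\<lambda>E. \<phi> (?u E) \<otimes>\<^bsub>A\<^esub> \<phi> (?t s E) \<otimes>\<^bsub>A\<^esub> \<phi> (?v (E #> g))) ?R
       = finprod A (\<lambda>E. \<phi> (?u E) \<otimes>\<^bsub>A\<^esub> \<phi> (?t s E)) ?R \<otimes>\<^bsub>A\<^esub> finprod A (\<lambda>E. \<phi> (?v (E #> g))) ?R"
      using s g u v rep_term coset_move by (intro A.finprod_multf) auto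
    moreover have "finprod A (\<lambda>E. \<phi> (?u E) \<otimes>\<^bsub>A\<^esub> \<phi> (?t s E)) ?R
       = finprod A (\<lambda>E. \<phi> (?u E)) ?R \<otimes>\<^bsub>A\<^esub> pre_transfer s g"
      unfolding pre_transfer_def using s g u v rep_term coset_move by (intro A.finprod_multf) auto
    ultimately show ?thesis by simp
  qed
  also have "finprod A (\<lambda>E. \<phi> (?v (E #> g))) ?R = finprod A (\<lambda>E. \<phi> (?v E)) ?R"
    using v g by (intro finprod_move[where f = "\<lambda>E. \<phi> (?v E)"]) auto
  also have "finprod A (\<lambda>E. \<phi> (?u E)) ?R \<otimes>\<^bsub>A\<^esub> pre_transfer s g \<otimes>\<^bsub>A\<^esub> finprod A (\<lambda>E. \<phi> (?v E)) ?R
      = pre_transfer s g \<otimes>\<^bsub>A\<^esub> finprod A (\<lambda>E. \<phi> (?u E) \<otimes>\<^bsub>A\<^esub> \<phi> (?v E)) ?R"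
  proof -
    have uc: "(\<lambda>E. \<phi> (?u E)) \<in> ?R \<rightarrow> carrier A" and vc: "(\<lambda>E. \<phi> (?v E)) \<in> ?R \<rightarrow> carrier A"
      using u v by auto
    show ?thesis
      unfolding A.finprod_multf[OF uc vc]
      using A.finprod_closed[OF uc] A.finprod_closed[OF vc] pre_transfer_closed[OF s g] by (simp add: A.m_ac)
  qed
  also have "finprod A (\<lambda>E. \<phi> (?u E) \<otimes>\<^bsub>A\<^esub> \<phi> (?v E)) ?R = \<one>\<^bsub>A\<^esub>"
  proof (rule A.finprod_one_eqI)
    fix E assume E: "E \<in> ?R"
    have "?u E \<otimes> ?v E = \<one>"
      using E rep_carrier[OF r E] rep_carrier[OF s E] by (simp add: m_assoc)
    then show "\<phi> (?u E) \<otimes>\<^bsub>A\<^esub> \<phi> (?v E) = \<one>\<^bsub>A\<^esub>"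
      using phi_mult[OF u[OF E] v[OF E]] by simp
  qed
  finally show ?thesis using pre_transfer_closed[OF s g] by simp
qed

text \<open>Since \<open>C\<close> is malnormal, \<open>\<langle>c\<rangle>\<close> permutes the cosets other than \<open>C\<close> semiregularly, so
  representatives can be chosen equivariantly under \<open>c\<close>; all factors but one of the transfer
  of \<open>c\<close> are then trivial.\<close>

lemma ex_equivariant_rep:
  assumes mal: "malnormal_in G (carrier G) C" and c: "c \<in> C"
  shows "\<exists>r. rep r \<and> r C = \<one> \<and> (\<forall>E\<in>rcosets C - {C}. r (E #> c) = r E \<otimes> c)"
proof -
  let ?R = "rcosets C"
  have cc: "c \<in> carrier G" using c by (rule C_carrier)
  \<comment> \<open>\<open>orb E\<close> is the orbit of E under <c> and \<open>b E\<close> a base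
    coset of it. As \<open>b\<close> depends on E only through the orbit, it is constant along the
    orbit. Choosing s(b E) freely and carrying it along by c^(i E), where E = (b E) c^(i E), gives
    an equivariant choice.\<close>
  define orb where "orb E = {E #> (c [^] k) | k::nat. True}" for E
  define b where "b E = (SOME D. D \<in> orb E)" for E
  define i where "i E = (SOME k::nat. E = b E #> (c [^] k))" for E
  define s where "s E = (SOME x. x \<in> E)" for E :: "'a set"
  define r where "r E = (if E = C then \<one> else s (b E) \<otimes> (c [^] i E))" for E
  have orb_sub: "D \<in> ?R" if "E \<in> ?R" "D \<in> orb E" for D E
    using that coset_move cc by (auto simp: orb_def)
  have orb_self: "E \<in> orb E" if "E \<in> ?R" for E
    using that coset_subset[OF that] unfolding orb_def by (force intro: exI[of _ "0::nat"])
  have sym: "\<exists>k::nat. E = D #> (c [^] k)" if "E \<in> ?R" "D \<in> orb E" for D E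
  proof -
    obtain k :: nat where k: "D = E #> (c [^] k)" using \<open>D \<in> orb E\<close> by (auto simp: orb_def)
    have "inv (c [^] k) \<in> generate G {c}"
      using subgroup.m_inv_closed[OF subgroup_generate[OF cc]] mem_generate_iff[OF cc] by blast
    then obtain l :: nat where "inv (c [^] k) = c [^] l" using mem_generate_iff[OF cc] by blast
    then have "D #> (c [^] l) = E #> (c [^] k \<otimes> inv (c [^] k))"
      using k cc \<open>E \<in> ?R\<close> by (simp add: coset_move_mult)
    then show ?thesis using cc coset_subset[OF \<open>E \<in> ?R\<close>] by (intro exI[of _ l]) simp
  qed
  have orb_eq: "orb (E #> c) = orb E" if E: "E \<in> ?R" for E
  proof
    show "orb (E #> c) \<subseteq> orb E"
    proof
      fix D assume "D \<in> orb (E #> c)"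
      then obtain k :: nat where "D = E #> c #> (c [^] k)" by (auto simp: orb_def)
      then have "D = E #> (c [^] Suc k)"
        using E cc nat_pow_Suc2[OF cc, of k] by (simp add: coset_move_mult)
      then show "D \<in> orb E" unfolding orb_def by blast
    qed
    show "orb E \<subseteq> orb (E #> c)"
    proof
      fix D assume "D \<in> orb E"
      then obtain k :: nat where k: "D = E #> (c [^] k)" by (auto simp: orb_def)
      have "E #> c \<in> orb E" unfolding orb_def using cc by (force intro: exI[of _ "1::nat"])
      then obtain l :: nat where "E = E #> c #> (c [^] l)" using sym[OF E] by blast
      then have "D = E #> c #> (c [^] l) #> (c [^] k)" using k by simp
      also have "\<dots> = E #> c #> (c [^] (l + k))"
        using E cc coset_move by (simp add: coset_move_mult m_assoc nat_pow_mult)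
      finally show "D \<in> orb (E #> c)" unfolding orb_def by blast
    qed
  qed
  have bE: "b E \<in> orb E" if "E \<in> ?R" for E
    unfolding b_def using orb_self[OF that] by (rule someI)
  have iE: "E = b E #> (c [^] i E)" if "E \<in> ?R" for E
    unfolding i_def using sym[OF that bE[OF that]] by (rule someI_ex)
  have sE: "s E \<in> E" if "E \<in> ?R" for E
    unfolding s_def using subgroup.rcosets_non_empty[OF C that] by (simp add: some_in_eq)
  have CR: "C \<in> ?R" using subgroup.subgroup_in_rcosets[OF C group_axioms] .
  have Cg: "C #> g = C" if "g \<in> C" for g
    using that C C_carrier by (simp add: coset_join2)
  have ne: "E #> g \<noteq> C" if "E \<in> ?R" "E \<noteq> C" "g \<in> C" for E g
  proof
    assume "E #> g = C"
    then have "E #> g #> inv g = C" using Cg[of "inv g"] C that by (simp add: subgroup.m_inv_closed)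
    then show False using that C_carrier coset_subset[OF that(1)] by (simp add: coset_move_mult)
  qed
  have pw: "c [^] (k::nat) \<in> C" for k using subgroup_pow_closed[OF C c] .
  \<comment> \<open>If the nontrivial d = c^k c^-l fixed a coset Cg, then g d g^-1 would lie in
    \<open>C\<close> and malnormality would put g in \<open>C\<close>. So, although the exponent
    \<open>i E\<close> is arbitrary, the power of c is determined.\<close>
  have free: "c [^] k = c [^] l" if E: "E \<in> ?R" "E \<noteq> C" and eq: "E #> (c [^] k) = E #> (c [^] l)" for E and k l :: nat
  proof (rule ccontr)
    assume nk: "c [^] k \<noteq> c [^] l"
    define d where "d = c [^] k \<otimes> inv (c [^] l)"
    have dC: "d \<in> C" unfolding d_def using pw C by (simp add: subgroup_closed)
    have d1: "d \<noteq> \<one>"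
    proof
      assume "d = \<one>"
      then have "d \<otimes> c [^] l = c [^] l" using cc by simp
      then show False using nk cc by (simp add: d_def m_assoc)
    qed
    obtain g where g: "g \<in> carrier G" "E = C #> g" using E(1) by (auto simp: RCOSETS_def)
    have "E #> d = E #> (c [^] k) #> inv (c [^] l)"
      using E cc by (simp add: d_def coset_move_mult)
    also have "\<dots> = E" unfolding eq using E(1) cc coset_subset[OF E(1)] by (simp add: coset_move_mult)
    finally have "cj G (inv g) d \<in> C"
      using g fixed_coset_iff[OF C g(1), of d] dC C_carrier by simp
    then have "inv g \<in> C" using malnormal_inD[OF mal _ dC d1] g by simp
    then have "g \<in> C" using C g by (metis inv_inv subgroup.m_inv_closed)
    then show False using g E(2) Cg by simp
  qed
  have "rep r"
    unfolding rep_def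
  proof
    fix E assume E: "E \<in> ?R"
    show "r E \<in> E"
    proof (cases "E = C")
      case False
      have bR: "b E \<in> ?R" using orb_sub[OF E bE[OF E]] .
      have "s (b E) \<otimes> (c [^] i E) \<in> b E #> (c [^] i E)"
        using sE[OF bR] by (auto simp: r_coset_def)
      then show ?thesis using iE[OF E] False by (simp add: r_def)
    qed (use C in \<open>simp add: r_def subgroup.one_closed\<close>)
  qed
  moreover have "r (E #> c) = r E \<otimes> c" if E: "E \<in> ?R - {C}" for E
  proof -
    have ER: "E \<in> ?R" and EC: "E \<noteq> C" using E by auto
    have EcR: "E #> c \<in> ?R" using coset_move[OF ER cc] .
    have bc: "b (E #> c) = b E" unfolding b_def orb_eq[OF ER] ..
    have bR: "b E \<in> ?R" using orb_sub[OF ER bE[OF ER]] .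
    have bC: "b E \<noteq> C"
    proof
      assume "b E = C"
      then have "E = C" using iE[OF ER] Cg[OF pw] by simp
      then show False using EC by simp
    qed
    have "b E #> (c [^] i (E #> c)) = E #> c"
      using iE[OF EcR] bc by simp
    also have "\<dots> = b E #> (c [^] i E) #> c" using iE[OF ER] by simp
    also have "\<dots> = b E #> (c [^] Suc (i E))"
      using cc bR by (simp add: coset_move_mult)
    finally have "c [^] i (E #> c) = c [^] Suc (i E)"
      by (rule free[OF bR bC])
    moreover have "s (b E) \<in> carrier G" using sE[OF bR] coset_subset[OF bR] by blast
    ultimately show ?thesis
      using ne[OF ER EC c] EC cc bc by (simp add: r_def m_assoc)
  qed
  moreover have "r C = \<one>" by (simp add: r_def)
  ultimately show ?thesis by blast
qed

lemma pre_transfer_on_malnormal: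
  assumes mal: "malnormal_in G (carrier G) C" and c: "c \<in> C" and s: "rep s"
  shows "pre_transfer s c = \<phi> c"
proof -
  let ?R = "rcosets C"
  obtain r where r: "rep r" "r C = \<one>" "\<And>E. E \<in> ?R - {C} \<Longrightarrow> r (E #> c) = r E \<otimes> c"
    using ex_equivariant_rep[OF mal c] by blast
  let ?t = "\<lambda>E. r E \<otimes> c \<otimes> inv (r (E #> c))"
  have cc: "c \<in> carrier G" using c by (rule C_carrier)
  have CR: "C \<in> ?R" using subgroup.subgroup_in_rcosets[OF C group_axioms] .
  then have R: "?R = insert C (?R - {C})" by blast
  have t1: "?t E = \<one>" if "E \<in> ?R - {C}" for E
    unfolding r(3)[OF that] using rep_carrier[OF r(1)] that cc by (intro r_inv) auto
  have "pre_transfer r c = finprod A (\<lambda>E. \<phi> (?t E)) (insert C (?R - {C}))"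
    unfolding pre_transfer_def using R by simp
  also have "\<dots> = \<phi> (?t C) \<otimes>\<^bsub>A\<^esub> finprod A (\<lambda>E. \<phi> (?t E)) (?R - {C})"
    using finite_cosets rep_term[OF r(1) _ cc] CR by (intro A.finprod_insert) auto
  also have "finprod A (\<lambda>E. \<phi> (?t E)) (?R - {C}) = \<one>\<^bsub>A\<^esub>"
    using t1 by (intro A.finprod_one_eqI) simp
  also have "?t C = c"
    using c cc C r(2) by (simp add: coset_join2)
  finally show ?thesis using pre_transfer_indep[OF r(1) s cc] c by simp
qed

text \<open>Take the kernel of the transfer. Since the transfer restricts to \<phi> on
  \<open>C\<close>, it meets \<open>C\<close> in ker \<phi>; and for each g some c in
  \<open>C\<close> has the same transfer value, so that g c^-1 lies in the kernel.\<close>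

lemma ex_transfer_kernel:
  assumes mal: "malnormal_in G (carrier G) C" and surj: "carrier A \<subseteq> \<phi> ` C"
  shows "\<exists>K. subgroup K G \<and> K \<inter> C = {c \<in> C. \<phi> c = \<one>\<^bsub>A\<^esub>} \<and> K <#> C = carrier G"
proof -
  define s where "s E = (SOME x. x \<in> E)" for E :: "'a set"
  have s: "rep s"
    unfolding rep_def s_def using subgroup.rcosets_non_empty[OF C] by (simp add: some_in_eq)
  define K where "K = {g \<in> carrier G. pre_transfer s g = \<one>\<^bsub>A\<^esub>}"
  have on_C: "pre_transfer s c = \<phi> c" if "c \<in> C" for c
    using pre_transfer_on_malnormal[OF mal that s] .
  have one: "\<one> \<in> C" using C by (rule subgroup.one_closed)
  have "subgroup K G"
  proof (rule subgroup_of_closed)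
    have "\<one> \<in> K" using on_C[OF one] by (simp add: K_def)
    then show "K \<noteq> {}" by blast
    show "a \<otimes> b \<in> K" if "a \<in> K" "b \<in> K" for a b
      using that pre_transfer_mult[OF s] by (simp add: K_def)
  qed (auto simp: K_def)
  moreover have "K \<inter> C = {c \<in> C. \<phi> c = \<one>\<^bsub>A\<^esub>}"
    using on_C C_carrier by (auto simp: K_def)
  moreover have "K <#> C = carrier G"
  proof
    show "K <#> C \<subseteq> carrier G" using C_carrier by (auto simp: set_mult_def K_def)
    show "carrier G \<subseteq> K <#> C"
    proof
      fix g assume g: "g \<in> carrier G"
      obtain c where c: "c \<in> C" "\<phi> c = pre_transfer s g"
        using surj pre_transfer_closed[OF s g] by force
      have cc: "c \<in> carrier G" using c(1) by (rule C_carrier)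
      let ?k = "g \<otimes> inv c"
      have k: "?k \<in> carrier G" using g cc by simp
      have e: "?k \<otimes> c = g" using g cc by (simp add: m_assoc)
      have "pre_transfer s ?k \<otimes>\<^bsub>A\<^esub> \<phi> c = \<phi> c"
        using pre_transfer_mult[OF s k cc] e on_C[OF c(1)] c by simp
      then have "pre_transfer s ?k = \<one>\<^bsub>A\<^esub>"
        using pre_transfer_closed[OF s k] c(1) by simp
      then have "?k \<in> K" using k by (simp add: K_def)
      then show "g \<in> K <#> C" using set_mult_memI[OF _ c(1), of ?k K] e by simp
    qed
  qed
  ultimately show ?thesis by blast
qed

end

section \<open>Frobenius kernels\<close>

text \<open>Solubility of \<open>C\<close>, phrased for all subgroups so that it is inherited by the
  smaller complements of the induction.\<close>

definition abelian_quotients :: "('a, 'b) monoid_scheme \<Rightarrow> 'a set \<Rightarrow> bool" where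
  "abelian_quotients G C \<longleftrightarrow> (\<forall>S. subgroup S G \<and> S \<subseteq> C \<and> S \<noteq> {\<one>\<^bsub>G\<^esub>} \<longrightarrow>
     (\<exists>N. subgroup N G \<and> N \<subset> S \<and> normalizes G S N \<and> abelian_mod G S N))"

text \<open>The Frobenius kernel as a mere set. Being determined by \<open>U\<close> and
  \<open>C\<close> alone, it is preserved by every conjugation that preserves \<open>U\<close> and
  the \<open>U\<close>-class of \<open>C\<close>.\<close>

definition frobenius_kernel :: "('a, 'b) monoid_scheme \<Rightarrow> 'a set \<Rightarrow> 'a set \<Rightarrow> 'a set" where
  "frobenius_kernel G U C = {x \<in> U. \<forall>u\<in>U. \<forall>c\<in>C. x = cj G u c \<longrightarrow> x = \<one>\<^bsub>G\<^esub>}"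

context finite_group
begin

lemma comm_group_FactGroup:
  assumes C: "subgroup C G" and N: "subgroup N G" "N \<subseteq> C" "normalizes G C N" and ab: "abelian_mod G C N"
  shows "comm_group (G\<lparr>carrier := C\<rparr> Mod N)"
proof -
  interpret CC: group "G\<lparr>carrier := C\<rparr>" using C by (rule subgroup_imp_group)
  interpret N: normal N "G\<lparr>carrier := C\<rparr>" using normal_in_iff[OF C N(1,2)] N(3) by simp
  have nc: "x \<in> carrier G" if "x \<in> N" for x using N(1) that by (rule subgroup.mem_carrier)
  have cc: "x \<in> carrier G" if "x \<in> C" for x using C that by (rule subgroup.mem_carrier)
  have Nsub: "N \<subseteq> carrier G" using nc by blast
  show ?thesis
  proof (rule group.group_comm_groupI[OF N.factorgroup_is_group])
    fix a b assume "a \<in> carrier (G\<lparr>carrier := C\<rparr> Mod N)" "b \<in> carrier (G\<lparr>carrier := C\<rparr> Mod N)"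
    then obtain x y where xy: "x \<in> C" "y \<in> C" "a = N #> x" "b = N #> y"
      by (auto simp: carrier_FactGroup)
    obtain n where n: "n \<in> N" "x \<otimes> y = n \<otimes> (y \<otimes> x)" using ab xy by (auto simp: abelian_mod_def)
    have "N #> (x \<otimes> y) = N #> n #> (y \<otimes> x)"
      unfolding n(2) using n xy nc cc Nsub by (simp add: coset_mult_assoc)
    then have "N #> (x \<otimes> y) = N #> (y \<otimes> x)"
      using n nc N(1) by (simp add: coset_join2)
    then show "a \<otimes>\<^bsub>G\<lparr>carrier := C\<rparr> Mod N\<^esub> b = b \<otimes>\<^bsub>G\<lparr>carrier := C\<rparr> Mod N\<^esub> a"
      using xy N.rcos_sum[of x y] N.rcos_sum[of y x] by simp
  qed
qed

lemma ex_malnormal_supplement: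
  assumes U: "subgroup U G" and mal: "malnormal_in G U C"
    and N: "subgroup N G" "N \<subseteq> C" "normalizes G C N" and ab: "abelian_mod G C N"
  shows "\<exists>K. subgroup K G \<and> K \<subseteq> U \<and> K \<inter> C = N \<and> K <#> C = U"
proof -
  have C: "subgroup C G" "C \<subseteq> U" using mal by (auto simp: malnormal_in_def)
  let ?A = "G\<lparr>carrier := C\<rparr> Mod N"
  interpret CC: group "G\<lparr>carrier := C\<rparr>" using C(1) by (rule subgroup_imp_group)
  interpret N: normal N "G\<lparr>carrier := C\<rparr>" using normal_in_iff[OF C(1) N(1,2)] N(3) by simp
  interpret T: transfer_setup "G\<lparr>carrier := U\<rparr>" ?A C "\<lambda>c. N #> c"
  proof (intro transfer_setup.intro transfer_setup_axioms.intro)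
    show "finite_group (G\<lparr>carrier := U\<rparr>)" using U by (rule finite_group_subgroup)
    show "comm_group ?A" using C(1) N ab by (rule comm_group_FactGroup)
    show "subgroup C (G\<lparr>carrier := U\<rparr>)" using C U by (simp add: subgroup_incl)
    show "N #> c \<in> carrier ?A" if "c \<in> C" for c using that by (auto simp: carrier_FactGroup)
    show "N #> (c \<otimes>\<^bsub>G\<lparr>carrier := U\<rparr>\<^esub> d) = (N #> c) \<otimes>\<^bsub>?A\<^esub> (N #> d)" if "c \<in> C" "d \<in> C" for c d
      using N.rcos_sum[of c d] that by simp
  qed
  have "malnormal_in (G\<lparr>carrier := U\<rparr>) (carrier (G\<lparr>carrier := U\<rparr>)) C"
    using mal U C by (auto simp: malnormal_in_def subgroup_incl cj_consistent)
  moreover have "carrier ?A \<subseteq> (\<lambda>c. N #> c) ` C" by (auto simp: carrier_FactGroup)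
  ultimately obtain K where K: "subgroup K (G\<lparr>carrier := U\<rparr>)" "K \<inter> C = {c \<in> C. N #> c = N}" "K <#> C = U"
    using T.ex_transfer_kernel by auto
  have "N #> c = N \<longleftrightarrow> c \<in> N" if "c \<in> C" for c
    using that N(1) C(1) by (metis coset_join2 subgroup.mem_carrier rcos_self)
  then have "K \<inter> C = N" using K(2) N(2) by auto
  moreover have "subgroup K G" using incl_subgroup[OF U K(1)] .
  moreover have "K \<subseteq> U" using subgroup.subset[OF K(1)] by simp
  ultimately show ?thesis using K(3) by blast
qed

text \<open>The kernel K1 of the transfer into C/N meets \<open>C\<close> in the smaller group N,
  which is malnormal in K1. By induction N has a complement K in K1, and K complements
  \<open>C\<close> in \<open>U\<close>, because K1 C = U and N is contained in
  \<open>C\<close>.\<close>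

lemma ex_malnormal_complement:
  assumes "subgroup U G" "malnormal_in G U C" "abelian_quotients G C"
  shows "\<exists>K. subgroup K G \<and> K \<subseteq> U \<and> K \<inter> C = {\<one>} \<and> K <#> C = U"
  using assms
proof (induction "card C" arbitrary: U C rule: less_induct)
  case less
  note U = \<open>subgroup U G\<close> and mal = \<open>malnormal_in G U C\<close> and aq = \<open>abelian_quotients G C\<close>
  have C: "subgroup C G" "C \<subseteq> U" using mal by (auto simp: malnormal_in_def)
  show ?case
  proof (cases "C = {\<one>}")
    case True
    have "U <#> {\<one>} = U" using U by (auto simp: set_mult_def subgroup.mem_carrier)
    then show ?thesis using True U by (intro exI[of _ U]) (auto simp: subgroup.one_closed)
  next
    case False
    then obtain N where N: "subgroup N G" "N \<subset> C" "normalizes G C N" "abelian_mod G C N"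
      using aq C unfolding abelian_quotients_def by blast
    obtain K1 where K1: "subgroup K1 G" "K1 \<subseteq> U" "K1 \<inter> C = N" "K1 <#> C = U"
      using ex_malnormal_supplement[OF U mal N(1) _ N(3,4)] N(2) by blast
    have "malnormal_in G K1 N"
      unfolding malnormal_in_def using N K1 mal
      by (metis IntI Int_lower1 malnormal_inD psubsetE subsetD)
    moreover have "abelian_quotients G N"
      using aq N(2) unfolding abelian_quotients_def by (meson psubsetE subset_trans)
    moreover have "card N < card C"
      using N(2) C finite_subgroup by (meson psubset_card_mono)
    ultimately obtain K where K: "subgroup K G" "K \<subseteq> K1" "K \<inter> N = {\<one>}" "K <#> N = K1"
      using less.hyps K1(1) by blast
    have "K \<inter> C = {\<one>}"
      using K K1 by blast
    moreover have "K <#> C = U"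
    proof
      have "a \<otimes> b \<in> U" if "a \<in> K" "b \<in> C" for a b
        using that K(2) K1(2) C(2) U by (meson subgroup.m_closed subsetD)
      then show "K <#> C \<subseteq> U" by (auto simp: set_mult_def)
      show "U \<subseteq> K <#> C"
      proof
        fix u assume "u \<in> U"
        then obtain k c where kc: "k \<in> K1" "c \<in> C" "u = k \<otimes> c" using K1(4) by (metis set_mult_memE)
        obtain l n where ln: "l \<in> K" "n \<in> N" "k = l \<otimes> n" using K(4) kc(1) by (metis set_mult_memE)
        have "u = l \<otimes> (n \<otimes> c)"
          using kc ln C K(1) N(1) by (simp add: m_assoc subgroup.mem_carrier)
        moreover have "n \<otimes> c \<in> C" using ln(2) kc(2) N(2) C by (auto simp: subgroup.m_closed)
        ultimately show "u \<in> K <#> C" using ln(1) set_mult_memI by blast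
      qed
    qed
    ultimately show ?thesis using K K1 by (metis subset_trans)
  qed
qed

text \<open>The conjugates of c by k, for k in \<open>K\<close> and 1 \<noteq> c in
  \<open>C\<close>, are pairwise distinct by malnormality and lie outside \<open>K\<close>. There
  are |K| (|C| - 1) of them, so together with \<open>K\<close> they exhaust
  \<open>U\<close>.\<close>

lemma complement_eq_frobenius_kernel:
  assumes U: "subgroup U G" and mal: "malnormal_in G U C"
    and K: "subgroup K G" "K \<inter> C = {\<one>}" "K <#> C = U"
  shows "K = frobenius_kernel G U C"
proof -
  have C: "subgroup C G" "C \<subseteq> U" using mal by (auto simp: malnormal_in_def)
  have KU: "K \<subseteq> U" using subset_set_mult(1)[OF K(1) C(1)] K(3) by simp
  have cc: "x \<in> carrier G" if "x \<in> C" for x using C(1) that by (rule subgroup.mem_carrier)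
  have kc: "x \<in> carrier G" if "x \<in> K" for x using K(1) that by (rule subgroup.mem_carrier)
  \<comment> \<open>Writing u^-1 = kd gives u = d^-1 k^-1, and conjugation by d^-1 stays inside
    \<open>C\<close>; so conjugation by elements of \<open>K\<close> reaches every
    conjugate.\<close>
  have conj_K: "\<exists>k\<in>K. \<exists>d\<in>C. cj G u c = cj G k d" if u: "u \<in> U" and c: "c \<in> C" for u c
  proof -
    have "inv u \<in> K <#> C" using u U K(3) by (simp add: subgroup.m_inv_closed)
    then obtain k d where kd: "k \<in> K" "d \<in> C" "inv u = k \<otimes> d" by (rule set_mult_memE)
    have uc: "u \<in> carrier G" using U u by (rule subgroup.mem_carrier)
    have "u = inv d \<otimes> inv k" using kd uc cc kc by (metis inv_inv inv_mult_group)
    then have "cj G u c = cj G (inv k) (cj G (inv d) c)"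
      using kd c cc kc by (simp add: cj_mult_left)
    moreover have "cj G (inv d) c \<in> C" using kd c C by (simp add: subgroup_cj_closed subgroup.m_inv_closed)
    ultimately show ?thesis using kd(1) K(1) by (meson subgroup.m_inv_closed)
  qed
  have disj: "cj G k c \<notin> K" if "k \<in> K" "c \<in> C" "c \<noteq> \<one>" for k c
  proof
    assume "cj G k c \<in> K"
    then have "cj G (inv k) (cj G k c) \<in> K"
      using that K(1) by (simp add: subgroup_cj_closed subgroup.m_inv_closed)
    then have "c \<in> K \<inter> C" using that kc cc by simp
    then show False using K(2) that by blast
  qed
  let ?f = "\<lambda>(k, c). cj G k c"
  let ?D = "K \<times> (C - {\<one>})"
  have inj: "inj_on ?f ?D"
  proof (rule inj_onI)
    fix x y assume "x \<in> ?D" "y \<in> ?D" and eq: "?f x = ?f y"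
    then obtain k c l d where kc': "x = (k, c)" "y = (l, d)" "k \<in> K" "l \<in> K" "c \<in> C" "d \<in> C" "c \<noteq> \<one>" "d \<noteq> \<one>"
      by auto
    have m: "k \<in> carrier G" "l \<in> carrier G" "c \<in> carrier G" "d \<in> carrier G" using kc' kc cc by auto
    have "cj G (k \<otimes> inv l) c = cj G (inv l) (cj G k c)" using m by (simp add: cj_mult_left)
    also have "\<dots> = d" using eq kc' m by simp
    finally have e: "cj G (k \<otimes> inv l) c = d" .
    have kl: "k \<otimes> inv l \<in> K" using kc' K(1) by (simp add: subgroup_closed)
    then have "k \<otimes> inv l \<in> C" using malnormal_inD[OF mal, of "k \<otimes> inv l" c] KU kc' e by auto
    then have "k \<otimes> inv l = \<one>" using kl K(2) by blast
    then have "k \<otimes> inv l \<otimes> l = l" using m by simp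
    then have "k = l" using m by (simp add: m_assoc)
    then show "x = y" using e m kc' by simp
  qed
  have finK: "finite K" and finC: "finite C" and finU: "finite U" using K(1) C(1) U finite_subgroup by auto
  have imgU: "?f ` ?D \<subseteq> U"
    using KU C(2) U by (auto simp: subgroup_cj_closed subsetD)
  have cardU: "card U = card K * card C" using card_set_mult_disjoint[OF K(1) C(1) K(2)] K(3) by simp
  have "card (?f ` ?D) = card K * (card C - 1)"
    using card_image[OF inj] subgroup.one_closed[OF C(1)] by (simp add: card_cartesian_product)
  moreover have "card C > 0" using subgroup_card_pos[OF C(1)] .
  ultimately have "card (?f ` ?D) + card K = card U"
    unfolding cardU by (simp add: algebra_simps)
  moreover have "?f ` ?D \<inter> K = {}" using disj by auto
  moreover have "finite (?f ` ?D)" using imgU finU finite_subset by blast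
  ultimately have "card (?f ` ?D \<union> K) = card U" using finK by (simp add: card_Un_disjoint)
  then have Ueq: "?f ` ?D \<union> K = U" using imgU KU finU by (intro card_subset_eq) auto
  show ?thesis
  proof
    show "K \<subseteq> frobenius_kernel G U C"
    proof
      fix x assume x: "x \<in> K"
      have "x = \<one>" if uc: "u \<in> U" "c \<in> C" "x = cj G u c" for u c
      proof -
        obtain k d where kd: "k \<in> K" "d \<in> C" "x = cj G k d" using conj_K[OF uc(1,2)] uc(3) by blast
        then have "d = \<one>" using disj x by blast
        then show ?thesis using kd kc by simp
      qed
      then show "x \<in> frobenius_kernel G U C" using x KU by (auto simp: frobenius_kernel_def)
    qed
    show "frobenius_kernel G U C \<subseteq> K"
    proof
      fix x assume x: "x \<in> frobenius_kernel G U C"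
      show "x \<in> K"
      proof (rule ccontr)
        assume xK: "x \<notin> K"
        then have "x \<in> ?f ` ?D" using x Ueq by (auto simp: frobenius_kernel_def)
        then obtain k c where "k \<in> K" "c \<in> C" "x = cj G k c" by auto
        then have "x = \<one>" using x KU by (auto simp: frobenius_kernel_def)
        then show False using xK K(1) subgroup.one_closed by blast
      qed
    qed
  qed
qed

text \<open>The premise \<open>gC\<close> says that g^-1 carries \<open>C\<close> to a
  \<open>U\<close>-conjugate of \<open>C\<close>. It is used with u = g for g in \<open>U\<close>,
  and with u = 1 for a g outside \<open>U\<close> that normalizes \<open>C\<close>.\<close>

lemma frobenius_kernel_cj:
  assumes U: "U \<subseteq> carrier G" and C: "C \<subseteq> carrier G" and g: "g \<in> carrier G"
    and gU: "cj G g ` U = U" and gC: "\<exists>u\<in>U. cj G (inv g \<otimes> u) ` C \<subseteq> C" and subU: "subgroup U G"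
    and x: "x \<in> frobenius_kernel G U C"
  shows "cj G g x \<in> frobenius_kernel G U C"
proof -
  obtain w where w: "w \<in> U" "cj G (inv g \<otimes> w) ` C \<subseteq> C" using gC by blast
  have xU: "x \<in> U" using x by (simp add: frobenius_kernel_def)
  have "cj G g x = \<one>" if u: "u \<in> U" and c: "c \<in> C" and e: "cj G g x = cj G u c" for u c
  proof -
    have m: "u \<in> carrier G" "c \<in> carrier G" "x \<in> carrier G" "w \<in> carrier G"
      using u c xU U C w by auto
    obtain v where v: "v \<in> U" "u = cj G g v" using gU u by blast
    have vc: "v \<in> carrier G" using v U by blast
    let ?d = "cj G (inv g \<otimes> w) c"
    have dC: "?d \<in> C" using w c by blast
    have "x = cj G (inv g) (cj G u c)" using m g e by (metis cj_cancel(1))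
    also have "\<dots> = cj G (u \<otimes> inv g) c" using m g by (simp add: cj_mult_left)
    also have "u \<otimes> inv g = inv g \<otimes> v" using v vc g by (simp add: cj_def m_assoc)
    also have "inv g \<otimes> v = (inv g \<otimes> w) \<otimes> (inv w \<otimes> v)" using m g vc by (simp add: m_assoc)
    also have "cj G ((inv g \<otimes> w) \<otimes> (inv w \<otimes> v)) c = cj G (inv w \<otimes> v) ?d"
      using m g vc by (simp add: cj_mult_left)
    finally have "x = cj G (inv w \<otimes> v) ?d" .
    moreover have "inv w \<otimes> v \<in> U" using w v subU by (simp add: subgroup_closed)
    ultimately have "x = \<one>" using x dC by (auto simp: frobenius_kernel_def)
    then show ?thesis using g by simp
  qed
  moreover have "cj G g x \<in> U" using gU xU by blast
  ultimately show ?thesis by (auto simp: frobenius_kernel_def)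
qed

text \<open>For any x in \<open>S\<close> outside \<open>M\<close>, maximality gives S = M<x>, so
  that S/M is cyclic.\<close>

lemma abelian_mod_maximal:
  assumes S: "subgroup S G" and M: "subgroup M G" "M \<subset> S" "normalizes G S M"
    and max: "\<And>L. subgroup L G \<Longrightarrow> M \<subseteq> L \<Longrightarrow> L \<subseteq> S \<Longrightarrow> L = M \<or> L = S"
  shows "abelian_mod G S M"
proof -
  obtain x where x: "x \<in> S" "x \<notin> M" using M(2) by blast
  have xc: "x \<in> carrier G" using S x(1) by (rule subgroup.mem_carrier)
  have mc: "y \<in> carrier G" if "y \<in> M" for y using M(1) that by (rule subgroup.mem_carrier)
  have gS: "generate G {x} \<subseteq> S" using generate_subset[OF S x(1)] .
  have gn: "normalizes G (generate G {x}) M" using M(3) gS by (auto simp: normalizes_def)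
  have L: "subgroup (M <#> generate G {x}) G"
    using subgroup_set_mult[OF M(1) subgroup_generate[OF xc] gn] .
  have "M <#> generate G {x} \<subseteq> S"
    using gS M(2) S by (auto simp: set_mult_def subgroup.m_closed subsetD)
  moreover have "x \<in> M <#> generate G {x}"
    using subset_set_mult(2)[OF M(1) subgroup_generate[OF xc]] mem_generate by blast
  ultimately have LS: "M <#> generate G {x} = S"
    using max[OF L subset_set_mult(1)[OF M(1) subgroup_generate[OF xc]]] x by blast
  have form: "\<exists>m\<in>M. \<exists>i::nat. a = m \<otimes> x [^] i" if "a \<in> S" for a
    using that unfolding LS[symmetric] set_mult_def by (auto simp: mem_generate_iff[OF xc]) blast
  have prod: "\<exists>n\<in>M. (m \<otimes> x [^] i) \<otimes> (m' \<otimes> x [^] j) = n \<otimes> x [^] (i + j)"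
    if "m \<in> M" "m' \<in> M" for m m' and i j :: nat
  proof
    show "m \<otimes> cj G (inv (x [^] i)) m' \<in> M"
      using that M(1,3) S subgroup_pow_closed[OF S x(1)]
      by (simp add: normalizes_def subgroup_closed)
    show "(m \<otimes> x [^] i) \<otimes> (m' \<otimes> x [^] j) = m \<otimes> cj G (inv (x [^] i)) m' \<otimes> x [^] (i + j)"
      using that mc xc by (simp add: cj_def m_assoc nat_pow_mult[symmetric])
  qed
  show ?thesis
    unfolding abelian_mod_def
  proof (intro ballI)
    fix a b assume ab: "a \<in> S" "b \<in> S"
    obtain m i where mi: "m \<in> M" "a = m \<otimes> x [^] (i::nat)" using form[OF ab(1)] by blast
    obtain m' j where mj: "m' \<in> M" "b = m' \<otimes> x [^] (j::nat)" using form[OF ab(2)] by blast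
    obtain n where n: "n \<in> M" "a \<otimes> b = n \<otimes> x [^] (i + j)" using prod[OF mi(1) mj(1)] mi mj by metis
    obtain n' where n': "n' \<in> M" "b \<otimes> a = n' \<otimes> x [^] (i + j)"
      using prod[OF mj(1) mi(1)] mi mj by (metis add.commute)
    have "a \<otimes> b = (n \<otimes> inv n') \<otimes> (b \<otimes> a)"
      unfolding n(2) n'(2) using n(1) n'(1) mc xc by (simp add: m_assoc)
    then show "\<exists>n\<in>M. a \<otimes> b = n \<otimes> (b \<otimes> a)"
      using n(1) n'(1) M(1) by (meson subgroup_closed)
  qed
qed

text \<open>A maximal member M of the proper subgroups of \<open>S\<close> above \<open>L\<close>
  has a larger normalizer by \<open>grow\<close>, hence is normal in \<open>S\<close>.
  \<open>L\<close> is 1 for p-groups and the intersection with P for subgroups of the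
  complement.\<close>

lemma ex_abelian_quotient:
  assumes S: "subgroup S G" and L: "subgroup L G" "L \<subset> S"
    and grow: "\<And>M. subgroup M G \<Longrightarrow> L \<subseteq> M \<Longrightarrow> M \<subset> S \<Longrightarrow> \<exists>k\<in>S - M. \<forall>h\<in>M. cj G k h \<in> M"
  shows "\<exists>N. subgroup N G \<and> N \<subset> S \<and> normalizes G S N \<and> abelian_mod G S N"
proof -
  define F where "F = {M. subgroup M G \<and> L \<subseteq> M \<and> M \<subset> S}"
  have fin: "finite F"
    using finite_subgroup[OF S] by (intro finite_subset[of F "Pow S"]) (auto simp: F_def)
  have "L \<in> F" using L by (simp add: F_def)
  then obtain M where M: "M \<in> F" and mx: "\<And>M'. M' \<in> F \<Longrightarrow> M \<subseteq> M' \<Longrightarrow> M' = M"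
    using finite_has_maximal[OF fin] by blast
  have MF: "subgroup M G" "L \<subseteq> M" "M \<subset> S" using M by (auto simp: F_def)
  have Mc: "M \<subseteq> carrier G" using MF(1) by (rule subgroup.subset)
  let ?N = "normalizer_in S M"
  have N: "subgroup ?N G" using subgroup_normalizer_in[OF S Mc] .
  have MN: "M \<subseteq> ?N" using MF subgroup_cj_closed[OF MF(1)] by (auto simp: normalizer_in_def)
  obtain k where "k \<in> S - M" "\<forall>h\<in>M. cj G k h \<in> M" using grow[OF MF] by blast
  then have "?N \<noteq> M" by (auto simp: normalizer_in_def)
  moreover have "?N \<subseteq> S" by (auto simp: normalizer_in_def)
  ultimately have "?N = S" using mx[of ?N] N MN MF(2) by (auto simp: F_def)
  then have nS: "normalizes G S M" using normalizes_normalizer_in[of S M] by simp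
  moreover have "abelian_mod G S M"
    using mx MF by (intro abelian_mod_maximal[OF S MF(1,3) nS]) (auto simp: F_def)
  ultimately show ?thesis using MF by blast
qed

lemma abelian_quotients_prime_power:
  assumes p: "Factorial_Ring.prime p" and P: "subgroup P G" "card P = p ^ n"
  shows "abelian_quotients G P"
  unfolding abelian_quotients_def
proof (intro allI impI, elim conjE)
  fix S assume S: "subgroup S G" "S \<subseteq> P" "S \<noteq> {\<one>}"
  obtain m where m: "card S = p ^ m" using subgroup_card_prime_power[OF S(1) P(1) S(2) P(2) p] by blast
  show "\<exists>N. subgroup N G \<and> N \<subset> S \<and> normalizes G S N \<and> abelian_mod G S N"
    using S triv_subgroup normalizer_grows[OF S(1) m p]
    by (intro ex_abelian_quotient[of S "{\<one>}"]) (auto simp: subgroup.one_closed)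
qed

end

section \<open>TI-subgroups and subnormal subgroups\<close>

context finite_group
begin

text \<open>The form in which TI is applied: a single non-identity element that stays in
  \<open>H\<close> under g excludes the trivial intersection, and H contained in H^g is an equality
  by cardinality.\<close>

lemma TI_subgroup_cj:
  assumes H: "TI_subgroup G H" and g: "g \<in> carrier G" and x: "x \<in> H" "x \<noteq> \<one>" "cj G g x \<in> H" and h: "h \<in> H"
  shows "cj G g h \<in> H"
proof -
  have sub: "subgroup H G" using H by (simp add: TI_subgroup_def)
  have Hc: "H \<subseteq> carrier G" using sub by (rule subgroup.subset)
  have "cj G g x \<in> cj G g ` H \<inter> H" using x by blast
  moreover have "cj G g x \<noteq> \<one>" using x g Hc by auto
  ultimately have "cj G g ` H \<inter> H = H" using H g by (auto simp: TI_subgroup_def conjugate_eq_image)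
  then have "H \<subseteq> cj G g ` H" by blast
  then have "H = cj G g ` H"
    using card_cj_image[OF g Hc] finite_subgroup[OF sub] by (intro card_subset_eq) auto
  then show ?thesis using h by blast
qed

lemma TI_subgroupI:
  assumes H: "subgroup H G"
    and n: "\<And>g x h. g \<in> carrier G \<Longrightarrow> x \<in> H \<Longrightarrow> x \<noteq> \<one> \<Longrightarrow> cj G g x \<in> H \<Longrightarrow> h \<in> H \<Longrightarrow> cj G g h \<in> H"
  shows "TI_subgroup G H"
  unfolding TI_subgroup_def conjugate_eq_image
proof (intro conjI H ballI)
  fix g assume g: "g \<in> carrier G"
  have Hc: "H \<subseteq> carrier G" using H by (rule subgroup.subset)
  have one: "\<one> \<in> H" using H by (rule subgroup.one_closed)
  show "cj G g ` H \<inter> H = {\<one>} \<or> cj G g ` H \<inter> H = H"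
  proof (cases "\<exists>x\<in>H. x \<noteq> \<one> \<and> cj G g x \<in> H")
    case True
    then have "cj G g ` H \<subseteq> H" using n[OF g] by blast
    then show ?thesis using cj_image_eq_if_subset[OF Hc g] by simp
  next
    case False
    have "y = \<one>" if "y \<in> cj G g ` H \<inter> H" for y
      using that False g by auto
    moreover have "\<one> \<in> cj G g ` H" using one g by (intro image_eqI[of _ _ \<one>]) auto
    ultimately show ?thesis using one by blast
  qed
qed

lemma subnormal_subgroup: "subnormal G H \<Longrightarrow> subgroup H G"
  by (induction rule: subnormal.induct) (auto simp: subgroup_self)

lemma subnormal_stepI:
  assumes "subnormal G K" "subgroup H G" "H \<subseteq> K" "normalizes G K H"
  shows "subnormal G H"
  using assms subnormal_subgroup by (blast intro: subnormal.step normal_in_iff[THEN iffD2])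

lemma subnormal_if_normal:
  assumes "subgroup H G" "normalizes G (carrier G) H"
  shows "subnormal G H"
  using subnormal_stepI[OF subnormal.top assms(1) subgroup.subset[OF assms(1)] assms(2)] .

lemma prime_power_set_mult:
  assumes p: "Factorial_Ring.prime p" and A: "subgroup A G" "card A = p ^ a" and B: "subgroup B G" "card B = p ^ b"
  shows "\<exists>m. card (A <#> B) = p ^ m"
proof -
  have "card (A <#> B) dvd p ^ (a + b)"
    using card_set_mult[OF A(1) B(1)] A B by (metis dvd_triv_left power_add)
  then show ?thesis using divides_primepow_nat[OF p] by metis
qed

text \<open>A maximal counterexample A equals its normalizer, as a larger normalizer would be
  subnormal and A normal in it. TI then puts into A every g that carries a non-identity element of A
  into A. For x of order p in A, the p-group N<x> centralizes some z \<noteq> 1 in \<open>N\<close>;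
  z commutes with x, so z lies in A, and \<open>N\<close> commutes with z, so \<open>N\<close> lies
  in A.\<close>

lemma subnormal_if_p_core:
  assumes p: "Factorial_Ring.prime p"
    and star: "\<And>H. subgroup H G \<Longrightarrow> p dvd card H \<Longrightarrow> TI_subgroup G H \<or> subnormal G H"
    and N: "subgroup N G" "normalizes G (carrier G) N" "card N = p ^ n" "N \<noteq> {\<one>}"
    and B: "subgroup B G" "p dvd card B"
  shows "subnormal G B"
proof (rule ccontr)
  assume nB: "\<not> subnormal G B"
  define F where "F = {A. subgroup A G \<and> p dvd card A \<and> \<not> subnormal G A}"
  have fin: "finite F"
    by (rule finite_subset[of F "Pow (carrier G)"]) (auto simp: F_def dest: subgroup.subset)
  have "B \<in> F" using B nB by (simp add: F_def)
  then obtain A where A: "A \<in> F" and mx: "\<And>A'. A' \<in> F \<Longrightarrow> A \<subseteq> A' \<Longrightarrow> A' = A"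
    using finite_has_maximal[OF fin] by blast
  have AF: "subgroup A G" "p dvd card A" "\<not> subnormal G A" using A by (auto simp: F_def)
  have TI: "TI_subgroup G A" using star AF by blast
  have Ac: "A \<subseteq> carrier G" using AF(1) by (rule subgroup.subset)
  let ?M = "normalizer_in (carrier G) A"
  have M: "subgroup ?M G" using subgroup_normalizer_in[OF subgroup_self Ac] .
  have AM: "A \<subseteq> ?M" using subgroup_cj_closed[OF AF(1)] Ac by (auto simp: normalizer_in_def)
  have "p dvd card ?M" using card_subgroup_dvd[OF AF(1) M AM] AF(2) dvd_trans by blast
  have MA: "?M = A"
  proof (rule ccontr)
    assume "?M \<noteq> A"
    then have "subnormal G ?M" using mx[of ?M] M AM \<open>p dvd card ?M\<close> by (auto simp: F_def)
    then have "subnormal G A" using AF(1) AM normalizes_normalizer_in by (rule subnormal_stepI)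
    then show False using AF(3) by blast
  qed
  have normA: "g \<in> A" if "g \<in> carrier G" "x \<in> A" "x \<noteq> \<one>" "cj G g x \<in> A" for g x
    using TI_subgroup_cj[OF TI that] that(1) MA by (auto simp: normalizer_in_def)
  obtain x where x: "x \<in> A" "ord x = p" using cauchy_in[OF p AF(1,2)] by blast
  have xc: "x \<in> carrier G" using x(1) Ac by blast
  have x1: "x \<noteq> \<one>" using x p by auto
  have X: "subgroup (generate G {x}) G" "card (generate G {x}) = p ^ 1"
    using subgroup_generate[OF xc] generate_pow_card[OF xc] x by simp_all
  have nX: "normalizes G (generate G {x}) N"
    using N(2) subgroup.subset[OF X(1)] by (auto simp: normalizes_def)
  let ?P = "N <#> generate G {x}"
  have P: "subgroup ?P G" using subgroup_set_mult[OF N(1) X(1) nX] .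
  obtain m where m: "card ?P = p ^ m" using prime_power_set_mult[OF p N(1,3) X] by blast
  have "n \<noteq> 0" using N(1,3,4) subgroup_card_eq_one[OF N(1)] by (cases n) auto
  then have "p dvd card N" using N(3) by simp
  moreover have "normalizes G ?P N"
    using N(2) subgroup.subset[OF P] by (auto simp: normalizes_def)
  ultimately obtain z where z: "z \<in> N" "z \<noteq> \<one>" "\<forall>s\<in>?P. s \<otimes> z = z \<otimes> s"
    using ex_central_fixed[OF P m p N(1)] by blast
  have zc: "z \<in> carrier G" using N(1) z(1) by (rule subgroup.mem_carrier)
  have "x \<in> ?P" using subset_set_mult(2)[OF N(1) X(1)] mem_generate by blast
  then have "cj G z x = x" using z(3) cj_eq_self_iff[OF zc xc] by simp
  then have zA: "z \<in> A" using normA[OF zc x(1) x1] x by simp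
  have NA: "N \<subseteq> A"
  proof
    fix y assume y: "y \<in> N"
    have yc: "y \<in> carrier G" using N(1) y by (rule subgroup.mem_carrier)
    have "y \<in> ?P" using subset_set_mult(1)[OF N(1) X(1)] y by blast
    then have "cj G y z = z" using z(3) cj_eq_self_iff[OF yc zc] by simp
    then show "y \<in> A" using normA[OF yc zA z(2)] zA by simp
  qed
  \<comment> \<open>Every g carries z into \<open>N\<close>, hence into A, and TI applies to all of
    \<open>G\<close>.\<close>
  have "normalizes G (carrier G) A"
    unfolding normalizes_def
  proof (intro ballI)
    fix g h assume g: "g \<in> carrier G" and h: "h \<in> A"
    have "cj G g z \<in> A" using N(2) g z(1) NA by (auto simp: normalizes_def)
    then show "cj G g h \<in> A" using TI_subgroup_cj[OF TI g zA z(2)] h by blast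
  qed
  then show False using subnormal_if_normal AF by blast
qed

text \<open>For H normal in K and L = H(P \<inter> K), the p-parts in |L| |P \<inter> H| = |H| |P
  \<inter> K| are compared. By induction |P \<inter> K| is the p-part of |K|, which bounds that of
  |L|; so |P \<inter> H| cannot fall short of the p-part of |H|.\<close>

lemma card_sylow_Int_subnormal:
  assumes p: "Factorial_Ring.prime p" and P: "sylow_sub G p P" and K: "subnormal G K"
  shows "card (P \<inter> K) = p ^ Factorial_Ring.multiplicity p (card K)"
  using K
proof (induction rule: subnormal.induct)
  case top
  have "P \<inter> carrier G = P" using P subgroup.subset by (auto simp: sylow_sub_def)
  then show ?case using P by (simp add: sylow_sub_def order_def)
next
  case (step K H)
  have Ps: "subgroup P G" "card P = p ^ Factorial_Ring.multiplicity p (order G)" using P by (auto simp: sylow_sub_def)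
  have K: "subgroup K G" using step.hyps(1) by (rule subnormal_subgroup)
  have n: "normalizes G K H" using step.hyps normal_in_iff[OF K step.hyps(2,3)] by simp
  have PK: "subgroup (P \<inter> K) G" using subgroup_Int[OF Ps(1) K] .
  have PH: "subgroup (P \<inter> H) G" using subgroup_Int[OF Ps(1) step.hyps(2)] .
  have n': "normalizes G (P \<inter> K) H" using n by (auto simp: normalizes_def)
  let ?L = "H <#> (P \<inter> K)"
  have L: "subgroup ?L G" using subgroup_set_mult[OF step.hyps(2) PK n'] .
  have LK: "?L \<subseteq> K" using step.hyps(3) K by (auto simp: set_mult_def subgroup.m_closed subsetD)
  have pp: "\<not> is_unit p" "p \<noteq> 0" using p by auto
  have pos: "card ?L > 0" "card H > 0" "card K > 0" using L step.hyps(2) K subgroup_card_pos by auto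
  obtain j where j: "card (P \<inter> H) = p ^ j"
    using subgroup_card_prime_power[OF PH Ps(1) _ Ps(2) p] by blast
  have "H \<inter> (P \<inter> K) = P \<inter> H" using step.hyps(3) by blast
  then have "card ?L * p ^ j = card H * p ^ Factorial_Ring.multiplicity p (card K)"
    using card_set_mult[OF step.hyps(2) PK] step.IH j by simp
  then have "Factorial_Ring.multiplicity p (card ?L * p ^ j)
      = Factorial_Ring.multiplicity p (card H * p ^ Factorial_Ring.multiplicity p (card K))" by simp
  then have "Factorial_Ring.multiplicity p (card ?L) + j
      = Factorial_Ring.multiplicity p (card H) + Factorial_Ring.multiplicity p (card K)"
    using p pp pos by (simp add: prime_elem_multiplicity_mult_distrib multiplicity_same_power)
  moreover have "Factorial_Ring.multiplicity p (card ?L) \<le> Factorial_Ring.multiplicity p (card K)"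
    using card_subgroup_dvd[OF L K LK] pos by (intro dvd_imp_multiplicity_le) auto
  moreover have "j \<le> Factorial_Ring.multiplicity p (card H)"
    using card_subgroup_dvd[OF PH step.hyps(2)] j pos pp by (intro multiplicity_geI) auto
  ultimately have "j = Factorial_Ring.multiplicity p (card H)" by linarith
  then show ?case using j by simp
qed

lemma ex_sylow:
  assumes p: "Factorial_Ring.prime p"
  shows "\<exists>P. sylow_sub G p P"
  using sylow_in[OF p subgroup_self, of "Factorial_Ring.multiplicity p (order G)"]
  by (auto simp: sylow_sub_def order_def multiplicity_dvd)

lemma sylow_sub_cj:
  assumes "sylow_sub G p P" "g \<in> carrier G"
  shows "sylow_sub G p (cj G g ` P)"
  using assms subgroup_cj_image card_cj_image subgroup.subset unfolding sylow_sub_def by metis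

text \<open>By the preceding lemma a subnormal p-subgroup lies in every Sylow p-subgroup, hence in
  their normal intersection.\<close>

lemma ex_p_core_if_subnormal:
  assumes p: "Factorial_Ring.prime p" and B: "subnormal G B" "card B = p ^ n" "B \<noteq> {\<one>}"
  shows "\<exists>N m. subgroup N G \<and> normalizes G (carrier G) N \<and> card N = p ^ m \<and> N \<noteq> {\<one>}"
proof -
  obtain P where P: "sylow_sub G p P" using ex_sylow[OF p] by blast
  have Bs: "subgroup B G" using B(1) by (rule subnormal_subgroup)
  have Ps: "subgroup P G" using P by (simp add: sylow_sub_def)
  have in_sylow: "B \<subseteq> Q" if "sylow_sub G p Q" for Q
  proof -
    have "card (Q \<inter> B) = card B"
      using card_sylow_Int_subnormal[OF p that B(1)] B(2) p by (simp add: multiplicity_same_power)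
    then have "Q \<inter> B = B" using finite_subgroup[OF Bs] by (intro card_subset_eq) auto
    then show ?thesis by blast
  qed
  \<comment> \<open>The intersection of all conjugates of \<open>P\<close>.\<close>
  define N where "N = {x \<in> carrier G. \<forall>g\<in>carrier G. cj G g x \<in> P}"
  have N: "subgroup N G"
  proof (rule subgroup_of_closed)
    have "\<one> \<in> N" using Ps by (auto simp: N_def subgroup.one_closed)
    then show "N \<noteq> {}" by blast
    show "a \<otimes> b \<in> N" if "a \<in> N" "b \<in> N" for a b
      using that Ps by (auto simp: N_def cj_mult_right subgroup.m_closed)
  qed (auto simp: N_def)
  have "N \<subseteq> P"
  proof
    fix x assume "x \<in> N"
    then have "x \<in> carrier G" "cj G \<one> x \<in> P" unfolding N_def using one_closed by blast+
    then show "x \<in> P" by simp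
  qed
  then obtain m where m: "card N = p ^ m"
    using subgroup_card_prime_power[OF N Ps _ _ p] P unfolding sylow_sub_def by blast
  have nN: "normalizes G (carrier G) N"
    unfolding normalizes_def
  proof (intro ballI)
    fix k h assume "k \<in> carrier G" "h \<in> N"
    then show "cj G k h \<in> N" by (simp add: N_def flip: cj_mult_left)
  qed
  have "B \<subseteq> N"
  proof
    fix b assume b: "b \<in> B"
    have bc: "b \<in> carrier G" using Bs b by (rule subgroup.mem_carrier)
    have "cj G g b \<in> P" if g: "g \<in> carrier G" for g
    proof -
      have "b \<in> cj G (inv g) ` P" using in_sylow[OF sylow_sub_cj[OF P]] g b by blast
      then obtain y where "y \<in> P" "b = cj G (inv g) y" by blast
      then show ?thesis using g subgroup.mem_carrier[OF Ps] by simp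
    qed
    then show "b \<in> N" using bc by (simp add: N_def)
  qed
  then have "N \<noteq> {\<one>}" using B(3) subgroup_nontrivial[OF Bs] by blast
  then show ?thesis using N nN m by blast
qed

text \<open>If k and l have the same commutator with x, then l k^-1 is fixed by x. On an x-invariant
  \<open>L\<close> finiteness makes the map surjective too.\<close>

lemma inj_on_commutator:
  assumes L: "subgroup L G" and x: "x \<in> carrier G" "\<And>l. l \<in> L \<Longrightarrow> cj G x l = l \<Longrightarrow> l = \<one>"
  shows "inj_on (\<lambda>l. inv l \<otimes> cj G x l) L"
proof (rule inj_onI)
  fix k l assume k: "k \<in> L" and l: "l \<in> L" and eq: "inv k \<otimes> cj G x k = inv l \<otimes> cj G x l"
  have m: "k \<in> carrier G" "l \<in> carrier G" using k l subgroup.mem_carrier[OF L] by auto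
  have kl: "l \<otimes> inv k \<in> L" using k l L by (simp add: subgroup_closed)
  have "l \<otimes> (inv k \<otimes> cj G x k) \<otimes> inv (cj G x k) = l \<otimes> (inv l \<otimes> cj G x l) \<otimes> inv (cj G x k)" using eq by simp
  then have "l \<otimes> inv k = cj G x l \<otimes> inv (cj G x k)"
    using m x by (simp add: m_assoc)
  also have "\<dots> = cj G x (l \<otimes> inv k)"
    using m x by (simp add: cj_mult_right cj_inv_right)
  finally have "cj G x (l \<otimes> inv k) = l \<otimes> inv k" ..
  then have "l \<otimes> inv k = \<one>" using x(2)[OF kl] by simp
  then have "l \<otimes> inv k \<otimes> k = k" using m by simp
  then show "k = l" using m by (simp add: m_assoc)
qed

lemma commutator_image:
  assumes L: "subgroup L G" "\<And>l. l \<in> L \<Longrightarrow> cj G x l \<in> L"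
    and x: "x \<in> carrier G" "\<And>l. l \<in> L \<Longrightarrow> cj G x l = l \<Longrightarrow> l = \<one>"
  shows "(\<lambda>l. inv l \<otimes> cj G x l) ` L = L"
proof (rule card_subset_eq)
  show "finite L" using L(1) by (rule finite_subgroup)
  show "(\<lambda>l. inv l \<otimes> cj G x l) ` L \<subseteq> L"
    using L by (auto simp: subgroup_closed)
  show "card ((\<lambda>l. inv l \<otimes> cj G x l) ` L) = card L"
    by (rule card_image) (rule inj_on_commutator[OF L(1) x])
qed

end

section \<open>Frobenius groups with given kernel and complement\<close>

locale frobenius_group = finite_group +
  fixes K C
  assumes K: "subgroup K G" and K_normal: "normalizes G (carrier G) K"
    and K_Int_C: "K \<inter> C = {\<one>}" and K_mult_C: "K <#> C = carrier G"
    and malnormal: "malnormal_in G (carrier G) C"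
    and K_nontrivial: "K \<noteq> {\<one>}"
begin

lemma C: "subgroup C G"
  using malnormal by (simp add: malnormal_in_def)

lemma C_carrier [simp]: "c \<in> C \<Longrightarrow> c \<in> carrier G"
  using C by (rule subgroup.mem_carrier)

lemma K_carrier [simp]: "k \<in> K \<Longrightarrow> k \<in> carrier G"
  using K by (rule subgroup.mem_carrier)

lemma K_cj [simp]: "g \<in> carrier G \<Longrightarrow> k \<in> K \<Longrightarrow> cj G g k \<in> K"
  using K_normal by (simp add: normalizes_def)

lemma fixed_point_free:
  assumes "x \<in> C" "x \<noteq> \<one>" "k \<in> K" "cj G x k = k"
  shows "k = \<one>"
proof -
  have "cj G k x = x" using assms cj_eq_self_iff[of x k] cj_eq_self_iff[of k x] by simp
  then have "k \<in> C" using malnormal_inD[OF malnormal, of k x] assms by simp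
  then show ?thesis using assms K_Int_C by blast
qed

text \<open>Going down a subnormal series: if \<open>K\<close> lies in L and H is normal in L with x
  in H, then H contains all commutators [k,x], and these exhaust \<open>K\<close> because x acts
  without fixed points.\<close>

lemma subnormal_contains_kernel:
  assumes B: "subnormal G B" and x: "x \<in> B" "x \<in> C" "x \<noteq> \<one>"
  shows "K \<subseteq> B"
  using B x(1)
proof (induction rule: subnormal.induct)
  case top
  then show ?case by auto
next
  case (step L H)
  have L: "subgroup L G" using step.hyps(1) by (rule subnormal_subgroup)
  have n: "normalizes G L H" using step.hyps normal_in_iff[OF L step.hyps(2,3)] by simp
  have KL: "K \<subseteq> L" using step by blast
  have "inv k \<otimes> cj G x k \<in> H" if k: "k \<in> K" for k
  proof -
    have "inv k \<otimes> cj G x k = cj G k (inv x) \<otimes> x"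
      using k x by (simp add: cj_def m_assoc)
    moreover have "cj G k (inv x) \<in> H"
      using n k KL step.prems step.hyps(2) by (auto simp: normalizes_def subgroup.m_inv_closed)
    ultimately show ?thesis using step.prems step.hyps(2) by (simp add: subgroup.m_closed)
  qed
  moreover have "(\<lambda>k. inv k \<otimes> cj G x k) ` K = K"
    using x fixed_point_free[OF x(2,3)] by (intro commutator_image[OF K]) auto
  ultimately show ?case using image_subsetI[of K "\<lambda>k. inv k \<otimes> cj G x k" H] by simp
qed

text \<open>An element of order r in \<open>C\<close> would fix a non-identity element of
  \<open>K\<close>.\<close>

lemma prime_dvd_complement_not_kernel:
  assumes r: "Factorial_Ring.prime r" "r dvd card C"
  shows "\<not> r dvd card K"
proof
  assume rK: "r dvd card K"
  obtain x where x: "x \<in> C" "ord x = r" using cauchy_in[OF r(1) C r(2)] by blast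
  have xc: "x \<in> carrier G" using x by simp
  have "card (generate G {x}) = r ^ 1" using generate_pow_card[OF xc] x by simp
  moreover have "normalizes G (generate G {x}) K"
    using K_normal subgroup.subset[OF subgroup_generate[OF xc]] by (auto simp: normalizes_def)
  ultimately obtain z where z: "z \<in> K" "z \<noteq> \<one>" "\<forall>s\<in>generate G {x}. s \<otimes> z = z \<otimes> s"
    using ex_central_fixed[OF subgroup_generate[OF xc] _ r(1) K rK] by blast
  then have "cj G x z = z" using cj_eq_self_iff[OF xc, of z] mem_generate by auto
  moreover have "x \<noteq> \<one>" using x r by auto
  ultimately show False using fixed_point_free[OF x(1) _ z(1)] z(2) by blast
qed

lemma order_eq: "order G = card K * card C"
  using card_set_mult_disjoint[OF K C K_Int_C] K_mult_C by (simp add: order_def)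

end

section \<open>The Frobenius kernel under the TI condition\<close>

locale frobenius_TI_group = frobenius_group +
  fixes p
  assumes p: "Factorial_Ring.prime p"
    and star: "\<And>H. subgroup H G \<Longrightarrow> p dvd card H \<Longrightarrow> TI_subgroup G H \<or> subnormal G H"
begin

text \<open>A = L<x> meets \<open>K\<close> in \<open>L\<close>, so it does not contain
  \<open>K\<close>; hence it is not subnormal, and so it is TI. As k carries l into A, it normalizes
  A, and [k,x] lies in A \<inter> K = L. Commutators with x map \<open>L\<close> onto
  \<open>L\<close>, so [k,x] = [m,x] for some m in \<open>L\<close>, and injectivity on
  \<open>K\<close> gives k = m.\<close>

lemma kernel_subgroup_TI:
  assumes x: "x \<in> C" "ord x = p"
    and L: "subgroup L G" "L \<subseteq> K" "L \<noteq> K" "\<And>l. l \<in> L \<Longrightarrow> cj G x l \<in> L"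
    and k: "k \<in> K" and l: "l \<in> L" "l \<noteq> \<one>" "cj G k l \<in> L"
  shows "k \<in> L"
proof -
  have xc: "x \<in> carrier G" using x by simp
  have x1: "x \<noteq> \<one>" using x p by auto
  have Lc: "L \<subseteq> carrier G" using L(1) by (rule subgroup.subset)
  let ?X = "generate G {x}"
  have X: "subgroup ?X G" using subgroup_generate[OF xc] .
  have XC: "?X \<subseteq> C" using generate_subset[OF C x(1)] .
  have nX: "normalizes G ?X L" using normalizes_generate[OF Lc xc L(4)] .
  let ?A = "L <#> ?X"
  have A: "subgroup ?A G" using subgroup_set_mult[OF L(1) X nX] .
  have LA: "L \<subseteq> ?A" and XA: "?X \<subseteq> ?A" using subset_set_mult[OF L(1) X] by auto
  have xA: "x \<in> ?A" using XA mem_generate by blast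
  have AK: "?A \<inter> K = L"
  proof
    show "?A \<inter> K \<subseteq> L"
    proof
      fix a assume a: "a \<in> ?A \<inter> K"
      then obtain m y where my: "m \<in> L" "y \<in> ?X" "a = m \<otimes> y" by (auto simp: set_mult_def)
      have mc: "m \<in> carrier G" and yc: "y \<in> carrier G" using my Lc XC by auto
      have "y = inv m \<otimes> a" using my mc yc by simp
      moreover have "inv m \<otimes> a \<in> K"
        using a my L(2) K by (auto simp: subgroup_closed subsetD)
      ultimately have "y \<in> K \<inter> C" using my XC by auto
      then have "y = \<one>" using K_Int_C by blast
      then show "a \<in> L" using my mc by simp
    qed
    show "L \<subseteq> ?A \<inter> K" using LA L(2) by blast
  qed
  have "p dvd card ?A"
    using ord_dvd_card[OF A xA] x by simp
  moreover have "\<not> subnormal G ?A"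
  proof
    assume "subnormal G ?A"
    then have "K \<subseteq> ?A" using subnormal_contains_kernel xA x x1 by blast
    then show False using AK L(2,3) by blast
  qed
  ultimately have TI: "TI_subgroup G ?A" using star A by blast
  have lA: "l \<in> ?A" "cj G k l \<in> ?A" using l LA by auto
  have "cj G k (inv x) \<in> ?A"
    using TI_subgroup_cj[OF TI K_carrier[OF k] lA(1) l(2) lA(2)] xA A by (simp add: subgroup.m_inv_closed)
  moreover have "inv k \<otimes> cj G x k = cj G k (inv x) \<otimes> x"
    using k xc by (simp add: cj_def m_assoc)
  ultimately have "inv k \<otimes> cj G x k \<in> ?A" using A xA by (simp add: subgroup.m_closed)
  moreover have "inv k \<otimes> cj G x k \<in> K" using k xc K by (simp add: subgroup_closed)
  ultimately have "inv k \<otimes> cj G x k \<in> L" using AK by blast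
  then obtain m where m: "m \<in> L" "inv k \<otimes> cj G x k = inv m \<otimes> cj G x m"
    using commutator_image[OF L(1,4) xc] fixed_point_free[OF x(1) x1] L(2) by (smt (verit, best) imageE subsetD)
  then have "k = m" using inj_on_commutator[OF K xc] fixed_point_free[OF x(1) x1] k L(2) by (auto simp: inj_on_def)
  then show ?thesis using m by simp
qed

lemma invariant_normal_trivial:
  assumes x: "x \<in> C" "ord x = p"
    and L: "subgroup L G" "L \<subseteq> K" "\<And>l. l \<in> L \<Longrightarrow> cj G x l \<in> L" "normalizes G K L"
  shows "L = {\<one>} \<or> L = K"
proof (rule ccontr)
  assume "\<not> ?thesis"
  then have ne: "L \<noteq> {\<one>}" "L \<noteq> K" by auto
  obtain l where l: "l \<in> L" "l \<noteq> \<one>" using ne(1) subgroup_nontrivial[OF L(1)] by blast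
  have "k \<in> L" if k: "k \<in> K" for k
    using kernel_subgroup_TI[OF x L(1,2) ne(2) L(3) k l] L(4) k l by (simp add: normalizes_def)
  then show False using ne(2) L(2) by blast
qed

text \<open>The number of Sylow q-subgroups of \<open>K\<close> divides |K|, which is prime to p, so
  x of order p fixes one of them.\<close>

lemma ex_invariant_sylow:
  assumes x: "x \<in> C" "ord x = p" and q: "Factorial_Ring.prime q"
  shows "\<exists>Q. subgroup Q G \<and> Q \<subseteq> K \<and> card Q = q ^ Factorial_Ring.multiplicity q (card K) \<and> (\<forall>y\<in>Q. cj G x y \<in> Q)"
proof -
  have xc: "x \<in> carrier G" using x by simp
  let ?e = "Factorial_Ring.multiplicity q (card K)"
  have Kpos: "card K > 0" using subgroup_card_pos[OF K] .
  obtain Q where Q: "subgroup Q G" "Q \<subseteq> K" "card Q = q ^ ?e"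
    using sylow_in[OF q K multiplicity_dvd] by blast
  have Qc: "Q \<subseteq> carrier G" using Q(1) by (rule subgroup.subset)
  have ci: "card ((\<lambda>k. Q #> k) ` K) * card Q = card K" using card_cosets_in[OF K Q(1,2)] .
  have nq: "\<not> q dvd card ((\<lambda>k. Q #> k) ` K)"
  proof
    assume "q dvd card ((\<lambda>k. Q #> k) ` K)"
    then have "q * q ^ ?e dvd card K" using ci Q(3) by (metis dvd_refl mult_dvd_mono)
    then have "Suc ?e \<le> ?e" using Kpos q by (intro multiplicity_geI) auto
    then show False by simp
  qed
  define E where "E = (\<lambda>k. cj G k ` Q) ` K"
  \<comment> \<open>The \<open>K\<close>-conjugates of Q are all the Sylow q-subgroups of
    \<open>K\<close>. This makes E stable under x, which lies outside \<open>K\<close>.\<close>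
  have conj: "R \<in> E" if R: "subgroup R G" "R \<subseteq> K" "card R = q ^ ?e" for R
  proof -
    obtain k where k: "k \<in> K" "\<forall>y\<in>R. cj G (inv k) y \<in> Q"
      using sylow_conjugate[OF q K Q(1,2) nq R] by blast
    have "R \<subseteq> cj G k ` Q"
    proof
      fix y assume y: "y \<in> R"
      have "y \<in> carrier G" using R(1) y by (rule subgroup.mem_carrier)
      then have "y = cj G k (cj G (inv k) y)" using k by simp
      then show "y \<in> cj G k ` Q" using k y by blast
    qed
    moreover have "finite (cj G k ` Q)" using Q(1) finite_subgroup by blast
    moreover have "card (cj G k ` Q) = card R" using card_cj_image[OF K_carrier[OF k(1)] Qc] Q R by simp
    ultimately have "R = cj G k ` Q" by (intro card_subset_eq) auto
    then show ?thesis using k by (auto simp: E_def)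
  qed
  have E_mem: "subgroup R G" "R \<subseteq> K" "card R = q ^ ?e" if "R \<in> E" for R
    using that Q Qc K by (auto simp: E_def subgroup_cj_image card_cj_image subgroup_cj_closed subsetD)
  have "card E dvd card K"
  proof -
    have im: "cj G (a \<otimes> b) ` Q = cj G b ` (cj G a ` Q)" if "a \<in> K" "b \<in> K" for a b
      using that Qc by (auto simp: image_image cj_mult_left subsetD)
    have "card K = card ((\<lambda>g. cj G g ` Q) ` K) * card {g \<in> K. cj G g ` Q = Q}"
      by (rule orbit_stabilizer[OF K, of "\<lambda>g R. cj G g ` R" Q])
        (use Qc im in \<open>auto simp: subsetD image_iff\<close>)
    then show ?thesis unfolding E_def by (metis dvd_triv_left)
  qed
  have pC: "p dvd card C" using ord_dvd_card[OF C x(1)] x by simp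
  have pE: "\<not> p dvd card E"
    using \<open>card E dvd card K\<close> prime_dvd_complement_not_kernel[OF p pC] dvd_trans by blast
  let ?X = "generate G {x}"
  have X: "subgroup ?X G" "card ?X = p ^ 1" using subgroup_generate[OF xc] generate_pow_card[OF xc] x by simp_all
  have Xc: "g \<in> carrier G" if "g \<in> ?X" for g using X(1) that by (rule subgroup.mem_carrier)
  have "p dvd card (E - {R \<in> E. \<forall>g\<in>?X. cj G g ` R = R})"
  proof (rule prime_dvd_card_non_fixed[OF X p])
    show "finite E" using finite_subgroup[OF K] by (simp add: E_def)
    show "cj G g ` R \<in> E" if g: "g \<in> ?X" and R: "R \<in> E" for g R
      using E_mem[OF R] Xc[OF g] subgroup.subset[OF E_mem(1)[OF R]]
      by (intro conj) (auto simp: subgroup_cj_image card_cj_image subsetD)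
    show "cj G \<one> ` R = R" if R: "R \<in> E" for R
      using subgroup.subset[OF E_mem(1)[OF R]] by (force simp: subsetD)
    show "cj G (g \<otimes> h) ` R = cj G h ` (cj G g ` R)" if "g \<in> ?X" "h \<in> ?X" "R \<in> E" for g h R
      using that subgroup.subset[OF E_mem(1)[OF that(3)]] Xc by (auto simp: image_image cj_mult_left subsetD)
  qed
  then have "{R \<in> E. \<forall>g\<in>?X. cj G g ` R = R} \<noteq> {}" using pE by (metis Diff_empty)
  then obtain R where R: "R \<in> E" "\<forall>g\<in>?X. cj G g ` R = R" by blast
  then have "\<forall>y\<in>R. cj G x y \<in> R" using mem_generate by blast
  then show ?thesis using E_mem[OF R(1)] by blast
qed

theorem kernel_elementary_abelian:
  assumes x: "x \<in> C" "ord x = p"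
  shows "\<exists>q r. Factorial_Ring.prime q \<and> q \<noteq> p \<and> r \<ge> 1 \<and> elem_abelian_sub G q r K"
proof -
  have xc: "x \<in> carrier G" using x by simp
  have pC: "p dvd card C" using ord_dvd_card[OF C x(1)] x by simp
  have Kc: "K \<subseteq> carrier G" using K by (rule subgroup.subset)
  have "card K \<noteq> 1" using K_nontrivial subgroup_card_eq_one[OF K] by simp
  then obtain q where q: "Factorial_Ring.prime q" "q dvd card K" using prime_factor_nat by blast
  have qp: "q \<noteq> p" using q prime_dvd_complement_not_kernel[OF p pC] by blast
  let ?e = "Factorial_Ring.multiplicity q (card K)"
  have e0: "?e > 0" using q subgroup_card_pos[OF K] by (simp add: prime_multiplicity_gt_zero_iff)
  obtain Q where Q: "subgroup Q G" "Q \<subseteq> K" "card Q = q ^ ?e" "\<And>y. y \<in> Q \<Longrightarrow> cj G x y \<in> Q"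
    using ex_invariant_sylow[OF x q(1)] by blast
  have Qc: "Q \<subseteq> carrier G" using Q(1) by (rule subgroup.subset)
  have "1 < q ^ ?e" using prime_gt_1_nat[OF q(1)] e0 by (rule one_less_power)
  then have "card Q \<noteq> 1" using Q(3) by linarith
  then have Q1: "Q \<noteq> {\<one>}" by auto
  \<comment> \<open>Otherwise Q is malnormal in \<open>K\<close>, so transfer gives it a complement
    L in \<open>K\<close>. As a Frobenius kernel L is normal in \<open>K\<close>, and it is
    invariant under x because Q is; being neither 1 nor \<open>K\<close>, it contradicts
    \<open>invariant_normal_trivial\<close>.\<close>
  have QK: "Q = K"
  proof (rule ccontr)
    assume ne: "Q \<noteq> K"
    have mal: "malnormal_in G K Q"
      using kernel_subgroup_TI[OF x Q(1,2) ne Q(4)] Q(1,2) by (auto simp: malnormal_in_def)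
    obtain L where L: "subgroup L G" "L \<subseteq> K" "L \<inter> Q = {\<one>}" "L <#> Q = K"
      using ex_malnormal_complement[OF K mal abelian_quotients_prime_power[OF q(1) Q(1,3)]] by blast
    have Leq: "L = frobenius_kernel G K Q" using complement_eq_frobenius_kernel[OF K mal L(1,3,4)] .
    have cjK: "cj G g ` K = K" if "g \<in> carrier G" for g
      using that by (intro cj_image_eq_if_subset[OF Kc]) auto
    have nL: "normalizes G K L"
      unfolding normalizes_def
    proof (intro ballI)
      fix k l assume k: "k \<in> K" and l: "l \<in> L"
      have "cj G (inv k \<otimes> k) ` Q \<subseteq> Q" using k Qc by auto
      then have "\<exists>u\<in>K. cj G (inv k \<otimes> u) ` Q \<subseteq> Q" using k by blast
      then show "cj G k l \<in> L"
        using frobenius_kernel_cj[OF Kc Qc K_carrier[OF k] cjK[OF K_carrier[OF k]] _ K] l unfolding Leq by blast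
    qed
    have xL: "cj G x l \<in> L" if l: "l \<in> L" for l
    proof -
      have "cj G x ` Q = Q" using Q(4) by (intro cj_image_eq_if_subset[OF Qc xc]) auto
      have "cj G (inv x) y \<in> Q" if y: "y \<in> Q" for y
      proof -
        obtain y' where "y' \<in> Q" "y = cj G x y'" using \<open>cj G x ` Q = Q\<close> y by blast
        then show ?thesis using xc Qc by auto
      qed
      then have "cj G (inv x \<otimes> \<one>) ` Q \<subseteq> Q" using xc by auto
      then have "\<exists>u\<in>K. cj G (inv x \<otimes> u) ` Q \<subseteq> Q" using subgroup.one_closed[OF K] by blast
      then show ?thesis
        using frobenius_kernel_cj[OF Kc Qc xc cjK[OF xc] _ K] l unfolding Leq by blast
    qed
    have "L = {\<one>} \<or> L = K" using invariant_normal_trivial[OF x L(1,2) xL nL] .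
    then show False
    proof
      assume "L = {\<one>}"
      then have "Q = K" using L(4) Qc by (auto simp: set_mult_def subsetD)
      then show False using ne by simp
    next
      assume "L = K"
      then have "Q = {\<one>}" using L(3) Q(2) by blast
      then show False using Q1 by simp
    qed
  qed
  have cK: "card K = q ^ ?e" using Q(3) QK by simp
  \<comment> \<open>Z is the centre of \<open>K\<close>, and W below consists of the elements killed
    by q. Both are invariant, and nontrivial because \<open>K\<close> is now a q-group, so each is
    all of \<open>K\<close>.\<close>
  define Z where "Z = {z \<in> K. \<forall>k\<in>K. k \<otimes> z = z \<otimes> k}"
  have Z: "subgroup Z G"
  proof (rule subgroup_of_closed)
    show "Z \<subseteq> carrier G" by (auto simp: Z_def)
    have "\<one> \<in> Z" using K by (auto simp: Z_def subgroup.one_closed)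
    then show "Z \<noteq> {}" by blast
    show "a \<otimes> b \<in> Z" if "a \<in> Z" "b \<in> Z" for a b
    proof -
      have ab: "a \<in> K" "b \<in> K" using that by (auto simp: Z_def)
      have "k \<otimes> (a \<otimes> b) = a \<otimes> b \<otimes> k" if k: "k \<in> K" for k
      proof -
        have "k \<otimes> (a \<otimes> b) = a \<otimes> k \<otimes> b"
          using \<open>a \<in> Z\<close> ab k by (simp add: Z_def flip: m_assoc)
        also have "\<dots> = a \<otimes> (b \<otimes> k)" using \<open>b \<in> Z\<close> ab k by (simp add: Z_def m_assoc)
        finally show ?thesis using ab k by (simp add: m_assoc)
      qed
      then show ?thesis using ab K by (simp add: Z_def subgroup.m_closed)
    qed
  qed
  have xZ: "cj G g z \<in> Z" if g: "g \<in> carrier G" and z: "z \<in> Z" for g z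
  proof -
    have zK: "z \<in> K" using z by (simp add: Z_def)
    have "k \<otimes> cj G g z = cj G g z \<otimes> k" if k: "k \<in> K" for k
    proof -
      have "cj G (inv g) k \<in> K" using g k by simp
      then have "cj G (inv g) k \<otimes> z = z \<otimes> cj G (inv g) k" using z by (simp add: Z_def)
      then have "cj G g (cj G (inv g) k \<otimes> z) = cj G g (z \<otimes> cj G (inv g) k)" by simp
      then show ?thesis using g k zK by (simp add: cj_mult_right)
    qed
    then show ?thesis using g zK by (simp add: Z_def)
  qed
  have "Z = {\<one>} \<or> Z = K"
    by (rule invariant_normal_trivial[OF x Z]) (use xZ xc in \<open>auto simp: Z_def[symmetric] normalizes_def\<close>, simp add: Z_def)
  moreover have "Z \<noteq> {\<one>}"
  proof -
    have "normalizes G K K" using K by (simp add: normalizes_def subgroup_cj_closed)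
    then obtain z where "z \<in> K" "z \<noteq> \<one>" "\<forall>s\<in>K. s \<otimes> z = z \<otimes> s"
      using ex_central_fixed[OF K cK q(1) K q(2)] by blast
    then show ?thesis by (auto simp: Z_def)
  qed
  ultimately have ZK: "Z = K" by blast
  have ab: "a \<otimes> b = b \<otimes> a" if "a \<in> K" "b \<in> K" for a b
  proof -
    have "b \<in> Z" using that ZK by simp
    then show ?thesis using that by (simp add: Z_def)
  qed
  define W where "W = {w \<in> K. w [^] q = \<one>}"
  have W: "subgroup W G"
  proof (rule subgroup_of_closed)
    show "W \<subseteq> carrier G" by (auto simp: W_def)
    have "\<one> \<in> W" using K by (auto simp: W_def subgroup.one_closed)
    then show "W \<noteq> {}" by blast
    show "a \<otimes> b \<in> W" if "a \<in> W" "b \<in> W" for a b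
    proof -
      have "a \<in> K" "b \<in> K" using that by (auto simp: W_def)
      then have "(a \<otimes> b) [^] q = a [^] q \<otimes> b [^] q" using ab by (intro pow_mult_distrib) auto
      then show ?thesis using that K by (simp add: W_def subgroup.m_closed)
    qed
  qed
  have gW: "cj G g w \<in> W" if "g \<in> carrier G" "w \<in> W" for g w
    using that by (auto simp: W_def simp flip: cj_pow_right)
  have "W = {\<one>} \<or> W = K"
  proof (rule invariant_normal_trivial[OF x W])
    show "W \<subseteq> K" by (auto simp: W_def)
    show "normalizes G K W" using gW by (simp add: normalizes_def)
  qed (use gW xc in auto)
  moreover have "W \<noteq> {\<one>}"
  proof -
    obtain y where y: "y \<in> K" "ord y = q" using cauchy_in[OF q(1) K q(2)] by blast
    then have "y \<in> W" using pow_ord_eq_1[of y] by (simp add: W_def)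
    moreover have "y \<noteq> \<one>" using y q by auto
    ultimately show ?thesis by blast
  qed
  ultimately have "W = K" by blast
  then have "elem_abelian_sub G q ?e K"
    using K ab cK by (auto simp: elem_abelian_sub_def W_def)
  then show ?thesis using q(1) qp e0 by (intro exI[of _ q] exI[of _ ?e]) auto
qed

lemma irreducible_action:
  assumes x: "x \<in> C" "ord x = p" and S: "x \<in> S"
    and ab: "\<And>a b. a \<in> K \<Longrightarrow> b \<in> K \<Longrightarrow> a \<otimes> b = b \<otimes> a"
  shows "acts_irreducibly G S K"
  unfolding acts_irreducibly_def conjugate_eq_image
proof (intro conjI allI impI K_nontrivial, elim conjE)
  fix W assume W: "subgroup W G" "W \<subseteq> K" "\<forall>s\<in>S. cj G s ` W \<subseteq> W"
  have "cj G k w = w" if "k \<in> K" "w \<in> W" for k w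
    using that W(2) ab[of k w] by (subst cj_eq_self_iff) auto
  then have "normalizes G K W" by (auto simp: normalizes_def)
  then show "W = {\<one>} \<or> W = K" using W S by (intro invariant_normal_trivial[OF x]) auto
qed

end

section \<open>Dedekind groups of rank one\<close>

context finite_group
begin

lemma generate_commute:
  assumes "x \<in> carrier G" "a \<in> generate G {x}" "b \<in> generate G {x}"
  shows "a \<otimes> b = b \<otimes> a"
  using assms by (auto simp: mem_generate_iff nat_pow_mult add.commute)

lemma pow_mem_generate [simp]: "x \<in> carrier G \<Longrightarrow> x [^] (k::nat) \<in> generate G {x}"
  by (auto simp: mem_generate_iff)

lemma generate_eq_if_ord_eq:
  assumes y: "y \<in> carrier G" and x: "x \<in> generate G {y}" and o: "ord x = ord y"
  shows "y \<in> generate G {x}"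
proof -
  have xc: "x \<in> carrier G" using subgroup_generate[OF y] x by (rule subgroup.mem_carrier)
  have "generate G {x} = generate G {y}"
    using generate_subset[OF subgroup_generate[OF y] x] o finite_subgroup[OF subgroup_generate[OF y]]
      generate_pow_card[OF xc] generate_pow_card[OF y] by (intro card_subset_eq) auto
  then show ?thesis by simp
qed

lemma mem_generate_pow_coprime:
  assumes x: "x \<in> carrier G" and co: "coprime k (ord x)"
  shows "x \<in> generate G {x [^] k}"
  using pow_ord_eq_ord_iff[OF finite_carrier x, of k] co x by (simp add: generate_eq_if_ord_eq[OF x])

lemma generate_order_two:
  assumes c: "c \<in> carrier G" "ord c = 2" and y: "y \<in> generate G {c}" "y \<noteq> \<one>"
  shows "y = c"
proof -
  obtain k :: nat where k: "y = c [^] k" using y(1) mem_generate_iff[OF c(1)] by blast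
  have "c [^] (2::nat) = \<one>" using pow_ord_eq_1[OF c(1)] c(2) by simp
  then have "c [^] (2 * (k div 2)) = \<one>" using c(1) by (simp flip: nat_pow_pow)
  moreover have "c [^] k = c [^] (2 * (k div 2)) \<otimes> c [^] (k mod 2)" using c(1) by (simp add: nat_pow_mult)
  ultimately have "y = c [^] (k mod 2)" using k c(1) by simp
  then show ?thesis using y(2) c(1) by (cases "k mod 2 = 0") (auto simp: mod_2_eq_odd)
qed

text \<open>Commutator calculus for c = [a,b] central in <a,b>. In the third identity, collecting
  the factors of (ba)^n exchanges n choose 2 pairs.\<close>

lemma central_commutator_pow:
  assumes a: "a \<in> carrier G" and b: "b \<in> carrier G" and c: "c \<in> carrier G"
    and ab: "a \<otimes> b = b \<otimes> a \<otimes> c" and ca: "c \<otimes> a = a \<otimes> c" and cb: "c \<otimes> b = b \<otimes> c"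
  shows "a [^] (n::nat) \<otimes> b = b \<otimes> a [^] n \<otimes> c [^] n"
    and "a \<otimes> b [^] (n::nat) = b [^] n \<otimes> a \<otimes> c [^] n"
    and "(b \<otimes> a) [^] (n::nat) = b [^] n \<otimes> a [^] n \<otimes> c [^] (n choose 2)"
proof -
  have cka: "c [^] (k::nat) \<otimes> a = a \<otimes> c [^] k" and ckb: "c [^] (k::nat) \<otimes> b = b \<otimes> c [^] k" for k
    using group_commutes_pow[OF ca c a] group_commutes_pow[OF cb c b] by auto
  have ckaz: "c [^] (k::nat) \<otimes> (a \<otimes> z) = a \<otimes> (c [^] k \<otimes> z)"
    and ckbz: "c [^] (k::nat) \<otimes> (b \<otimes> z) = b \<otimes> (c [^] k \<otimes> z)" if "z \<in> carrier G" for k z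
    using cka[of k] ckb[of k] a b c that by (simp_all flip: m_assoc)
  have abz: "a \<otimes> (b \<otimes> z) = b \<otimes> (a \<otimes> (c \<otimes> z))" if "z \<in> carrier G" for z
  proof -
    have "a \<otimes> (b \<otimes> z) = (a \<otimes> b) \<otimes> z" using a b that by (simp add: m_assoc)
    also have "\<dots> = b \<otimes> (a \<otimes> (c \<otimes> z))" unfolding ab using a b c that by (simp add: m_assoc)
    finally show ?thesis .
  qed
  have ab': "a \<otimes> b = b \<otimes> (a \<otimes> c)" using ab a b c by (simp add: m_assoc)
  have cc: "c [^] (k::nat) \<otimes> c = c \<otimes> c [^] k" for k using nat_pow_Suc2[OF c, of k] by simp
  show anb: "a [^] (n::nat) \<otimes> b = b \<otimes> a [^] n \<otimes> c [^] n" for n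
  proof (induction n)
    case (Suc n)
    have "a [^] Suc n \<otimes> b = a [^] n \<otimes> (b \<otimes> (a \<otimes> c))"
      using a b c ab' by (simp add: m_assoc)
    also have "\<dots> = (a [^] n \<otimes> b) \<otimes> (a \<otimes> c)" using a b c by (simp add: m_assoc)
    also have "\<dots> = b \<otimes> a [^] n \<otimes> c [^] n \<otimes> (a \<otimes> c)" unfolding Suc.IH ..
    also have "\<dots> = b \<otimes> a [^] Suc n \<otimes> c [^] Suc n" using a b c by (simp add: m_assoc ckaz)
    finally show ?case .
  qed (use a b in simp)
  show "a \<otimes> b [^] (n::nat) = b [^] n \<otimes> a \<otimes> c [^] n" for n
  proof (induction n)
    case (Suc n)
    have "a \<otimes> b [^] Suc n = (a \<otimes> b [^] n) \<otimes> b" using a b by (simp add: m_assoc)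
    also have "\<dots> = b [^] n \<otimes> (a \<otimes> (c [^] n \<otimes> b))" unfolding Suc.IH using a b c by (simp add: m_assoc)
    also have "\<dots> = b [^] n \<otimes> (b \<otimes> (a \<otimes> (c \<otimes> c [^] n)))" using a b c by (simp add: ckb abz)
    also have "\<dots> = b [^] Suc n \<otimes> a \<otimes> c [^] Suc n" using a b c by (simp add: m_assoc cc)
    finally show ?case .
  qed (use a b in simp)
  show "(b \<otimes> a) [^] (n::nat) = b [^] n \<otimes> a [^] n \<otimes> c [^] (n choose 2)" for n
  proof (induction n)
    case (Suc n)
    let ?e = "n choose 2"
    have "(b \<otimes> a) [^] Suc n = b [^] n \<otimes> (a [^] n \<otimes> (c [^] ?e \<otimes> (b \<otimes> a)))"
      using Suc.IH a b c by (simp add: m_assoc)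
    also have "c [^] ?e \<otimes> (b \<otimes> a) = b \<otimes> (a \<otimes> c [^] ?e)" using a b c by (simp add: ckbz cka)
    also have "a [^] n \<otimes> (b \<otimes> (a \<otimes> c [^] ?e)) = (a [^] n \<otimes> b) \<otimes> (a \<otimes> c [^] ?e)" using a b c by (simp add: m_assoc)
    also have "\<dots> = b \<otimes> a [^] n \<otimes> c [^] n \<otimes> (a \<otimes> c [^] ?e)" unfolding anb ..
    also have "b [^] n \<otimes> \<dots> = b [^] Suc n \<otimes> a [^] Suc n \<otimes> (c [^] n \<otimes> c [^] ?e)"
      using a b c by (simp add: m_assoc ckaz)
    also have "c [^] n \<otimes> c [^] ?e = c [^] (Suc n choose 2)"
      using c by (simp add: nat_pow_mult numeral_2_eq_2)
    finally show ?case .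
  qed (use a b c in \<open>simp add: numeral_2_eq_2\<close>)
qed

text \<open>Normality of all cyclic subgroups, which amounts to that of all subgroups; abelian
  groups are included.\<close>

definition dedekind :: "'a set \<Rightarrow> bool" where
  "dedekind H \<longleftrightarrow> subgroup H G \<and> (\<forall>a\<in>H. \<forall>h\<in>H. cj G h a \<in> generate G {a})"

text \<open>At most one subgroup of each prime order; for Dedekind groups this excludes precisely
  the subgroups Z_r x Z_r.\<close>

definition rank_one :: "'a set \<Rightarrow> bool" where
  "rank_one H \<longleftrightarrow> (\<forall>x\<in>H. \<forall>y\<in>H. Factorial_Ring.prime (ord x) \<longrightarrow> ord y = ord x \<longrightarrow> y \<in> generate G {x})"

text \<open>[a,b] equals both a^-1 a^b, which lies in <a>, and (b^-1)^a b, which lies in <b>; hence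
  it commutes with a and with b.\<close>

lemma dedekind_commutator:
  assumes H: "dedekind H" and a: "a \<in> H" and b: "b \<in> H"
  shows "\<exists>c. c \<in> generate G {a} \<and> c \<in> generate G {b} \<and> a \<otimes> b = b \<otimes> a \<otimes> c \<and> c \<otimes> a = a \<otimes> c \<and> c \<otimes> b = b \<otimes> c"
proof -
  have sub: "subgroup H G" using H by (simp add: dedekind_def)
  have m: "a \<in> carrier G" "b \<in> carrier G" using sub a b subgroup.mem_carrier[OF sub] by simp_all
  let ?c = "inv a \<otimes> cj G b a"
  have "cj G b a \<in> generate G {a}" using H a b by (simp add: dedekind_def)
  then have ca: "?c \<in> generate G {a}"
    using subgroup_generate[OF m(1)] by (simp add: subgroup_closed)
  have "cj G a (inv b) = inv (cj G a b)" using m by (simp add: cj_inv_right)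
  moreover have "cj G a b \<in> generate G {b}" using H a b by (simp add: dedekind_def)
  ultimately have "cj G a (inv b) \<otimes> b \<in> generate G {b}"
    using subgroup_generate[OF m(2)] by (simp add: subgroup_closed)
  moreover have "?c = cj G a (inv b) \<otimes> b" using m by (simp add: cj_def m_assoc)
  ultimately have cb: "?c \<in> generate G {b}" by simp
  have "a \<otimes> b = b \<otimes> a \<otimes> ?c" using m by (simp add: cj_def m_assoc)
  moreover have "?c \<otimes> a = a \<otimes> ?c" using generate_commute[OF m(1) ca mem_generate] .
  moreover have "?c \<otimes> b = b \<otimes> ?c" using generate_commute[OF m(2) cb mem_generate] .
  ultimately show ?thesis using ca cb by blast
qed

lemma ex_prime_order_power:
  assumes x: "x \<in> carrier G" "ord x = r ^ m" "x \<noteq> \<one>" and r: "Factorial_Ring.prime r"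
  shows "\<exists>k. m = Suc k \<and> ord (x [^] (r ^ k)) = r"
proof -
  have "m \<noteq> 0" using x ord_eq_1[OF x(1)] by (cases m) auto
  then obtain k where k: "m = Suc k" using not0_implies_Suc by blast
  have "ord (x [^] (r ^ k)) = r ^ m div r ^ k"
    using ord_pow[OF x(1), of "r ^ k"] x(2) k r by (simp add: prime_gt_0_nat)
  then show ?thesis using k r by (simp add: prime_gt_0_nat)
qed

text \<open>The aim is an element of order r outside X = <x>, against rank one. A power v of y just
  outside X is corrected by a in X to w = va with w^r = c^(r choose 2), where c = [a,v] and c^r = 1.
  For odd r this is 1. For r = 2 it leaves w^2 = c of order 2, and if ord x \<ge> 8, a further
  factor u of order 4 from X gives (uw)^2 = 1.\<close>

lemma incomparable_prime_power_elements:
  assumes H: "dedekind H" and rk: "rank_one H" and r: "Factorial_Ring.prime r"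
    and x: "x \<in> H" "ord x = r ^ m" and y: "y \<in> H" "ord y = r ^ n"
    and yx: "y \<notin> generate G {x}" and xy: "x \<notin> generate G {y}"
  shows "r = 2 \<and> ord x = 4 \<and> x \<otimes> y \<noteq> y \<otimes> x"
proof -
  have sub: "subgroup H G" using H by (simp add: dedekind_def)
  have xc: "x \<in> carrier G" and yc: "y \<in> carrier G" using x y subgroup.mem_carrier[OF sub] by auto
  let ?X = "generate G {x}"
  have X: "subgroup ?X G" using subgroup_generate[OF xc] .
  have XH: "?X \<subseteq> H" using generate_subset[OF sub x(1)] .
  have x1: "x \<noteq> \<one>" using xy subgroup.one_closed[OF subgroup_generate[OF yc]] by auto
  have "y [^] (r ^ n) \<in> ?X" using pow_ord_eq_1[OF yc] y(2) X by (simp add: subgroup.one_closed)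
  then have ex: "\<exists>k. y [^] (r ^ k) \<in> ?X" by blast
  \<comment> \<open>The first of y, y^r, y^(r^2), ... inside <x>; its predecessor v is outside,
    while v^r is inside.\<close>
  define k where "k = (LEAST k. y [^] (r ^ k) \<in> ?X)"
  have kX: "y [^] (r ^ k) \<in> ?X" unfolding k_def using ex by (rule LeastI_ex)
  have "k \<noteq> 0" using kX yx yc by (cases k) auto
  then obtain b where b: "k = Suc b" using not0_implies_Suc by blast
  define v where "v = y [^] (r ^ b)"
  have vX: "v \<notin> ?X" unfolding v_def using not_less_Least[of b "\<lambda>k. y [^] (r ^ k) \<in> ?X"] b k_def by auto
  have vc: "v \<in> carrier G" using yc by (simp add: v_def)
  have vH: "v \<in> H" unfolding v_def using subgroup_pow_closed[OF sub y(1)] .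
  have vr: "v [^] r \<in> ?X" using kX yc b by (simp add: v_def nat_pow_pow mult.commute)
  then obtain i :: nat where i: "v [^] r = x [^] i" using mem_generate_iff[OF xc] by blast
  have "r dvd i"
  proof (rule ccontr)
    assume "\<not> r dvd i"
    then have "coprime i (ord x)" using r x(2) by (metis coprime_commute coprime_power_right_iff prime_imp_coprime)
    then have "x \<in> generate G {v [^] r}" using mem_generate_pow_coprime[OF xc] i by simp
    moreover have "v [^] r \<in> generate G {y}" using yc by (simp add: v_def nat_pow_pow)
    ultimately have "x \<in> generate G {y}" using generate_subset[OF subgroup_generate[OF yc]] by blast
    then show False using xy by blast
  qed
  then obtain j where j: "i = r * j" by blast
  \<comment> \<open>Here v^r = (x^j)^r, so v x^-j would have order r if v and x^j commuted.\<close>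
  define a where "a = inv (x [^] j)"
  have aX: "a \<in> ?X" unfolding a_def using X xc by (simp add: subgroup.m_inv_closed)
  have ac: "a \<in> carrier G" using xc by (simp add: a_def)
  have aH: "a \<in> H" using aX XH by blast
  define w where "w = v \<otimes> a"
  have wc: "w \<in> carrier G" using vc ac by (simp add: w_def)
  have wH: "w \<in> H" using vH aH sub by (simp add: w_def subgroup.m_closed)
  have wX: "w \<notin> ?X"
  proof
    assume "w \<in> ?X"
    then have "w \<otimes> inv a \<in> ?X" using aX X by (simp add: subgroup_closed)
    then show False using vX vc ac by (simp add: w_def m_assoc)
  qed
  have w1: "w \<noteq> \<one>" using wX X subgroup.one_closed by blast
  obtain c where c: "c \<in> generate G {a}" "c \<in> generate G {v}" "a \<otimes> v = v \<otimes> a \<otimes> c" "c \<otimes> a = a \<otimes> c" "c \<otimes> v = v \<otimes> c"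
    using dedekind_commutator[OF H aH vH] by blast
  have cX: "c \<in> ?X" using c(1) generate_subset[OF X aX] by blast
  have cc: "c \<in> carrier G" using X cX by (rule subgroup.mem_carrier)
  have cH: "c \<in> H" using cX XH by blast
  note cp = central_commutator_pow[OF ac vc cc c(3,4,5)]
  have cr: "c [^] r = \<one>"
  proof -
    have "v [^] r \<otimes> a = a \<otimes> v [^] r" using generate_commute[OF xc vr aX] .
    also have "\<dots> = v [^] r \<otimes> a \<otimes> c [^] r" by (rule cp(2))
    finally have "v [^] r \<otimes> a \<otimes> c [^] r = v [^] r \<otimes> a" ..
    then show ?thesis using vc ac cc by simp
  qed
  have "v [^] r \<otimes> a [^] r = \<one>"
    unfolding i j a_def using xc by (simp add: nat_pow_inv nat_pow_pow mult.commute)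
  then have wr: "w [^] r = c [^] (r choose 2)" using cp(3)[of r] cc by (simp add: w_def)
  obtain m' where m': "m = Suc m'" "ord (x [^] (r ^ m')) = r" using ex_prime_order_power[OF xc x(2) x1 r] by blast
  have key: "u \<in> ?X" if u: "u \<in> H" "ord u = r" for u
  proof -
    have "x [^] (r ^ m') \<in> H" using subgroup_pow_closed[OF sub x(1)] .
    then have "u \<in> generate G {x [^] (r ^ m')}" using rk u m'(2) r by (simp add: rank_one_def)
    then show ?thesis using generate_subset[OF X, of "x [^] (r ^ m')"] xc by auto
  qed
  have prime_ord: "ord u = r" if "u \<in> carrier G" "u \<noteq> \<one>" "u [^] r = \<one>" for u
    using that r ord_eq_1 pow_eq_id by (metis prime_nat_iff)
  have "w [^] r \<noteq> \<one>" using key[OF wH prime_ord[OF wc w1]] wX by blast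
  then have c2: "c [^] (r choose 2) \<noteq> \<one>" using wr by simp
  have r2: "r = 2"
  proof (rule ccontr)
    assume "r \<noteq> 2"
    then have "2 < r" using prime_ge_2_nat[OF r] by simp
    then have "even (r - 1)" using prime_odd_nat[OF r] by simp
    then obtain t where "r - 1 = 2 * t" by blast
    then have "r choose 2 = r * t" by (simp add: choose_two)
    then have "r dvd (r choose 2)" by simp
    then have "c [^] (r choose 2) = \<one>" using cr cc by (metis dvd_trans pow_eq_id)
    then show False using c2 by blast
  qed
  have cc2: "c [^] (2::nat) = \<one>" and wc2: "w [^] (2::nat) = c" and c1: "c \<noteq> \<one>"
    using cr wr c2 cc unfolding r2 by simp_all
  have oc: "ord c = 2" using prime_ord[OF cc c1] cr r2 by simp
  have ncav: "a \<otimes> v \<noteq> v \<otimes> a" using c(3) c1 ac vc cc by simp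
  have ncxv: "x \<otimes> v \<noteq> v \<otimes> x"
  proof
    assume e: "x \<otimes> v = v \<otimes> x"
    have "x [^] j \<otimes> v = v \<otimes> x [^] j" using group_commutes_pow[OF e xc vc] .
    then have "cj G v (x [^] j) = x [^] j" using cj_eq_self_iff[OF vc, of "x [^] j"] xc by simp
    then have "cj G v a = a" using vc xc by (simp add: a_def cj_inv_right)
    then show False using cj_eq_self_iff[OF vc ac] ncav by simp
  qed
  have nc: "x \<otimes> y \<noteq> y \<otimes> x"
  proof
    assume "x \<otimes> y = y \<otimes> x"
    then have "y \<otimes> x = x \<otimes> y" ..
    then have "v \<otimes> x = x \<otimes> v" unfolding v_def using group_commutes_pow[OF _ yc xc] by blast
    then show False using ncxv by simp
  qed
  have m2: "m \<noteq> 1"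
  proof
    assume "m = 1"
    then have "ord x = 2" using x(2) r2 by simp
    then have "x \<in> generate G {c}" using rk oc cH x(1) by (simp add: rank_one_def)
    then have "x = c" using generate_order_two[OF cc oc] x1 by simp
    then show False using ncxv c(5) by simp
  qed
  have "m = 2"
  proof (rule ccontr)
    assume "m \<noteq> 2"
    then obtain l where l: "m = Suc (Suc (Suc l))" using m2 m'(1) by (metis One_nat_def Suc_1 not0_implies_Suc)
    \<comment> \<open>As m = l + 3, u has order 4. It commutes with v because the commutator d of x
      and v has order dividing 2, and with a because both lie in X.\<close>
    define u where "u = x [^] (2 ^ Suc l :: nat)"
    have uX: "u \<in> ?X" using xc by (simp add: u_def)
    have uc: "u \<in> carrier G" using xc by (simp add: u_def)
    have uH: "u \<in> H" using uX XH by blast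
    have uu: "u [^] (2::nat) = x [^] (2 ^ m' :: nat)"
      using xc l m' by (simp add: u_def nat_pow_pow mult.commute)
    have ou: "ord (u [^] (2::nat)) = 2" using uu m'(2) r2 by simp
    obtain d where d: "d \<in> generate G {x}" "x \<otimes> v = v \<otimes> x \<otimes> d" "d \<otimes> x = x \<otimes> d" "d \<otimes> v = v \<otimes> d"
      using dedekind_commutator[OF H x(1) vH] by blast
    have dc: "d \<in> carrier G" using X d(1) by (rule subgroup.mem_carrier)
    note dp = central_commutator_pow[OF xc vc dc d(2,3,4)]
    have "d [^] (2::nat) = \<one>"
    proof -
      have "v [^] r \<otimes> x = x \<otimes> v [^] r" using generate_commute[OF xc vr mem_generate] .
      also have "\<dots> = v [^] r \<otimes> x \<otimes> d [^] r" by (rule dp(2))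
      finally have "v [^] r \<otimes> x \<otimes> d [^] r = v [^] r \<otimes> x" ..
      then show ?thesis using vc xc dc r2 by simp
    qed
    then have "d [^] (2 ^ Suc l :: nat) = \<one>" using dc by (simp flip: nat_pow_pow)
    then have "u \<otimes> v = v \<otimes> u" using dp(1)[of "2 ^ Suc l"] vc uc by (simp add: u_def)
    moreover have "u \<otimes> a = a \<otimes> u" using generate_commute[OF xc uX aX] .
    ultimately have "u \<otimes> w = w \<otimes> u" using uc vc ac unfolding w_def by (metis m_assoc)
    then have "(u \<otimes> w) [^] (2::nat) = u [^] (2::nat) \<otimes> w [^] (2::nat)" using uc wc by (intro pow_mult_distrib)
    moreover have "u [^] (2::nat) = c"
    proof -
      have "u [^] (2::nat) \<in> H" using subgroup_pow_closed[OF sub uH] .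
      then have "u [^] (2::nat) \<in> generate G {c}" using rk ou oc cH by (simp add: rank_one_def)
      moreover have "u [^] (2::nat) \<noteq> \<one>" using ou by (metis ord_id numeral_eq_one_iff semiring_norm(85))
      ultimately show ?thesis using generate_order_two[OF cc oc] by blast
    qed
    moreover have "c \<otimes> c = \<one>" using cc2 cc by (simp add: numeral_2_eq_2)
    ultimately have uw2: "(u \<otimes> w) [^] (2::nat) = \<one>" using wc2 by simp
    have uwX: "u \<otimes> w \<notin> ?X"
    proof
      assume "u \<otimes> w \<in> ?X"
      then have "inv u \<otimes> (u \<otimes> w) \<in> ?X" using uX X by (simp add: subgroup_closed)
      then show False using wX uc wc by simp
    qed
    have "u \<otimes> w \<noteq> \<one>" using uwX X subgroup.one_closed by force
    then have "ord (u \<otimes> w) = r" using prime_ord[of "u \<otimes> w"] uw2 uc wc r2 by simp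
    then show False using key[of "u \<otimes> w"] uwX uH wH sub by (simp add: subgroup.m_closed)
  qed
  then show ?thesis using r2 x(2) nc by simp
qed

lemma ord_mult_coprime:
  assumes u: "u \<in> carrier G" and v: "v \<in> carrier G" and uv: "u \<otimes> v = v \<otimes> u" and co: "coprime (ord u) (ord v)"
  shows "ord (u \<otimes> v) = ord u * ord v"
proof (rule dvd_antisym)
  show "ord (u \<otimes> v) dvd ord u * ord v" using ord_mul_divides[OF uv u v] .
  let ?n = "ord (u \<otimes> v)"
  have "(u \<otimes> v) [^] (?n * k) = \<one>" for k using u v by (simp flip: nat_pow_pow)
  then have e: "u [^] (?n * k) \<otimes> v [^] (?n * k) = \<one>" for k using pow_mult_distrib[OF uv u v] by simp
  have "u [^] (?n * ord v) = \<one>" using e[of "ord v"] u v by (simp add: mult.commute[of ?n] flip: nat_pow_pow)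
  then have "ord u dvd ?n" using u co by (simp add: pow_eq_id coprime_dvd_mult_left_iff)
  moreover have "v [^] (?n * ord u) = \<one>" using e[of "ord u"] u v by (simp add: mult.commute[of ?n] flip: nat_pow_pow)
  then have "ord v dvd ?n" using v co by (simp add: pow_eq_id coprime_dvd_mult_left_iff coprime_commute)
  ultimately show "ord u * ord v dvd ?n" using co divides_mult by blast
qed

text \<open>Take x of maximal order. In the commutative \<open>A\<close> any two elements of s-power
  order are comparable, so such a y outside <x> would properly extend the s-part of x; exchanging
  that part for y would raise the order. Thus <x> contains every Sylow subgroup of
  \<open>A\<close>.\<close>

lemma abelian_rank_one_cyclic:
  assumes A: "subgroup A G" and ab: "\<And>a b. a \<in> A \<Longrightarrow> b \<in> A \<Longrightarrow> a \<otimes> b = b \<otimes> a" and rk: "rank_one A"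
  shows "\<exists>x\<in>A. A = generate G {x}"
proof -
  have Ac: "x \<in> carrier G" if "x \<in> A" for x using A that by (rule subgroup.mem_carrier)
  have ded: "dedekind A"
    unfolding dedekind_def
  proof (intro conjI A ballI)
    fix a h assume ah: "a \<in> A" "h \<in> A"
    then have "cj G h a = a" using cj_eq_self_iff[of h a] ab Ac by simp
    then show "cj G h a \<in> generate G {a}" by simp
  qed
  have finA: "finite A" using A by (rule finite_subgroup)
  have "finite (ord ` A)" "ord ` A \<noteq> {}" using finA subgroup.one_closed[OF A] by auto
  then obtain x where x: "x \<in> A" and mx: "\<And>y. y \<in> A \<Longrightarrow> ord y \<le> ord x"
    using Max_in[of "ord ` A"] Max_ge[of "ord ` A"] by (metis (no_types, lifting) image_iff)
  have xc: "x \<in> carrier G" using Ac[OF x] .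
  have gA: "generate G {x} \<subseteq> A" using generate_subset[OF A x] .
  have pp: "y \<in> generate G {x}" if s: "Factorial_Ring.prime s" and y: "y \<in> A" "ord y = s ^ n" for s y n
  proof (rule ccontr)
    assume ny: "y \<notin> generate G {x}"
    have yc: "y \<in> carrier G" using Ac[OF y(1)] .
    obtain i j :: nat and k where d: "x = x [^] i \<otimes> x [^] j" "ord (x [^] i) = s ^ k" "\<not> s dvd ord (x [^] j)"
      using prime_part_decomposition[OF xc s] by blast
    have iA: "x [^] i \<in> A" "x [^] j \<in> A" using subgroup_pow_closed[OF A x] by auto
    have ic: "x [^] i \<in> carrier G" using xc by simp
    have "generate G {x [^] i} \<subseteq> generate G {x}"
      using generate_subset[OF subgroup_generate[OF xc]] xc by simp
    then have nyi: "y \<notin> generate G {x [^] i}" using ny by blast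
    then have iy: "x [^] i \<in> generate G {y}"
      using incomparable_prime_power_elements[OF ded rk s iA(1) d(2) y nyi] ab iA(1) y(1) by blast
    have "ord (x [^] i) \<noteq> ord y" using generate_eq_if_ord_eq[OF yc iy] nyi by blast
    moreover have "ord (x [^] i) dvd ord y"
      using ord_dvd_card[OF subgroup_generate[OF yc] iy] generate_pow_card[OF yc] by simp
    ultimately have lt: "ord (x [^] i) < ord y" using ord_pos[OF yc] by (simp add: dvd_imp_le le_neq_implies_less)
    have jc: "x [^] j \<in> carrier G" using xc by simp
    have "coprime (ord y) (ord (x [^] j))" using y(2) d(3) s by (simp add: prime_imp_coprime)
    then have "ord (y \<otimes> x [^] j) = ord y * ord (x [^] j)"
      using ord_mult_coprime[OF yc jc] ab y(1) iA(2) by simp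
    moreover have "ord x \<le> ord (x [^] i) * ord (x [^] j)"
    proof (rule dvd_imp_le)
      show "ord x dvd ord (x [^] i) * ord (x [^] j)"
        using ord_mul_divides[of "x [^] i" "x [^] j"] ab[OF iA] ic jc d(1) by metis
      show "0 < ord (x [^] i) * ord (x [^] j)" using ord_pos ic jc by simp
    qed
    moreover have "ord (x [^] i) * ord (x [^] j) < ord y * ord (x [^] j)" using lt ord_pos[OF jc] by simp
    ultimately have "ord x < ord (y \<otimes> x [^] j)" by linarith
    then show False using mx[of "y \<otimes> x [^] j"] y(1) iA(2) A by (simp add: subgroup.m_closed)
  qed
  have "card A dvd ord x"
  proof (rule multiplicity_le_imp_dvd)
    show "card A \<noteq> 0" using subgroup_card_pos[OF A] by simp
    fix s :: nat assume s: "Factorial_Ring.prime s"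
    let ?e = "Factorial_Ring.multiplicity s (card A)"
    obtain S where S: "subgroup S G" "S \<subseteq> A" "card S = s ^ ?e" using sylow_in[OF s A multiplicity_dvd] by blast
    have "S \<subseteq> generate G {x}"
    proof
      fix y assume y: "y \<in> S"
      have "ord y dvd s ^ ?e" using ord_dvd_card[OF S(1) y] S(3) by simp
      then obtain n where "ord y = s ^ n" using divides_primepow_nat[OF s] by metis
      then show "y \<in> generate G {x}" using pp[OF s] y S(2) by blast
    qed
    then have "s ^ ?e dvd ord x"
      using card_subgroup_dvd[OF S(1) subgroup_generate[OF xc]] S(3) generate_pow_card[OF xc] by simp
    then show "?e \<le> Factorial_Ring.multiplicity s (ord x)"
      using s ord_pos[OF xc] by (intro multiplicity_geI) auto
  qed
  then have "card A \<le> card (generate G {x})" using generate_pow_card[OF xc] ord_pos[OF xc] by (simp add: dvd_imp_le)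
  then have "generate G {x} = A" using gA finA by (intro card_seteq)
  then show ?thesis using x by blast
qed

lemma cyclic_sub_generate:
  assumes x: "x \<in> carrier G"
  shows "cyclic_sub G (generate G {x})"
proof -
  let ?H = "generate G {x}"
  have H: "subgroup ?H G" using subgroup_generate[OF x] .
  interpret H: group "G\<lparr>carrier := ?H\<rparr>" using H by (rule subgroup_imp_group)
  have "(\<lambda>n::int. x [^] n) = (\<lambda>n. x [^]\<^bsub>G\<lparr>carrier := ?H\<rparr>\<^esub> n)"
    using int_pow_consistent[OF H mem_generate] by (rule ext)
  moreover have "?H = range (\<lambda>n::int. x [^] n)"
    using generate_pow[OF x] by (auto simp: full_SetCompr_eq)
  ultimately have "carrier (G\<lparr>carrier := ?H\<rparr>) = range (\<lambda>n::int. x [^]\<^bsub>G\<lparr>carrier := ?H\<rparr>\<^esub> n)"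
    by simp
  then have "cyclic_group (G\<lparr>carrier := ?H\<rparr>)" using H.cyclic_group by auto
  then show ?thesis using H by (simp add: cyclic_sub_def)
qed

lemma cyclic_sub_imp_generate:
  assumes "cyclic_sub G H"
  shows "\<exists>x\<in>H. H = generate G {x}"
proof -
  have H: "subgroup H G" "cyclic_group (G\<lparr>carrier := H\<rparr>)" using assms by (auto simp: cyclic_sub_def)
  interpret H: group "G\<lparr>carrier := H\<rparr>" using H(1) by (rule subgroup_imp_group)
  obtain x where x: "x \<in> H" "H = range (\<lambda>n::int. x [^]\<^bsub>G\<lparr>carrier := H\<rparr>\<^esub> n)"
    using H(2) H.cyclic_group by auto
  have "x \<in> carrier G" using H(1) x(1) by (rule subgroup.mem_carrier)
  then have "generate G {x} = range (\<lambda>n::int. x [^] n)"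
    using generate_pow by (auto simp: full_SetCompr_eq)
  moreover have "(\<lambda>n::int. x [^] n) = (\<lambda>n. x [^]\<^bsub>G\<lparr>carrier := H\<rparr>\<^esub> n)"
    using int_pow_consistent[OF H(1) x(1)] by (rule ext)
  ultimately have "H = generate G {x}" using x(2) by simp
  then show ?thesis using x(1) by blast
qed

end

section \<open>Noncommutative Dedekind groups of rank one and the quaternion factor\<close>

context finite_group
begin

lemma pow_mod_ord: "x \<in> carrier G \<Longrightarrow> x [^] (k mod ord x) = x [^] (k::nat)"
proof -
  assume x: "x \<in> carrier G"
  have "x [^] k = x [^] (ord x * (k div ord x)) \<otimes> x [^] (k mod ord x)"
    using x by (simp add: nat_pow_mult)
  also have "x [^] (ord x * (k div ord x)) = \<one>" using x by (simp flip: nat_pow_pow)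
  finally show ?thesis using x by simp
qed

text \<open>Choose a prime r dividing the order of c = [x,y] and let m, n be the r'-parts of ord x
  and ord y. Then [x^m, y^n] = c^(mn) \<noteq> 1, and these powers of r-power order do not commute,
  hence are incomparable.\<close>

lemma noncommuting_powers:
  assumes H: "dedekind H" and rk: "rank_one H" and x: "x \<in> H" and y: "y \<in> H" and nc: "x \<otimes> y \<noteq> y \<otimes> x"
  shows "\<exists>(m::nat) (n::nat). ord (x [^] m) = 4 \<and> ord (y [^] n) = 4 \<and> x [^] m \<otimes> y [^] n \<noteq> y [^] n \<otimes> x [^] m"
proof -
  have sub: "subgroup H G" using H by (simp add: dedekind_def)
  have xc: "x \<in> carrier G" and yc: "y \<in> carrier G" using x y subgroup.mem_carrier[OF sub] by auto
  obtain c where c: "c \<in> generate G {x}" "x \<otimes> y = y \<otimes> x \<otimes> c" "c \<otimes> x = x \<otimes> c" "c \<otimes> y = y \<otimes> c"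
    using dedekind_commutator[OF H x y] by blast
  have cc: "c \<in> carrier G" using subgroup_generate[OF xc] c(1) by (rule subgroup.mem_carrier)
  have "c \<noteq> \<one>" using c(2) nc xc yc by auto
  then have "ord c \<noteq> 1" using ord_eq_1[OF cc] by simp
  then obtain r where r: "Factorial_Ring.prime r" "r dvd ord c" using prime_factor_nat by blast
  obtain e m where m: "ord x = r ^ e * m" "\<not> r dvd m"
    using multiplicity_decompose'[of "ord x" r] ord_pos[OF xc] r(1) by (metis less_numeral_extra(3) not_prime_unit)
  obtain f n where n: "ord y = r ^ f * n" "\<not> r dvd n"
    using multiplicity_decompose'[of "ord y" r] ord_pos[OF yc] r(1) by (metis less_numeral_extra(3) not_prime_unit)
  let ?x = "x [^] m" and ?y = "y [^] n"
  have "?x [^] (r ^ e) = \<one>" using pow_ord_eq_1[OF xc] m(1) xc by (simp add: nat_pow_pow mult.commute)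
  then have "ord ?x dvd r ^ e" using xc by (simp add: pow_eq_id)
  then obtain e' where e': "ord ?x = r ^ e'" using divides_primepow_nat[OF r(1)] by metis
  have "?y [^] (r ^ f) = \<one>" using pow_ord_eq_1[OF yc] n(1) yc by (simp add: nat_pow_pow mult.commute)
  then have "ord ?y dvd r ^ f" using yc by (simp add: pow_eq_id)
  then obtain f' where f': "ord ?y = r ^ f'" using divides_primepow_nat[OF r(1)] by metis
  have xH: "?x \<in> H" and yH: "?y \<in> H" using subgroup_pow_closed[OF sub] x y by auto
  have xmc: "?x \<in> carrier G" and ync: "?y \<in> carrier G" using xc yc by auto
  have xm: "?x \<otimes> y = y \<otimes> ?x \<otimes> c [^] m" using central_commutator_pow(1)[OF xc yc cc c(2-4)] .
  have cx: "c [^] m \<otimes> ?x = ?x \<otimes> c [^] m"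
  proof (rule group_commutes_pow)
    show "c \<otimes> ?x = ?x \<otimes> c" using group_commutes_pow[OF c(3)[symmetric] xc cc] by simp
  qed (use xc cc in auto)
  have cy: "c [^] m \<otimes> y = y \<otimes> c [^] m" using group_commutes_pow[OF c(4) cc yc] .
  have xmyn: "?x \<otimes> ?y = ?y \<otimes> ?x \<otimes> (c [^] m) [^] n"
    using central_commutator_pow(2)[OF xmc yc _ xm cx cy] cc by simp
  have nc': "?x \<otimes> ?y \<noteq> ?y \<otimes> ?x"
  proof
    assume "?x \<otimes> ?y = ?y \<otimes> ?x"
    then have "c [^] (m * n) = \<one>" using xmyn xc yc cc by (simp add: nat_pow_pow)
    then have "r dvd m * n" using cc r(2) by (metis dvd_trans pow_eq_id)
    then show False using m(2) n(2) r(1) by (simp add: prime_dvd_mult_iff)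
  qed
  have yx: "?y \<notin> generate G {?x}" using nc' generate_commute[OF xmc mem_generate] by blast
  have xy: "?x \<notin> generate G {?y}" using nc' generate_commute[OF ync _ mem_generate] by blast
  have "ord ?x = 4" using incomparable_prime_power_elements[OF H rk r(1) xH e' yH f' yx xy] by blast
  moreover have "ord ?y = 4" using incomparable_prime_power_elements[OF H rk r(1) yH f' xH e' xy yx] by blast
  ultimately show ?thesis using nc' by blast
qed

lemma odd_order_central:
  assumes H: "dedekind H" and rk: "rank_one H" and x: "x \<in> H" "odd (ord x)" and y: "y \<in> H"
  shows "x \<otimes> y = y \<otimes> x"
proof (rule ccontr)
  assume "x \<otimes> y \<noteq> y \<otimes> x"
  then obtain m :: nat where m: "ord (x [^] m) = 4" using noncommuting_powers[OF H rk x(1) y] by blast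
  have xc: "x \<in> carrier G" using H x(1) subgroup.mem_carrier by (auto simp: dedekind_def)
  have "ord (x [^] m) dvd ord x"
    using ord_dvd_card[OF subgroup_generate[OF xc], of "x [^] m"] generate_pow_card[OF xc] xc by simp
  then have "4 dvd ord x" using m by simp
  then show False using x(2) by (meson dvd_trans even_numeral)
qed

text \<open>Both squares have order 2, and rank one admits only one such element. v acts on <u> of
  order 4 by an odd exponent different from 1, hence by 3 = -1.\<close>

lemma noncommuting_two_elements:
  assumes H: "dedekind H" and rk: "rank_one H"
    and u: "u \<in> H" "ord u = 2 ^ a" and v: "v \<in> H" "ord v = 2 ^ b" and nc: "u \<otimes> v \<noteq> v \<otimes> u"
  shows "ord u = 4" "ord v = 4" "u [^] (2::nat) = v [^] (2::nat)" "cj G v u = inv u"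
proof -
  have sub: "subgroup H G" using H by (simp add: dedekind_def)
  have uc: "u \<in> carrier G" and vc: "v \<in> carrier G" using u v subgroup.mem_carrier[OF sub] by auto
  have vu: "v \<notin> generate G {u}" using nc generate_commute[OF uc mem_generate] by blast
  have uv: "u \<notin> generate G {v}" using nc generate_commute[OF vc _ mem_generate] by blast
  show ou: "ord u = 4" using incomparable_prime_power_elements[OF H rk two_is_prime_nat u v vu uv] by blast
  show ov: "ord v = 4" using incomparable_prime_power_elements[OF H rk two_is_prime_nat v u uv vu] by blast
  have o2: "ord (u [^] (2::nat)) = 2" "ord (v [^] (2::nat)) = 2"
    using ord_pow[OF uc, of 2] ord_pow[OF vc, of 2] ou ov by simp_all
  have "u [^] (2::nat) \<in> H" "v [^] (2::nat) \<in> H" using u v subgroup_pow_closed[OF sub] by auto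
  then have "u [^] (2::nat) \<in> generate G {v [^] (2::nat)}" using rk o2 by (simp add: rank_one_def)
  moreover have "u [^] (2::nat) \<noteq> \<one>" using o2(1) by (metis ord_id numeral_eq_one_iff semiring_norm(85))
  ultimately show "u [^] (2::nat) = v [^] (2::nat)" using generate_order_two[of "v [^] (2::nat)"] o2 vc by simp
  have "cj G v u \<in> generate G {u}" using H u v by (simp add: dedekind_def)
  then obtain k :: nat where k: "cj G v u = u [^] k" using mem_generate_iff[OF uc] by blast
  have k4: "cj G v u = u [^] (k mod 4)" using k pow_mod_ord[OF uc, of k] ou by simp
  have "coprime k 4" using pow_ord_eq_ord_iff[OF finite_carrier uc, of k] k ou ord_cj[OF vc uc] by simp
  then have "odd k" by (metis coprime_common_divisor_nat even_numeral numeral_eq_one_iff semiring_norm(85))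
  then have "k mod 4 = 1 \<or> k mod 4 = 3" by presburger
  moreover have "k mod 4 \<noteq> 1"
  proof
    assume "k mod 4 = 1"
    then have "cj G v u = u" using k4 uc by simp
    then show False using cj_eq_self_iff[OF vc uc] nc by simp
  qed
  ultimately have c3: "cj G v u = u [^] (3::nat)" using k4 by simp
  have "u [^] (3::nat) \<otimes> u = u [^] (4::nat)" using uc by (simp add: numeral_eq_Suc)
  also have "\<dots> = \<one>" using pow_ord_eq_1[OF uc] ou by simp
  finally show "cj G v u = inv u" unfolding c3 using uc by (metis inv_equality nat_pow_closed)
qed

text \<open>Noncommuting x, y of order 4 generate a quaternion group Q. All elements of 2-power
  order turn out to lie in Q, and the elements of odd order form a central cyclic subgroup D, so
  splitting each element into its two parts gives H = Q x D.\<close>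

lemma ex_quaternion_direct_factor:
  assumes H: "dedekind H" and rk: "rank_one H" and nab: "a0 \<in> H" "b0 \<in> H" "a0 \<otimes> b0 \<noteq> b0 \<otimes> a0"
  shows "\<exists>Q D. int_direct G H Q D \<and> G\<lparr>carrier := Q\<rparr> \<cong> quaternion_group \<and> cyclic_sub G D \<and> odd (card D)"
proof -
  have sub: "subgroup H G" using H by (simp add: dedekind_def)
  have hc: "h \<in> carrier G" if "h \<in> H" for h using sub that by (rule subgroup.mem_carrier)
  obtain m n :: nat where mn: "ord (a0 [^] m) = 4" "ord (b0 [^] n) = 4" "a0 [^] m \<otimes> b0 [^] n \<noteq> b0 [^] n \<otimes> a0 [^] m"
    using noncommuting_powers[OF H rk nab] by blast
  define x where "x = a0 [^] m"
  define y where "y = b0 [^] n"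
  have xH: "x \<in> H" and yH: "y \<in> H" using nab subgroup_pow_closed[OF sub] by (auto simp: x_def y_def)
  have xc: "x \<in> carrier G" and yc: "y \<in> carrier G" using hc xH yH by auto
  have ox: "ord x = 2 ^ 2" and oy: "ord y = 2 ^ 2" and nc: "x \<otimes> y \<noteq> y \<otimes> x" using mn by (auto simp: x_def y_def)
  note two = noncommuting_two_elements[OF H rk]
  have xx: "x [^] (2::nat) = y [^] (2::nat)" and yx: "cj G y x = inv x" using two[OF xH ox yH oy nc] by auto
  have x4: "x [^] (4::nat) = \<one>" using pow_ord_eq_1[OF xc] ox by simp
  have inv_x: "inv x = x [^] (3::nat)"
  proof -
    have "x [^] (3::nat) \<otimes> x = \<one>" using x4 xc by (simp add: numeral_eq_Suc)
    then show ?thesis using xc by (metis inv_equality nat_pow_closed)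
  qed
  have "cj G (inv y) x = inv x"
  proof -
    have "cj G y (inv x) = x" using yx xc yc by (simp add: cj_inv_right)
    then have "cj G (inv y) (cj G y (inv x)) = cj G (inv y) x" by simp
    then show ?thesis using xc yc by simp
  qed
  then have cyx: "cj G (inv y) (x [^] (c::nat)) = x [^] (3 * c)" for c
    using xc yc inv_x by (simp add: cj_pow_right nat_pow_pow)
  have yxc: "y \<otimes> x [^] (c::nat) = x [^] (3 * c) \<otimes> y" for c
    using cyx[of c] xc yc by (simp add: cj_def m_assoc flip: cyx)
  have pm: "x [^] (k mod 4) = x [^] (k::nat)" for k using pow_mod_ord[OF xc, of k] ox by simp
  \<comment> \<open>The coordinates of \<open>quaternion_group\<close>; the relations y x^c = x^(3c)
    y and y^2 = x^2 reproduce its multiplication.\<close>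
  define f where "f = (\<lambda>(a::nat, b::nat). x [^] a \<otimes> y [^] b)"
  let ?S = "carrier quaternion_group"
  have S: "?S = {0..<4} \<times> {0..<2}" by (simp add: quaternion_group_def)
  have fc: "f s \<in> carrier G" for s using xc yc by (simp add: f_def case_prod_beta)
  have hom: "f (s \<otimes>\<^bsub>quaternion_group\<^esub> t) = f s \<otimes> f t" if s: "s \<in> ?S" and t: "t \<in> ?S" for s t
  proof -
    obtain a b c d where ab: "s = (a, b)" "t = (c, d)" by (cases s, cases t) auto
    have b: "b = 0 \<or> b = 1" and d: "d = 0 \<or> d = 1" using s t ab S by auto
    show ?thesis
    proof (cases "b = 0")
      case True
      have "f s \<otimes> f t = x [^] (a + c) \<otimes> y [^] d"
        using True ab xc yc by (simp add: f_def nat_pow_mult flip: m_assoc)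
      moreover have "d mod 2 = d" using d by auto
      ultimately show ?thesis using True ab pm[of "a + c"] by (simp add: f_def quaternion_group_def)
    next
      case False
      then have b1: "b = 1" using b by simp
      have "f s \<otimes> f t = x [^] a \<otimes> ((y \<otimes> x [^] c) \<otimes> y [^] d)"
        using b1 ab xc yc by (simp add: f_def m_assoc)
      also have "\<dots> = x [^] a \<otimes> x [^] (3 * c) \<otimes> (y \<otimes> y [^] d)"
        unfolding yxc using xc yc by (simp add: m_assoc)
      also have "\<dots> = x [^] (a + 3 * c) \<otimes> (y \<otimes> y [^] d)" using xc by (simp add: nat_pow_mult)
      finally have e: "f s \<otimes> f t = x [^] (a + 3 * c) \<otimes> (y \<otimes> y [^] d)" .
      show ?thesis
      proof (cases "d = 0")
        case True
        then show ?thesis using e b1 ab yc pm[of "a + 3 * c"] by (simp add: f_def quaternion_group_def)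
      next
        case False
        then have d1: "d = 1" using d by simp
        have "y \<otimes> y [^] d = x [^] (2::nat)" using d1 yc xx by (simp add: numeral_2_eq_2)
        then have "f s \<otimes> f t = x [^] (a + 3 * c + 2)" using e xc by (simp add: nat_pow_mult)
        then show ?thesis using b1 d1 ab xc pm[of "a + 3 * c + 2"] by (simp add: f_def quaternion_group_def)
      qed
    qed
  qed
  have yX: "y \<notin> generate G {x}" using nc generate_commute[OF xc mem_generate] by blast
  have noteq: "x [^] (a::nat) \<noteq> x [^] (c::nat) \<otimes> y" for a c
  proof
    assume "x [^] a = x [^] c \<otimes> y"
    then have "y = inv (x [^] c) \<otimes> x [^] a" using xc yc by simp
    then show False using yX xc subgroup_generate[OF xc] by (simp add: subgroup_closed)
  qed
  have inj: "inj_on f ?S"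
  proof (rule inj_onI)
    fix s t assume s: "s \<in> ?S" and t: "t \<in> ?S" and eq: "f s = f t"
    obtain a b c d where ab: "s = (a, b)" "t = (c, d)" by (cases s, cases t) auto
    have b: "b = 0 \<or> b = 1" and d: "d = 0 \<or> d = 1" and ac: "a < 4" "c < 4" using s t ab S by auto
    have bd: "b = d"
    proof (rule ccontr)
      assume "b \<noteq> d"
      then consider "b = 0" "d = 1" | "b = 1" "d = 0" using b d by blast
      then show False using eq ab xc yc noteq[of a c] noteq[of c a] by cases (auto simp: f_def)
    qed
    then have "x [^] a = x [^] c" using eq ab xc yc by (simp add: f_def)
    moreover have "inj_on (\<lambda>k. x [^] k) {0..ord x - 1}" using ord_inj[OF xc] .
    ultimately have "a = c" using ac ox by (auto simp: inj_on_def)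
    then show "s = t" using ab bd by simp
  qed
  define Q where "Q = f ` ?S"
  have closed: "s \<otimes>\<^bsub>quaternion_group\<^esub> t \<in> ?S" if "s \<in> ?S" "t \<in> ?S" for s t
    by (auto simp: quaternion_group_def split: prod.splits)
  have Q: "subgroup Q G"
  proof (rule subgroup_of_closed)
    show "Q \<subseteq> carrier G" using fc by (auto simp: Q_def)
    show "Q \<noteq> {}" by (auto simp: Q_def S)
    show "a \<otimes> b \<in> Q" if "a \<in> Q" "b \<in> Q" for a b
      using that hom closed unfolding Q_def by (metis (no_types, lifting) image_iff)
  qed
  have fiso: "bij_betw f ?S Q" using inj by (simp add: Q_def bij_betw_def)
  have inviso: "inv_into ?S f \<in> iso (G\<lparr>carrier := Q\<rparr>) quaternion_group"
  proof -
    have bij: "bij_betw (inv_into ?S f) Q ?S" using fiso by (rule bij_betw_inv_into)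
    have "inv_into ?S f (a \<otimes> b) = inv_into ?S f a \<otimes>\<^bsub>quaternion_group\<^esub> inv_into ?S f b"
      if abQ: "a \<in> Q" "b \<in> Q" for a b
    proof -
      obtain s t where st: "s \<in> ?S" "t \<in> ?S" "a = f s" "b = f t" using abQ by (auto simp: Q_def)
      then have "a \<otimes> b = f (s \<otimes>\<^bsub>quaternion_group\<^esub> t)" using hom by simp
      then show ?thesis using st inj closed by (simp add: inv_into_f_f)
    qed
    then show ?thesis using bij by (auto simp: iso_def hom_def bij_betw_def)
  qed
  have QH: "Q \<subseteq> H"
    using xH yH sub by (auto simp: Q_def f_def subgroup.m_closed subgroup_pow_closed)
  have cardQ: "card Q = 8" using bij_betw_same_card[OF fiso] S by simp
  have xQ: "x \<in> Q" unfolding Q_def S using xc by (intro image_eqI[of _ _ "(1, 0)"]) (auto simp: f_def)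
  have yQ: "y \<in> Q" unfolding Q_def S using yc by (intro image_eqI[of _ _ "(0, 1)"]) (auto simp: f_def)
  \<comment> \<open>By comparability the only alternative is that t is a power of u. Then u fails to
    commute with t' as well, so u and t both have order 4 and generate the same subgroup.\<close>
  have in_gen: "u \<in> generate G {t}"
    if u: "u \<in> H" "ord u = 2 ^ k" and t: "t \<in> H" "ord t = 2 ^ i" and t': "t' \<in> H" "ord t' = 2 ^ j"
      and n: "t \<otimes> t' \<noteq> t' \<otimes> t" and com: "u \<otimes> t = t \<otimes> u" for u t t' k i j
  proof (rule ccontr)
    assume nu: "u \<notin> generate G {t}"
    have uc: "u \<in> carrier G" and tc: "t \<in> carrier G" and t'c: "t' \<in> carrier G" using u t t' hc by auto
    have tu: "t \<in> generate G {u}"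
      using incomparable_prime_power_elements[OF H rk two_is_prime_nat t u nu] com by metis
    then obtain l :: nat where l: "t = u [^] l" using mem_generate_iff[OF uc] by blast
    have "u \<otimes> t' \<noteq> t' \<otimes> u" using n l group_commutes_pow[OF _ uc t'c, of l] by metis
    then have "ord u = 4" using two(1)[OF u t'] by simp
    moreover have "ord t = 4" using two(1)[OF t t' n] .
    ultimately show False using generate_eq_if_ord_eq[OF uc tu] nu by simp
  qed
  have two_in_Q: "u \<in> Q" if u: "u \<in> H" "ord u = 2 ^ k" for u k
  proof -
    have uc: "u \<in> carrier G" using hc u(1) .
    consider "u \<otimes> x = x \<otimes> u" | "u \<otimes> y = y \<otimes> u" | "u \<otimes> x \<noteq> x \<otimes> u" "u \<otimes> y \<noteq> y \<otimes> u" by blast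
    then show ?thesis
    proof cases
      case 1
      then have "u \<in> generate G {x}" using in_gen[OF u xH ox yH oy nc] by blast
      then show ?thesis using generate_subset[OF Q xQ] by blast
    next
      case 2
      then have "u \<in> generate G {y}" using in_gen[OF u yH oy xH ox nc[symmetric]] by blast
      then show ?thesis using generate_subset[OF Q yQ] by blast
    next
      case 3
      \<comment> \<open>u inverts both x and y, hence fixes xy, because x^-1 y^-1 = (yx)^-1 = xy; so
        \<open>in_gen\<close> applies to xy instead.\<close>
      have cx: "cj G u x = inv x" using two(4)[OF xH ox u] 3 by metis
      have cy: "cj G u y = inv y" using two(4)[OF yH oy u] 3 by metis
      let ?t = "x \<otimes> y"
      have tH: "?t \<in> H" using xH yH sub by (simp add: subgroup.m_closed)
      have tc: "?t \<in> carrier G" using xc yc by simp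
      have yx1: "y \<otimes> x = inv x \<otimes> y" using yxc[of 1] xc yc inv_x by simp
      have sq: "?t [^] (2::nat) = x [^] (2::nat)"
      proof -
        have "?t [^] (2::nat) = x \<otimes> ((y \<otimes> x) \<otimes> y)" using xc yc by (simp add: numeral_2_eq_2 m_assoc)
        also have "\<dots> = y [^] (2::nat)" unfolding yx1 using xc yc by (simp add: numeral_2_eq_2 m_assoc)
        finally show ?thesis using xx by simp
      qed
      have "?t [^] (4::nat) = (?t [^] (2::nat)) [^] (2::nat)" using tc by (simp add: nat_pow_pow)
      also have "\<dots> = \<one>" unfolding sq using xc x4 by (simp add: nat_pow_pow)
      finally have "ord ?t dvd 2 ^ 2" using tc by (simp add: pow_eq_id)
      then obtain i where ot: "ord ?t = 2 ^ i" using divides_primepow_nat[OF two_is_prime_nat] by metis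
      have nt: "?t \<otimes> x \<noteq> x \<otimes> ?t" using nc xc yc by (simp add: m_assoc)
      have "cj G u ?t = inv x \<otimes> inv y" using cx cy xc yc uc by (simp add: cj_mult_right)
      also have "\<dots> = ?t"
      proof -
        have "y \<otimes> x \<otimes> ?t = y \<otimes> (x \<otimes> x) \<otimes> y" using xc yc by (simp add: m_assoc)
        also have "x \<otimes> x = y \<otimes> y" using xx xc yc by (simp add: numeral_2_eq_2)
        also have "y \<otimes> (y \<otimes> y) \<otimes> y = (y [^] (2::nat)) [^] (2::nat)" using yc by (simp add: nat_pow_pow numeral_eq_Suc m_assoc)
        also have "\<dots> = \<one>" unfolding xx[symmetric] using xc x4 by (simp add: nat_pow_pow)
        finally have "inv (y \<otimes> x) = ?t" using xc yc by (metis inv_equality inv_inv m_closed)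
        then show ?thesis using xc yc by (simp add: inv_mult_group)
      qed
      finally have "u \<otimes> ?t = ?t \<otimes> u" using cj_eq_self_iff[OF uc tc] by simp
      then have "u \<in> generate G {?t}" using in_gen[OF u tH ot xH ox nt] by blast
      moreover have "?t \<in> Q" using xQ yQ Q by (simp add: subgroup.m_closed)
      ultimately show ?thesis using generate_subset[OF Q] by blast
    qed
  qed
  define D where "D = {h \<in> H. odd (ord h)}"
  have Dcom: "d \<otimes> h = h \<otimes> d" if "d \<in> D" "h \<in> H" for d h
    using that odd_order_central[OF H rk] by (auto simp: D_def)
  have D: "subgroup D G"
  proof (rule subgroup_of_closed)
    show "D \<subseteq> carrier G" using hc by (auto simp: D_def)
    have "\<one> \<in> D" using subgroup.one_closed[OF sub] by (simp add: D_def)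
    then show "D \<noteq> {}" by blast
    show "a \<otimes> b \<in> D" if ab: "a \<in> D" "b \<in> D" for a b
    proof -
      have m: "a \<in> H" "b \<in> H" "odd (ord a)" "odd (ord b)" using ab by (auto simp: D_def)
      have "ord (a \<otimes> b) dvd ord a * ord b" using ord_mul_divides[OF Dcom[OF ab(1) m(2)]] m hc by blast
      then have "odd (ord (a \<otimes> b))" using m dvd_trans by (metis even_mult_iff)
      then show ?thesis using m sub by (simp add: D_def subgroup.m_closed)
    qed
  qed
  have "rank_one D" using rk by (auto simp: rank_one_def D_def)
  then obtain d where "d \<in> D" "D = generate G {d}"
    using abelian_rank_one_cyclic[OF D] Dcom by (metis (no_types, lifting) D_def mem_Collect_eq)
  then have cycD: "cyclic_sub G D" using cyclic_sub_generate subgroup.mem_carrier[OF D] by metis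
  have oddD: "odd (card D)"
  proof
    assume "even (card D)"
    then obtain e where "e \<in> D" "ord e = 2" using cauchy_in[OF two_is_prime_nat D] by blast
    then show False by (simp add: D_def)
  qed
  have QD: "Q \<inter> D = {\<one>}"
  proof
    show "Q \<inter> D \<subseteq> {\<one>}"
    proof
      fix g assume g: "g \<in> Q \<inter> D"
      have "ord g dvd 2 ^ 3" using ord_dvd_card[OF Q, of g] g cardQ by simp
      moreover have "odd (ord g)" using g by (simp add: D_def)
      ultimately have "ord g = 1"
        using divides_primepow_nat[OF two_is_prime_nat] by (metis dvd_refl even_power neq0_conv power_0)
      then show "g \<in> {\<one>}" using g hc QH ord_eq_1 by blast
    qed
    show "{\<one>} \<subseteq> Q \<inter> D" using Q D subgroup.one_closed by blast
  qed
  have "Q <#> D = H"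
  proof
    show "Q <#> D \<subseteq> H" using QH sub by (auto simp: set_mult_def D_def subgroup.m_closed subsetD)
    show "H \<subseteq> Q <#> D"
    proof
      fix h assume h: "h \<in> H"
      obtain i j :: nat and k where ij: "h = h [^] i \<otimes> h [^] j" "ord (h [^] i) = 2 ^ k" "\<not> 2 dvd ord (h [^] j)"
        using prime_part_decomposition[OF hc[OF h] two_is_prime_nat] by blast
      have "h [^] i \<in> H" "h [^] j \<in> H" using subgroup_pow_closed[OF sub h] by auto
      then have "h [^] i \<in> Q" "h [^] j \<in> D" using two_in_Q ij by (auto simp: D_def)
      then show "h \<in> Q <#> D" using ij(1) set_mult_memI by metis
    qed
  qed
  then have "int_direct G H Q D"
    unfolding int_direct_def using Q D QD Dcom QH by (metis subsetD)
  then show ?thesis using inviso cycD oddD by (auto simp: is_iso_def)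
qed

lemma dedekind_rank_one_structure:
  assumes H: "dedekind H" and rk: "rank_one H"
  shows "cyc_or_Q8_odd G H"
proof (cases "\<forall>a\<in>H. \<forall>b\<in>H. a \<otimes> b = b \<otimes> a")
  case True
  have sub: "subgroup H G" using H by (simp add: dedekind_def)
  obtain x where x: "x \<in> H" "H = generate G {x}" using abelian_rank_one_cyclic[OF sub _ rk] True by blast
  then have "cyclic_sub G H" using cyclic_sub_generate subgroup.mem_carrier[OF sub] by metis
  then show ?thesis by (simp add: cyc_or_Q8_odd_def)
next
  case False
  then show ?thesis using ex_quaternion_direct_factor[OF H rk] unfolding cyc_or_Q8_odd_def by blast
qed

text \<open>(uv)^(ord v) = u^(ord v), and ord v is invertible modulo ord u.\<close>

lemma coprime_parts_mem_generate:
  assumes u: "u \<in> carrier G" and v: "v \<in> carrier G" and uv: "u \<otimes> v = v \<otimes> u" and co: "coprime (ord u) (ord v)"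
  shows "u \<in> generate G {u \<otimes> v}"
proof -
  have "(u \<otimes> v) [^] ord v = u [^] ord v" using pow_mult_distrib[OF uv u v, of "ord v"] u v by simp
  then have "u [^] ord v \<in> generate G {u \<otimes> v}" using pow_mem_generate[of "u \<otimes> v" "ord v"] u v by simp
  moreover have "u \<in> generate G {u [^] ord v}" using mem_generate_pow_coprime[OF u] co by (simp add: coprime_commute)
  ultimately show ?thesis using generate_subset[OF subgroup_generate] u v by blast
qed

text \<open>Conjugation acts componentwise, and coprimality puts both components of g into
  <g>.\<close>

lemma dedekind_direct_product:
  assumes A: "dedekind A" and B: "dedekind B" and dir: "int_direct G U A B" and co: "coprime (card A) (card B)"
  shows "dedekind U"
proof -
  have As: "subgroup A G" and Bs: "subgroup B G" using A B by (auto simp: dedekind_def)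
  have com: "a \<otimes> b = b \<otimes> a" if "a \<in> A" "b \<in> B" for a b using dir that by (auto simp: int_direct_def)
  have U: "A <#> B = U" using dir by (simp add: int_direct_def)
  have ac: "a \<in> carrier G" if "a \<in> A" for a using As that by (rule subgroup.mem_carrier)
  have bc: "b \<in> carrier G" if "b \<in> B" for b using Bs that by (rule subgroup.mem_carrier)
  have cjab: "cj G b a = a" "cj G a b = b" if "a \<in> A" "b \<in> B" for a b
    using that com[OF that] cj_eq_self_iff[of a b] cj_eq_self_iff[of b a] ac bc by simp_all
  have "normalizes G B A" using cjab by (simp add: normalizes_def)
  then have Us: "subgroup U G" using subgroup_set_mult[OF As Bs] U by simp
  moreover have "cj G h g \<in> generate G {g}" if g: "g \<in> U" and h: "h \<in> U" for g h
  proof -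
    obtain a b where ab: "a \<in> A" "b \<in> B" "g = a \<otimes> b" using g U by (metis set_mult_memE)
    obtain c d where cd: "c \<in> A" "d \<in> B" "h = c \<otimes> d" using h U by (metis set_mult_memE)
    have m: "a \<in> carrier G" "b \<in> carrier G" "c \<in> carrier G" "d \<in> carrier G" using ab cd ac bc by auto
    have gc: "g \<in> carrier G" using ab m by simp
    have cA: "cj G c a \<in> generate G {a}" and cB: "cj G d b \<in> generate G {b}"
      using A B ab cd by (auto simp: dedekind_def)
    have "cj G c a \<in> A" using As ab cd by (simp add: subgroup_cj_closed)
    then have "cj G h g = cj G c a \<otimes> cj G d b"
      using m ab cd cjab by (simp add: cj_mult_left cj_mult_right)
    moreover have co': "coprime (ord a) (ord b)"
      using co ord_dvd_card[OF As ab(1)] ord_dvd_card[OF Bs ab(2)] by (meson coprime_divisors)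
    then have "a \<in> generate G {g}" using coprime_parts_mem_generate[OF m(1,2) com[OF ab(1,2)]] ab(3) by simp
    moreover have "b \<in> generate G {g}"
      using coprime_parts_mem_generate[OF m(2,1)] com[OF ab(1,2)] co' ab(3) by (simp add: coprime_commute)
    ultimately show ?thesis
      using cA cB generate_subset[OF subgroup_generate[OF gc]] subgroup_generate[OF gc]
      by (metis subgroup.m_closed subsetD)
  qed
  ultimately show ?thesis by (simp add: dedekind_def)
qed

lemma cyclic_dedekind:
  assumes "cyclic_sub G H"
  shows "dedekind H"
proof -
  have H: "subgroup H G" using assms by (simp add: cyclic_sub_def)
  obtain x where x: "x \<in> H" "H = generate G {x}" using cyclic_sub_imp_generate[OF assms] by blast
  have xc: "x \<in> carrier G" using H x(1) by (rule subgroup.mem_carrier)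
  have "cj G h a = a" if "a \<in> H" "h \<in> H" for a h
    using that generate_commute[OF xc] x(2) H by (subst cj_eq_self_iff) (auto simp: subgroup.mem_carrier)
  then show ?thesis using H by (simp add: dedekind_def)
qed

lemma quaternion_dedekind:
  assumes Q: "subgroup Q G" and iso: "G\<lparr>carrier := Q\<rparr> \<cong> quaternion_group"
  shows "dedekind Q" "card Q = 8"
proof -
  obtain h where h: "h \<in> iso (G\<lparr>carrier := Q\<rparr>) quaternion_group" using iso by (auto simp: is_iso_def)
  have bij: "bij_betw h Q (carrier quaternion_group)" using h by (simp add: iso_def)
  have hm: "h (a \<otimes> b) = h a \<otimes>\<^bsub>quaternion_group\<^esub> h b" if "a \<in> Q" "b \<in> Q" for a b
    using h that by (simp add: iso_def hom_def)
  show "card Q = 8" using bij_betw_same_card[OF bij] by (simp add: quaternion_group_def)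
  \<comment> \<open>Any two elements of Q_8 commute or one inverts the other. Written as tst = s
    this involves no inverses, so the multiplication rule alone decides the finitely many
    cases.\<close>
  have qd: "t \<otimes>\<^bsub>quaternion_group\<^esub> s \<otimes>\<^bsub>quaternion_group\<^esub> t = s \<or> t \<otimes>\<^bsub>quaternion_group\<^esub> s = s \<otimes>\<^bsub>quaternion_group\<^esub> t"
    if st: "s \<in> carrier quaternion_group" "t \<in> carrier quaternion_group" for s t
  proof -
    obtain a b c d where ab: "s = (a, b)" "t = (c, d)" by (cases s, cases t) auto
    have "b = 0 \<or> b = 1" "d = 0 \<or> d = 1" "a = 0 \<or> a = 1 \<or> a = 2 \<or> a = 3" "c = 0 \<or> c = 1 \<or> c = 2 \<or> c = 3"
      using st ab by (auto simp: quaternion_group_def)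
    then show ?thesis unfolding ab by (elim disjE) (simp_all add: quaternion_group_def)
  qed
  have "cj G g a \<in> generate G {a}" if a: "a \<in> Q" and g: "g \<in> Q" for a g
  proof -
    have m: "a \<in> carrier G" "g \<in> carrier G" using a g subgroup.mem_carrier[OF Q] by auto
    have hc: "h a \<in> carrier quaternion_group" "h g \<in> carrier quaternion_group" using bij a g bij_betwE by auto
    have inj: "inj_on h Q" using bij by (simp add: bij_betw_def)
    have ag: "a \<otimes> g \<in> Q" "g \<otimes> a \<in> Q" "a \<otimes> g \<otimes> a \<in> Q" using a g Q by (auto simp: subgroup.m_closed)
    from qd[OF hc(2,1)] have "a \<otimes> g \<otimes> a = g \<or> a \<otimes> g = g \<otimes> a"
    proof
      assume "h a \<otimes>\<^bsub>quaternion_group\<^esub> h g \<otimes>\<^bsub>quaternion_group\<^esub> h a = h g"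
      then have "h (a \<otimes> g \<otimes> a) = h g" using hm a g ag by simp
      then show ?thesis using inj ag g by (auto dest: inj_onD)
    next
      assume "h a \<otimes>\<^bsub>quaternion_group\<^esub> h g = h g \<otimes>\<^bsub>quaternion_group\<^esub> h a"
      then have "h (a \<otimes> g) = h (g \<otimes> a)" using hm a g by simp
      then show ?thesis using inj ag by (auto dest: inj_onD)
    qed
    then show ?thesis
    proof
      assume e: "a \<otimes> g \<otimes> a = g"
      have "inv g \<otimes> (a \<otimes> g \<otimes> a) \<otimes> inv a = cj G g a" using m by (simp add: cj_def m_assoc)
      then have "cj G g a = inv a" unfolding e using m by simp
      then show ?thesis using subgroup.m_inv_closed[OF subgroup_generate[OF m(1)] mem_generate] by simp
    next
      assume "a \<otimes> g = g \<otimes> a"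
      then have "cj G g a = a" using cj_eq_self_iff[OF m(2,1)] by simp
      then show ?thesis by simp
    qed
  qed
  then show "dedekind Q" using Q by (simp add: dedekind_def)
qed

lemma cyc_or_Q8_odd_dedekind:
  assumes "cyc_or_Q8_odd G H"
  shows "dedekind H"
  using assms unfolding cyc_or_Q8_odd_def
proof
  assume "cyclic_sub G H"
  then show ?thesis by (rule cyclic_dedekind)
next
  assume "\<exists>Q C. int_direct G H Q C \<and> G\<lparr>carrier := Q\<rparr> \<cong> quaternion_group \<and> cyclic_sub G C \<and> odd (card C)"
  then obtain Q D where QD: "int_direct G H Q D" "G\<lparr>carrier := Q\<rparr> \<cong> quaternion_group" "cyclic_sub G D" "odd (card D)"
    by blast
  have Q: "subgroup Q G" using QD(1) by (simp add: int_direct_def)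
  have "coprime (2 ^ 3) (card D)" using QD(4) by (simp only: coprime_power_left_iff coprime_left_2_iff_odd) simp
  then have "coprime (card Q) (card D)" using quaternion_dedekind(2)[OF Q QD(2)] by simp
  then show ?thesis
    using dedekind_direct_product[OF quaternion_dedekind(1)[OF Q QD(2)] cyclic_dedekind[OF QD(3)] QD(1)] by simp
qed

end

section \<open>Complements acting on an abelian kernel\<close>

text \<open>An ordered product, since the ambient group is not commutative; the factors will lie in
  the abelian kernel.\<close>

primrec nprod :: "('a, 'b) monoid_scheme \<Rightarrow> (nat \<Rightarrow> 'a) \<Rightarrow> nat \<Rightarrow> 'a" where
  "nprod G f 0 = \<one>\<^bsub>G\<^esub>"
| "nprod G f (Suc n) = nprod G f n \<otimes>\<^bsub>G\<^esub> f n"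

text \<open>The action on the kernel of polynomials in x with natural coefficients:
  \<open>mult\<close> adds two of them and \<open>conj\<close> multiplies by x. Finiteness supplies
  the negatives, so this stands for the commutative ring generated by x.\<close>

inductive_set cj_polynomials :: "('a, 'b) monoid_scheme \<Rightarrow> 'a \<Rightarrow> ('a \<Rightarrow> 'a) set" for G x where
  ident: "(\<lambda>w. w) \<in> cj_polynomials G x"
| mult: "f \<in> cj_polynomials G x \<Longrightarrow> g \<in> cj_polynomials G x \<Longrightarrow> (\<lambda>w. f w \<otimes>\<^bsub>G\<^esub> g w) \<in> cj_polynomials G x"
| conj: "f \<in> cj_polynomials G x \<Longrightarrow> (\<lambda>w. cj G x (f w)) \<in> cj_polynomials G x"

locale frobenius_abelian_kernel = frobenius_group +
  assumes K_comm: "a \<in> K \<Longrightarrow> b \<in> K \<Longrightarrow> a \<otimes> b = b \<otimes> a"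
begin

lemma nprod_closed: "(\<And>i. f i \<in> K) \<Longrightarrow> nprod G f n \<in> K"
  by (induction n) (simp_all add: subgroup.one_closed[OF K] subgroup.m_closed[OF K])

lemma nprod_mult:
  assumes "\<And>i. f i \<in> K" "\<And>i. g i \<in> K"
  shows "nprod G (\<lambda>i. f i \<otimes> g i) n = nprod G f n \<otimes> nprod G g n"
proof (induction n)
  case (Suc n)
  have m: "nprod G f n \<in> K" "nprod G g n \<in> K" "f n \<in> K" "g n \<in> K"
    by (intro nprod_closed assms)+
  have "nprod G (\<lambda>i. f i \<otimes> g i) (Suc n) = nprod G f n \<otimes> (nprod G g n \<otimes> f n) \<otimes> g n"
    using Suc m by (simp add: m_assoc)
  also have "nprod G g n \<otimes> f n = f n \<otimes> nprod G g n" using m K_comm by blast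
  finally show ?case using m by (simp add: m_assoc)
qed simp

lemma cj_nprod:
  assumes "\<And>i. f i \<in> K" "g \<in> carrier G"
  shows "cj G g (nprod G f n) = nprod G (\<lambda>i. cj G g (f i)) n"
proof (induction n)
  case (Suc n)
  have "nprod G f n \<in> K" using assms(1) by (rule nprod_closed)
  moreover have "f n \<in> K" by (rule assms(1))
  ultimately have "nprod G f n \<in> carrier G" "f n \<in> carrier G" by auto
  then show ?case using Suc assms(2) by (simp add: cj_mult_right)
qed (use assms in simp)

lemma nprod_Suc_shift:
  assumes "\<And>i. f i \<in> K"
  shows "nprod G f (Suc n) = f 0 \<otimes> nprod G (\<lambda>i. f (Suc i)) n"
proof (induction n)
  case (Suc n)
  have m: "nprod G (\<lambda>i. f (Suc i)) n \<in> K" by (intro nprod_closed assms)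
  have "nprod G f (Suc (Suc n)) = f 0 \<otimes> nprod G (\<lambda>i. f (Suc i)) n \<otimes> f (Suc n)" using Suc by simp
  then show ?case using m assms by (simp add: m_assoc)
qed (use assms in simp)

lemma nprod_swap:
  assumes "\<And>i j. f i j \<in> K"
  shows "nprod G (\<lambda>i. nprod G (f i) m) n = nprod G (\<lambda>j. nprod G (\<lambda>i. f i j) n) m"
proof (induction m)
  case 0
  show ?case by (induction n) auto
next
  case (Suc m)
  have "nprod G (\<lambda>i. nprod G (f i) (Suc m)) n = nprod G (\<lambda>i. nprod G (f i) m \<otimes> f i m) n" by simp
  also have "\<dots> = nprod G (\<lambda>i. nprod G (f i) m) n \<otimes> nprod G (\<lambda>i. f i m) n"
    by (intro nprod_mult nprod_closed assms)
  finally show ?case using Suc by simp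
qed

lemma nprod_one: "(\<And>i. i < n \<Longrightarrow> f i = \<one>) \<Longrightarrow> nprod G f n = \<one>"
  by (induction n) auto

lemma nprod_const: "v \<in> K \<Longrightarrow> nprod G (\<lambda>_. v) n = v [^] n"
  by (induction n) auto

text \<open>Conjugation by e shifts the factors v, v^e, ..., v^(e^(r-1)) cyclically, so the product
  is fixed by e and hence trivial.\<close>

lemma norm_trivial:
  assumes e: "e \<in> C" "e \<noteq> \<one>" "e [^] r = \<one>" and v: "v \<in> K"
  shows "nprod G (\<lambda>i. cj G (e [^] i) v) r = \<one>"
proof (cases r)
  case (Suc n)
  have ec: "e \<in> carrier G" and vc: "v \<in> carrier G" using e v by auto
  let ?f = "\<lambda>i. cj G (e [^] (i::nat)) v"
  have f: "?f i \<in> K" for i using ec v by simp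
  let ?w = "nprod G ?f r"
  have w: "?w \<in> K" by (intro nprod_closed f)
  have "cj G e ?w = nprod G (\<lambda>i. cj G e (?f i)) r" using f ec by (rule cj_nprod)
  also have "\<dots> = nprod G (\<lambda>i. ?f (Suc i)) r" using ec vc by (simp add: cj_mult_left)
  finally have cw: "cj G e ?w = nprod G (\<lambda>i. ?f (Suc i)) r" .
  have s: "nprod G (\<lambda>i. ?f (Suc i)) r \<in> K" by (intro nprod_closed f)
  have "?f 0 \<otimes> nprod G (\<lambda>i. ?f (Suc i)) r = ?w \<otimes> ?f r"
    using nprod_Suc_shift[of ?f r] f by simp
  also have "?f r = ?f 0" using e by simp
  also have "?w \<otimes> ?f 0 = ?f 0 \<otimes> ?w" using w f K_comm by blast
  finally have "nprod G (\<lambda>i. ?f (Suc i)) r = ?w" using f[of 0] w s K_carrier by (metis Units_eq Units_l_cancel)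
  then have "cj G e ?w = ?w" using cw by simp
  then show ?thesis using fixed_point_free[OF e(1,2) w] by simp
qed simp

text \<open>Were \<open>\<langle>x, y\<rangle>\<close> of order \<open>r\<^sup>2\<close>, multiplying the trivial norms of \<open>v\<close> over the cyclic groups
  generated by \<open>x y\<^sup>j\<close> would leave \<open>v\<^sup>r\<close>.\<close>

lemma commuting_prime_order:
  assumes r: "Factorial_Ring.prime r" and x: "x \<in> C" "ord x = r" and y: "y \<in> C" "ord y = r"
    and xy: "x \<otimes> y = y \<otimes> x"
  shows "y \<in> generate G {x}"
proof (rule ccontr)
  assume ny: "y \<notin> generate G {x}"
  have xc: "x \<in> carrier G" and yc: "y \<in> carrier G" using x y by auto
  obtain v where v: "v \<in> K" "v \<noteq> \<one>" using K_nontrivial subgroup_nontrivial[OF K] by blast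
  have vc: "v \<in> carrier G" using v by simp
  have xr: "x [^] r = \<one>" and yr: "y [^] r = \<one>" using pow_ord_eq_1[OF xc] pow_ord_eq_1[OF yc] x y by auto
  let ?e = "\<lambda>j. x \<otimes> y [^] (j::nat)"
  have comj: "x \<otimes> y [^] (j::nat) = y [^] j \<otimes> x" for j
    using group_commutes_pow[OF xy[symmetric] yc xc] by simp
  have eC: "?e j \<in> C" for j using x y C subgroup_pow_closed[OF C y(1)] by (simp add: subgroup.m_closed)
  have e1: "?e j \<noteq> \<one>" for j
  proof
    assume "?e j = \<one>"
    then have "x = inv (y [^] j)" using xc yc by (metis inv_equality nat_pow_closed)
    then have "x \<in> generate G {y}" using subgroup_generate[OF yc] yc by (simp add: subgroup.m_inv_closed)
    then show False using generate_eq_if_ord_eq[OF yc] x y ny by simp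
  qed
  have er: "?e j [^] r = \<one>" for j
  proof -
    have "?e j [^] r = x [^] r \<otimes> (y [^] j) [^] r" using comj xc yc by (intro pow_mult_distrib) auto
    also have "(y [^] j) [^] r = (y [^] r) [^] j" using yc by (simp add: nat_pow_pow mult.commute)
    finally show ?thesis using xr yr by simp
  qed
  let ?f = "\<lambda>j i. cj G (?e j [^] (i::nat)) v"
  have fK: "?f j i \<in> K" for j i using xc yc v by simp
  have "nprod G (\<lambda>j. nprod G (?f j) r) r = \<one>"
    by (rule nprod_one) (rule norm_trivial[OF eC e1 er v(1)])
  then have tot: "nprod G (\<lambda>i. nprod G (\<lambda>j. ?f j i) r) r = \<one>" using nprod_swap[of ?f r r] fK by simp
  \<comment> \<open>Since (x y^j)^i = x^i (y^i)^j, for 0 < i < r the product over j is a norm for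
    y^i and vanishes. Only i = 0 survives, contributing v^r.\<close>
  have inner: "nprod G (\<lambda>j. ?f j i) r = \<one>" if i: "0 < i" "i < r" for i
  proof -
    have yi1: "y [^] i \<noteq> \<one>" using i yc y(2) by (simp add: pow_eq_id nat_dvd_not_less)
    have yiC: "y [^] i \<in> C" using subgroup_pow_closed[OF C y(1)] .
    have yir: "(y [^] i) [^] r = \<one>" using yc yr by (simp add: nat_pow_pow mult.commute[of i] flip: nat_pow_pow[of y r i])
    have "?f j i = cj G ((y [^] i) [^] j) (cj G (x [^] i) v)" for j
    proof -
      have "?e j [^] i = x [^] i \<otimes> (y [^] j) [^] i" using comj xc yc by (intro pow_mult_distrib) auto
      then show ?thesis using xc yc vc by (simp add: cj_mult_left nat_pow_pow mult.commute)
    qed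
    then show ?thesis using norm_trivial[OF yiC yi1 yir, of "cj G (x [^] i) v"] xc v by simp
  qed
  obtain n where n: "r = Suc n" using prime_gt_0_nat[OF r] gr0_implies_Suc by blast
  let ?g = "\<lambda>i. nprod G (\<lambda>j. ?f j i) r"
  have gK: "?g i \<in> K" for i by (intro nprod_closed fK)
  have "nprod G ?g r = ?g 0 \<otimes> nprod G (\<lambda>i. ?g (Suc i)) n" using nprod_Suc_shift[of ?g n] gK n by metis
  also have "nprod G (\<lambda>i. ?g (Suc i)) n = \<one>"
    by (rule nprod_one) (use inner n in \<open>simp only: zero_less_Suc Suc_less_eq\<close>)
  also have "?g 0 = v [^] r" using nprod_const[OF v(1)] vc by simp
  finally have "v [^] r = \<one>" using tot vc by simp
  then have "ord v = r" using r v(2) ord_eq_1[OF vc] pow_eq_id[OF vc] by (metis prime_nat_iff)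
  then have "r dvd card K" using ord_dvd_card[OF K v(1)] by simp
  moreover have "r dvd card C" using ord_dvd_card[OF C x(1)] x by simp
  ultimately show False using prime_dvd_complement_not_kernel[OF r] by blast
qed

text \<open>c d^-1 fixes v. Equations in \<open>C\<close> can thus be checked on a single
  non-identity element of \<open>K\<close>.\<close>

lemma complement_element_eq:
  assumes c: "c \<in> C" and d: "d \<in> C" and v: "v \<in> K" "v \<noteq> \<one>" and eq: "cj G c v = cj G d v"
  shows "c = d"
proof (rule ccontr)
  assume ne: "c \<noteq> d"
  have m: "c \<in> carrier G" "d \<in> carrier G" "v \<in> carrier G" using c d v by auto
  have "c \<otimes> inv d \<noteq> \<one>"
  proof
    assume "c \<otimes> inv d = \<one>"
    then have "c \<otimes> inv d \<otimes> d = d" using m by simp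
    then show False using ne m by (simp add: m_assoc)
  qed
  moreover have "c \<otimes> inv d \<in> C" using c d C by (simp add: subgroup_closed)
  moreover have "cj G (c \<otimes> inv d) v = v" using m eq by (simp add: cj_mult_left)
  ultimately show False using fixed_point_free v by blast
qed

lemma cj_polynomials_props:
  assumes x: "x \<in> carrier G" and f: "f \<in> cj_polynomials G x"
  shows "w \<in> K \<Longrightarrow> f w \<in> K"
    and "w \<in> K \<Longrightarrow> w' \<in> K \<Longrightarrow> f (w \<otimes> w') = f w \<otimes> f w'"
    and "w \<in> K \<Longrightarrow> c \<in> carrier G \<Longrightarrow> c \<otimes> x = x \<otimes> c \<Longrightarrow> f (cj G c w) = cj G c (f w)"
proof -
  have cl: "w \<in> K \<Longrightarrow> f w \<in> K" for w
    using f by (induction rule: cj_polynomials.induct) (auto simp: x subgroup.m_closed[OF K])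
  then show "w \<in> K \<Longrightarrow> f w \<in> K" for w .
  have cl': "g w \<in> K" if "g \<in> cj_polynomials G x" "w \<in> K" for g w
    using that by (induction rule: cj_polynomials.induct) (auto simp: x subgroup.m_closed[OF K])
  show "w \<in> K \<Longrightarrow> w' \<in> K \<Longrightarrow> f (w \<otimes> w') = f w \<otimes> f w'"
    using f
  proof (induction rule: cj_polynomials.induct)
    case (mult f g)
    have m: "f w \<in> K" "f w' \<in> K" "g w \<in> K" "g w' \<in> K" using mult cl' by auto
    have "f (w \<otimes> w') \<otimes> g (w \<otimes> w') = f w \<otimes> (f w' \<otimes> g w) \<otimes> g w'" using mult m by (simp add: m_assoc)
    also have "f w' \<otimes> g w = g w \<otimes> f w'" using m K_comm by blast
    finally show ?case using m by (simp add: m_assoc)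
  next
    case (conj f)
    then show ?case using cl' x by (simp add: cj_mult_right)
  qed auto
  show "w \<in> K \<Longrightarrow> c \<in> carrier G \<Longrightarrow> c \<otimes> x = x \<otimes> c \<Longrightarrow> f (cj G c w) = cj G c (f w)"
    using f
  proof (induction rule: cj_polynomials.induct)
    case (mult f g)
    then show ?case using cl' by (simp add: cj_mult_right)
  next
    case (conj f)
    have fw: "f w \<in> carrier G" using conj cl' by auto
    have "cj G x (f (cj G c w)) = cj G x (cj G c (f w))" using conj by simp
    also have "\<dots> = cj G (c \<otimes> x) (f w)" using conj.prems(2) fw x by (simp add: cj_mult_left)
    also have "\<dots> = cj G (x \<otimes> c) (f w)" using conj by simp
    also have "\<dots> = cj G c (cj G x (f w))" using conj.prems fw x by (simp add: cj_mult_left)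
    finally show ?case .
  qed auto
qed

lemma cj_polynomials_commute:
  assumes x: "x \<in> carrier G" and f: "f \<in> cj_polynomials G x" and g: "g \<in> cj_polynomials G x" and w: "w \<in> K"
  shows "f (g w) = g (f w)"
  using f
proof (induction rule: cj_polynomials.induct)
  case (mult f h)
  then show ?case using cj_polynomials_props(1,2)[OF x] g w by simp
next
  case (conj f)
  then show ?case using cj_polynomials_props(1,3)[OF x] g w x by simp
qed simp

text \<open>Schur's lemma. An irreducible module over the commutative ring generated by \<open>x\<close> is cyclic,
  so its endomorphisms commute.\<close>

lemma centralizer_abelian:
  assumes x: "x \<in> C" and irr: "acts_irreducibly G {x} K"
    and c: "c \<in> C" "c \<otimes> x = x \<otimes> c" and d: "d \<in> C" "d \<otimes> x = x \<otimes> d"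
  shows "c \<otimes> d = d \<otimes> c"
proof -
  have m: "x \<in> carrier G" "c \<in> carrier G" "d \<in> carrier G" using x c d by auto
  obtain v where v: "v \<in> K" "v \<noteq> \<one>" using K_nontrivial subgroup_nontrivial[OF K] by blast
  have vc: "v \<in> carrier G" using v by simp
  \<comment> \<open>The submodule generated by v; by irreducibility it is all of
    \<open>K\<close>.\<close>
  let ?W = "(\<lambda>f. f v) ` cj_polynomials G x"
  have vW: "v \<in> ?W" using cj_polynomials.ident by (intro image_eqI[of _ _ "\<lambda>w. w"]) auto
  have WK: "?W \<subseteq> K" using cj_polynomials_props(1)[OF m(1)] v by blast
  have "subgroup ?W G"
  proof (rule subgroup_of_closed)
    show "?W \<subseteq> carrier G" using WK by auto
    show "?W \<noteq> {}" using vW by blast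
    show "a \<otimes> b \<in> ?W" if ab: "a \<in> ?W" "b \<in> ?W" for a b
    proof -
      obtain f g where "f \<in> cj_polynomials G x" "a = f v" "g \<in> cj_polynomials G x" "b = g v" using ab by blast
      then show ?thesis using cj_polynomials.mult[of f G x g] by (intro image_eqI[of _ _ "\<lambda>w. f w \<otimes> g w"]) auto
    qed
  qed
  moreover have "cj G x ` ?W \<subseteq> ?W"
  proof
    fix b assume "b \<in> cj G x ` ?W"
    then obtain f where "f \<in> cj_polynomials G x" "b = cj G x (f v)" by blast
    then show "b \<in> ?W" using cj_polynomials.conj[of f G x] by (intro image_eqI[of _ _ "\<lambda>w. cj G x (f w)"]) auto
  qed
  ultimately have "?W = {\<one>} \<or> ?W = K"
    using irr WK unfolding acts_irreducibly_def conjugate_eq_image by blast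
  then have W: "?W = K" using vW v by blast
  obtain f where f: "f \<in> cj_polynomials G x" "cj G c v = f v" using W v m by (metis K_cj imageE)
  obtain g where g: "g \<in> cj_polynomials G x" "cj G d v = g v" using W v m by (metis K_cj imageE)
  \<comment> \<open>c and d act on v as polynomials f and g in x. These commute with each other and
    with the actions of c and d, so cd and dc agree on v.\<close>
  have "cj G (c \<otimes> d) v = cj G d (f v)" using m vc f by (simp add: cj_mult_left)
  also have "\<dots> = f (g v)" using cj_polynomials_props(3)[OF m(1) f(1) v(1) m(3) d(2)] g by simp
  also have "\<dots> = g (f v)" using cj_polynomials_commute[OF m(1) f(1) g(1) v(1)] .
  also have "\<dots> = cj G c (g v)" using cj_polynomials_props(3)[OF m(1) g(1) v(1) m(2) c(2)] f by simp
  also have "\<dots> = cj G (d \<otimes> c) v" using m vc g by (simp add: cj_mult_left)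
  finally show ?thesis
    using complement_element_eq[OF _ _ v] c d C by (simp add: subgroup.m_closed)
qed

text \<open>Elements of the same prime order generating different subgroups have their commutator in
  <x> \<inter> <y> = 1, so \<open>commuting_prime_order\<close> rules them out.\<close>

lemma dedekind_rank_one:
  assumes H: "dedekind H" "H \<subseteq> C"
  shows "rank_one H"
  unfolding rank_one_def
proof (intro ballI impI)
  fix x y assume x: "x \<in> H" and y: "y \<in> H" and r: "Factorial_Ring.prime (ord x)" and o: "ord y = ord x"
  have xC: "x \<in> C" and yC: "y \<in> C" using x y H(2) by auto
  have xc: "x \<in> carrier G" and yc: "y \<in> carrier G" using xC yC by auto
  show "y \<in> generate G {x}"
  proof (rule ccontr)
    assume ny: "y \<notin> generate G {x}"
    obtain c where c: "c \<in> generate G {x}" "c \<in> generate G {y}" "x \<otimes> y = y \<otimes> x \<otimes> c"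
      using dedekind_commutator[OF H(1) x y] by blast
    have cc: "c \<in> carrier G" using subgroup_generate[OF xc] c(1) by (rule subgroup.mem_carrier)
    have "c = \<one>"
    proof (rule ccontr)
      assume "c \<noteq> \<one>"
      moreover have "ord c dvd ord y" using ord_dvd_card[OF subgroup_generate[OF yc] c(2)] generate_pow_card[OF yc] by simp
      ultimately have "ord c = ord y" using r o ord_eq_1[OF cc] by (metis prime_nat_iff)
      then have "y \<in> generate G {c}" using generate_eq_if_ord_eq[OF yc c(2)] by simp
      then show False using ny generate_subset[OF subgroup_generate[OF xc] c(1)] by blast
    qed
    then have "x \<otimes> y = y \<otimes> x" using c(3) xc yc by simp
    then show False using commuting_prime_order[OF r xC refl yC o] ny by blast
  qed
qed

lemma abelian_complement_cyclic:
  assumes H: "subgroup H G" "H \<subseteq> C" and ab: "\<And>a b. a \<in> H \<Longrightarrow> b \<in> H \<Longrightarrow> a \<otimes> b = b \<otimes> a"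
  shows "\<exists>x\<in>H. H = generate G {x}"
proof -
  have "cj G h a = a" if "a \<in> H" "h \<in> H" for a h
    using that ab[of h a] H(2) by (subst cj_eq_self_iff) auto
  then have "dedekind H" using H(1) by (simp add: dedekind_def)
  then show ?thesis using abelian_rank_one_cyclic[OF H(1) ab] dedekind_rank_one H(2) by blast
qed

end

section \<open>The structure of the complement\<close>

context finite_group
begin

text \<open>P<y> is a p-group containing the Sylow subgroup \<open>P\<close>.\<close>

lemma p_element_in_normal_sylow:
  assumes p: "Factorial_Ring.prime p" and P: "sylow_sub G p P" and C: "subgroup C G" "normalizes G C P"
    and y: "y \<in> C" "ord y = p ^ k"
  shows "y \<in> P"
proof -
  have Ps: "subgroup P G" "card P = p ^ Factorial_Ring.multiplicity p (order G)" using P by (auto simp: sylow_sub_def)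
  have yc: "y \<in> carrier G" using C(1) y(1) by (rule subgroup.mem_carrier)
  let ?Y = "generate G {y}"
  have Y: "subgroup ?Y G" "card ?Y = p ^ k" using subgroup_generate[OF yc] generate_pow_card[OF yc] y(2) by simp_all
  have n: "normalizes G ?Y P" using C(2) generate_subset[OF C(1) y(1)] by (auto simp: normalizes_def)
  obtain m where m: "card (P <#> ?Y) = p ^ m" using prime_power_set_mult[OF p Ps Y] by blast
  have "P <#> ?Y = P" using card_sylow_max[OF p P subgroup_set_mult[OF Ps(1) Y(1) n] m subset_set_mult(1)[OF Ps(1) Y(1)]] .
  then show ?thesis using subset_set_mult(2)[OF Ps(1) Y(1)] mem_generate by blast
qed

lemma sylow_element_order:
  assumes p: "Factorial_Ring.prime p" and P: "sylow_sub G p P" and y: "y \<in> P"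
  shows "\<exists>k. ord y = p ^ k"
proof -
  have "ord y dvd p ^ Factorial_Ring.multiplicity p (order G)" using ord_dvd_card[of P y] P y by (auto simp: sylow_sub_def)
  then show ?thesis using divides_primepow_nat[OF p] by metis
qed

lemma coprime_order_trivial:
  assumes "w \<in> carrier G" "ord w = p ^ k" "Factorial_Ring.prime p" "\<not> p dvd ord w"
  shows "w = \<one>"
proof -
  have "k = 0" using assms by (cases k) auto
  then show ?thesis using assms ord_eq_1[of w] by simp
qed

end

lemma (in frobenius_group) frobenius_if_kernel:
  assumes "C \<noteq> {\<one>}" "K = frobenius_kernel G (carrier G) C"
  shows "frobenius G K C"
  unfolding frobenius_def conjugate_eq_image
proof (intro conjI C assms(1) ballI)
  show "C \<noteq> carrier G"
  proof
    assume "C = carrier G"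
    then have "K \<subseteq> K \<inter> C" by auto
    then show False using K_Int_C K_nontrivial subgroup_nontrivial[OF K] by blast
  qed
  show "C \<inter> cj G g ` C = {\<one>}" if g: "g \<in> carrier G - C" for g
  proof
    show "C \<inter> cj G g ` C \<subseteq> {\<one>}"
    proof
      fix y assume "y \<in> C \<inter> cj G g ` C"
      then obtain c where c: "c \<in> C" "y = cj G g c" "cj G g c \<in> C" by blast
      then have "c = \<one>" using malnormal_inD[OF malnormal, of g c] g by blast
      then show "y \<in> {\<one>}" using c g by simp
    qed
    have "\<one> \<in> C" using C by (rule subgroup.one_closed)
    moreover have "\<one> \<in> cj G g ` C" using \<open>\<one> \<in> C\<close> g by (intro image_eqI[of _ _ \<one>]) auto
    ultimately show "{\<one>} \<subseteq> C \<inter> cj G g ` C" by blast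
  qed
  show "K = carrier G - (\<Union>g\<in>carrier G. cj G g ` C) \<union> {\<one>}"
  proof (intro subset_antisym subsetI)
    fix x assume "x \<in> K"
    then have x: "x \<in> carrier G" "\<And>u c. u \<in> carrier G \<Longrightarrow> c \<in> C \<Longrightarrow> x = cj G u c \<Longrightarrow> x = \<one>"
      unfolding assms(2) frobenius_kernel_def by blast+
    then show "x \<in> carrier G - (\<Union>g\<in>carrier G. cj G g ` C) \<union> {\<one>}" by blast
  next
    fix x assume x: "x \<in> carrier G - (\<Union>g\<in>carrier G. cj G g ` C) \<union> {\<one>}"
    then show "x \<in> K"
      using subgroup.one_closed[OF K] unfolding assms(2) frobenius_kernel_def by blast
  qed
qed

lemma (in frobenius_group) int_semidirect_kernel: "int_semidirect G (carrier G) K C"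
  unfolding int_semidirect_def
  using K C K_Int_C K_mult_C subgroup_self normal_in_iff[OF subgroup_self K] K_normal subgroup.subset[OF K] subgroup.subset[OF C]
  by simp

section \<open>Frobenius complements normalizing a Sylow p-subgroup\<close>

locale TI_complement = frobenius_TI_group +
  fixes P
  assumes P: "sylow_sub G p P" and PC: "P \<subseteq> C" and CP: "normalizes G C P"
    and p_dvd: "p dvd order G" and kernel: "K = frobenius_kernel G (carrier G) C"
begin

lemma p_elements: "y \<in> C \<Longrightarrow> ord y = p ^ k \<Longrightarrow> y \<in> P"
  using p_element_in_normal_sylow[OF p P C CP] .

lemma P_sub: "subgroup P G" and cardP: "card P = p ^ Factorial_Ring.multiplicity p (order G)"
  using P by (auto simp: sylow_sub_def)

lemma p_dvd_card_P: "p dvd card P"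
proof -
  have "order G \<noteq> 0" using order_gt_0_iff_finite by simp
  then have "Factorial_Ring.multiplicity p (order G) > 0" using p p_dvd by (simp add: prime_multiplicity_gt_zero_iff)
  then show ?thesis using cardP by simp
qed

lemma ex_central_prime_element: "\<exists>z\<in>P. ord z = p \<and> (\<forall>y\<in>P. y \<otimes> z = z \<otimes> y)"
proof -
  have "normalizes G P P" using P_sub by (simp add: normalizes_def subgroup_cj_closed)
  then obtain z where z: "z \<in> P" "z \<noteq> \<one>" "\<forall>s\<in>P. s \<otimes> z = z \<otimes> s"
    using ex_central_fixed[OF P_sub cardP p P_sub p_dvd_card_P] by blast
  have zc: "z \<in> carrier G" using P_sub z(1) by (rule subgroup.mem_carrier)
  obtain m where m: "ord z = p ^ m" using sylow_element_order[OF p P z(1)] by blast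
  obtain k where k: "ord (z [^] (p ^ k)) = p" using ex_prime_order_power[OF zc m z(2) p] by blast
  have "y \<otimes> z [^] (p ^ k) = z [^] (p ^ k) \<otimes> y" if y: "y \<in> P" for y
    using group_commutes_pow[of z y "p ^ k"] z(3) y zc subgroup.mem_carrier[OF P_sub y] by simp
  then show ?thesis using k subgroup_pow_closed[OF P_sub z(1)] by blast
qed

text \<open>A fixed element of order \<open>p\<close> in the centre of \<open>P\<close>. The
  subgroup Z it generates is the only one of order \<open>p\<close> in \<open>C\<close>, hence
  normal in \<open>C\<close>.\<close>

definition z where "z = (SOME z. z \<in> P \<and> ord z = p \<and> (\<forall>y\<in>P. y \<otimes> z = z \<otimes> y))"

lemma z: "z \<in> P" "ord z = p" "y \<in> P \<Longrightarrow> y \<otimes> z = z \<otimes> y"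
proof -
  have "z \<in> P \<and> ord z = p \<and> (\<forall>y\<in>P. y \<otimes> z = z \<otimes> y)"
    unfolding z_def by (rule someI_ex) (use ex_central_prime_element in blast)
  then show "z \<in> P" "ord z = p" "y \<in> P \<Longrightarrow> y \<otimes> z = z \<otimes> y" by auto
qed

lemma zC: "z \<in> C"
  using z(1) PC by blast

lemma zc [simp]: "z \<in> carrier G"
  using zC by simp

lemma z_ne_one: "z \<noteq> \<one>"
  using z(2) p by auto

abbreviation Z where "Z \<equiv> generate G {z}"

lemma Z: "subgroup Z G" "Z \<subseteq> C" "card Z = p"
  using subgroup_generate[OF zc] generate_subset[OF C zC] generate_pow_card[OF zc] z(2) by auto

lemma K_ab: "a \<in> K \<Longrightarrow> b \<in> K \<Longrightarrow> a \<otimes> b = b \<otimes> a"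
  using kernel_elementary_abelian[OF zC z(2)] by (auto simp: elem_abelian_sub_def)

sublocale frobenius_abelian_kernel G K C
  by unfold_locales (rule K_ab)

text \<open>y lies in \<open>P\<close> and so commutes with the central z; commuting elements of
  order \<open>p\<close> in \<open>C\<close> generate the same subgroup.\<close>

lemma prime_order_in_Z:
  assumes "y \<in> C" "ord y = p"
  shows "y \<in> Z" "z \<in> generate G {y}"
proof -
  have "y \<in> P" using p_elements[of y 1] assms by simp
  then show "y \<in> Z" using commuting_prime_order[OF p zC z(2) assms] z(3) by simp
  then show "z \<in> generate G {y}" using generate_eq_if_ord_eq[OF zc] assms z(2) by simp
qed

lemma Z_nontrivial_element:
  assumes "w \<in> Z" "w \<noteq> \<one>"
  shows "z \<in> generate G {w}"
proof -
  have wC: "w \<in> C" using assms(1) Z(2) by blast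
  have "ord w dvd p" using ord_dvd_card[OF Z(1) assms(1)] Z(3) by simp
  then have "ord w = p" using p assms(2) ord_eq_1[of w] wC by (metis C_carrier prime_nat_iff)
  then show ?thesis using prime_order_in_Z(2)[OF wC] by simp
qed

lemma CZ: "normalizes G C Z"
  unfolding normalizes_def
proof (intro ballI)
  fix c w assume c: "c \<in> C" and w: "w \<in> Z"
  have "cj G c z \<in> Z" using prime_order_in_Z(1)[of "cj G c z"] c zC z(2) C by (simp add: subgroup_cj_closed)
  moreover obtain k :: nat where "w = z [^] k" using w mem_generate_iff[OF zc] by blast
  ultimately show "cj G c w \<in> Z" using c by (simp add: cj_pow_right subgroup_pow_closed[OF Z(1)])
qed

text \<open>\<open>A\<close> cannot contain \<open>K\<close>, so it is not subnormal and therefore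
  TI. It contains z, which every c in \<open>C\<close> carries into Z and hence into
  \<open>A\<close>.\<close>

lemma complement_subgroup_normal:
  assumes A: "subgroup A G" "A \<subseteq> C" "p dvd card A"
  shows "normalizes G C A"
proof -
  obtain x where x: "x \<in> A" "ord x = p" using cauchy_in[OF p A(1,3)] by blast
  have xC: "x \<in> C" using x A(2) by blast
  have x1: "x \<noteq> \<one>" using x p by auto
  have "\<not> subnormal G A"
  proof
    assume "subnormal G A"
    then have "K \<subseteq> A" using subnormal_contains_kernel x(1) xC x1 by blast
    then have "K \<subseteq> K \<inter> C" using A(2) by blast
    then show False using K_Int_C K_nontrivial subgroup_nontrivial[OF K] by blast
  qed
  then have TI: "TI_subgroup G A" using star A by blast
  have "z \<in> A" using prime_order_in_Z(2)[OF xC x(2)] generate_subset[OF A(1) x(1)] by blast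
  then have ZA: "Z \<subseteq> A" using generate_subset[OF A(1)] by blast
  show ?thesis
    unfolding normalizes_def
  proof (intro ballI)
    fix c a assume c: "c \<in> C" and a: "a \<in> A"
    have "cj G c z \<in> A" using CZ c ZA mem_generate by (auto simp: normalizes_def)
    then show "cj G c a \<in> A" using TI_subgroup_cj[OF TI C_carrier[OF c] \<open>z \<in> A\<close> z_ne_one _ a] by blast
  qed
qed

lemma irreducible: "y \<in> C \<Longrightarrow> ord y = p \<Longrightarrow> y \<in> S \<Longrightarrow> acts_irreducibly G S K"
  using irreducible_action K_ab by blast

lemma centralizer_z_abelian:
  "c \<in> C \<Longrightarrow> c \<otimes> z = z \<otimes> c \<Longrightarrow> d \<in> C \<Longrightarrow> d \<otimes> z = z \<otimes> d \<Longrightarrow> c \<otimes> d = d \<otimes> c"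
  using centralizer_abelian[OF zC irreducible[OF zC z(2)]] by blast

lemma C_nontrivial: "C \<noteq> {\<one>}"
  using zC z_ne_one by blast

lemma frob: "frobenius G K C"
  using frobenius_if_kernel[OF C_nontrivial kernel] .

text \<open>The involution z inverts \<open>K\<close>, since v v^z is fixed by z. Hence every cyclic
  subgroup of \<open>K\<close> is invariant, and irreducibility makes \<open>K\<close> cyclic of
  prime order. Z has only one non-identity element, so z is central in \<open>C\<close> and
  \<open>C\<close> is abelian, therefore cyclic.\<close>

lemma case_two:
  assumes p2: "p = 2"
  shows "\<exists>q K a. Factorial_Ring.prime q \<and> odd q \<and> a \<in> carrier G \<and>
           cyclic_sub G K \<and> card K = q \<and> even (ord a) \<and>
           int_semidirect G (carrier G) K (generate G {a}) \<and>
           frobenius G K (generate G {a})"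
proof -
  obtain q r where q: "Factorial_Ring.prime q" "q \<noteq> p" "elem_abelian_sub G q r K"
    using kernel_elementary_abelian[OF zC z(2)] by blast
  obtain v where v: "v \<in> K" "v \<noteq> \<one>" using K_nontrivial subgroup_nontrivial[OF K] by blast
  have vc: "v \<in> carrier G" using v by simp
  have "z [^] (2::nat) = \<one>" using pow_ord_eq_1[OF zc] z(2) p2 by metis
  moreover have "z [^] (2::nat) = z \<otimes> z" by (simp add: numeral_2_eq_2)
  ultimately have zz: "z \<otimes> z = \<one>" by simp
  have invert: "cj G z v = inv v"
  proof -
    have cz: "cj G z v \<in> K" using v by simp
    have "cj G z (cj G z v) = v" using cj_mult_left[OF zc zc vc] zz vc by simp
    then have "cj G z (v \<otimes> cj G z v) = cj G z v \<otimes> v" using vc by (simp add: cj_mult_right)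
    also have "\<dots> = v \<otimes> cj G z v" using K_ab cz v by blast
    finally have "v \<otimes> cj G z v = \<one>"
      using fixed_point_free[OF zC z_ne_one, of "v \<otimes> cj G z v"] v cz K by (simp add: subgroup.m_closed)
    then have "inv v = cj G z v" using vc by (metis cj_closed inv_comm inv_equality zc)
    then show ?thesis by simp
  qed
  have V: "subgroup (generate G {v}) G" using subgroup_generate[OF vc] .
  have VK: "generate G {v} \<subseteq> K" using generate_subset[OF K v(1)] .
  have "cj G z ` generate G {v} \<subseteq> generate G {v}"
  proof
    fix w assume "w \<in> cj G z ` generate G {v}"
    then obtain u where "u \<in> generate G {v}" "w = cj G z u" by blast
    then obtain k :: nat where "w = cj G z (v [^] k)" using mem_generate_iff[OF vc] by metis
    then have "w = inv v [^] k" using invert vc by (simp add: cj_pow_right)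
    then show "w \<in> generate G {v}"
      using subgroup_pow_closed[OF V] subgroup.m_inv_closed[OF V mem_generate] by simp
  qed
  then have "generate G {v} = {\<one>} \<or> generate G {v} = K"
    using irreducible[OF zC z(2), of "{z}"] V VK unfolding acts_irreducibly_def conjugate_eq_image by blast
  then have VeqK: "generate G {v} = K" using v mem_generate by blast
  have "v [^] q = \<one>" using q(3) v(1) by (simp add: elem_abelian_sub_def)
  then have "ord v = q" using q(1) v(2) ord_eq_1[OF vc] pow_eq_id[OF vc] by (metis prime_nat_iff)
  then have cK: "card K = q" using generate_pow_card[OF vc] VeqK by simp
  have cycK: "cyclic_sub G K" using cyclic_sub_generate[OF vc] VeqK by simp
  have oddq: "odd q" using q(1,2) p2 by (metis primes_dvd_imp_eq two_is_prime_nat)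
  have cent: "c \<otimes> z = z \<otimes> c" if c: "c \<in> C" for c
  proof -
    have "cj G c z \<in> Z" using CZ c mem_generate by (auto simp: normalizes_def)
    moreover have "cj G c z \<noteq> \<one>" using c z_ne_one by simp
    ultimately have "cj G c z = z" using generate_order_two[OF zc] z(2) p2 by simp
    then show ?thesis using cj_eq_self_iff[OF C_carrier[OF c] zc] by simp
  qed
  obtain a where a: "a \<in> C" "C = generate G {a}"
    using abelian_complement_cyclic[OF C] centralizer_z_abelian cent by blast
  have ac: "a \<in> carrier G" using a(1) by simp
  have "p dvd card C" using ord_dvd_card[OF C zC] z(2) by simp
  then have "even (ord a)" using generate_pow_card[OF ac] a(2) p2 by simp
  then show ?thesis
    using q(1) oddq ac cycK cK int_semidirect_kernel frob a(2) by metis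
qed

text \<open>\<open>P\<close> and the subgroup of elements of order prime to \<open>p\<close> are
  abelian subgroups of a Frobenius complement, hence cyclic. A nontrivial S in \<open>P\<close>
  contains an element of order \<open>p\<close>, which already acts irreducibly.\<close>

lemma case_abelian:
  assumes ab: "\<And>a b. a \<in> C \<Longrightarrow> b \<in> C \<Longrightarrow> a \<otimes> b = b \<otimes> a"
  shows "\<exists>q r V P H C. Factorial_Ring.prime q \<and> q \<noteq> p \<and> r \<ge> 1 \<and>
           elem_abelian_sub G q r V \<and> sylow_sub G p P \<and> cyclic_sub G P \<and>
           cyc_or_Q8_odd G H \<and> int_direct G C P H \<and>
           int_semidirect G (carrier G) V C \<and> frobenius G V C \<and>
           (\<forall>S. subgroup S G \<and> S \<subseteq> P \<and> S \<noteq> {\<one>} \<longrightarrow> acts_irreducibly G S V)"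
proof -
  obtain q r where q: "Factorial_Ring.prime q" "q \<noteq> p" "r \<ge> 1" "elem_abelian_sub G q r K"
    using kernel_elementary_abelian[OF zC z(2)] by blast
  obtain x where "x \<in> P" "P = generate G {x}"
    using abelian_complement_cyclic[OF P_sub PC] ab PC by blast
  then have cycP: "cyclic_sub G P" using cyclic_sub_generate subgroup.mem_carrier[OF P_sub] by metis
  define H where "H = {h \<in> C. \<not> p dvd ord h}"
  have H: "subgroup H G"
  proof (rule subgroup_of_closed)
    show "H \<subseteq> carrier G" by (auto simp: H_def)
    have "\<one> \<in> H" using subgroup.one_closed[OF C] prime_gt_1_nat[OF p] by (simp add: H_def)
    then show "H \<noteq> {}" by blast
    show "a \<otimes> b \<in> H" if "a \<in> H" "b \<in> H" for a b
    proof -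
      have m: "a \<in> C" "b \<in> C" "\<not> p dvd ord a" "\<not> p dvd ord b" using that by (auto simp: H_def)
      have "ord (a \<otimes> b) dvd ord a * ord b" using ord_mul_divides[OF ab[OF m(1,2)]] m by simp
      then have "\<not> p dvd ord (a \<otimes> b)"
        using m(3,4) prime_dvd_mult_iff[OF p, of "ord a" "ord b"] dvd_trans[of p "ord (a \<otimes> b)" "ord a * ord b"] by blast
      then show ?thesis using m C by (simp add: H_def subgroup.m_closed)
    qed
  qed
  have HC: "H \<subseteq> C" by (auto simp: H_def)
  obtain y where "y \<in> H" "H = generate G {y}"
    using abelian_complement_cyclic[OF H HC] ab HC by blast
  then have cycH: "cyclic_sub G H" using cyclic_sub_generate subgroup.mem_carrier[OF H] by metis
  have PH: "P \<inter> H = {\<one>}"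
  proof
    show "P \<inter> H \<subseteq> {\<one>}"
    proof
      fix w assume w: "w \<in> P \<inter> H"
      obtain k where "ord w = p ^ k" using sylow_element_order[OF p P] w by blast
      then show "w \<in> {\<one>}" using coprime_order_trivial[of w p k] w p by (auto simp: H_def)
    qed
    show "{\<one>} \<subseteq> P \<inter> H" using P_sub H subgroup.one_closed by blast
  qed
  have "P <#> H = C"
  proof
    show "P <#> H \<subseteq> C" using PC HC C by (auto simp: set_mult_def subgroup.m_closed subsetD)
    show "C \<subseteq> P <#> H"
    proof
      fix h assume h: "h \<in> C"
      obtain i j :: nat and k where ij: "h = h [^] i \<otimes> h [^] j" "ord (h [^] i) = p ^ k" "\<not> p dvd ord (h [^] j)"
        using prime_part_decomposition[OF C_carrier[OF h] p] by blast
      have "h [^] i \<in> C" "h [^] j \<in> C" using subgroup_pow_closed[OF C h] by auto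
      then have "h [^] i \<in> P" "h [^] j \<in> H" using p_elements ij by (auto simp: H_def)
      then show "h \<in> P <#> H" using ij(1) set_mult_memI by metis
    qed
  qed
  then have dir: "int_direct G C P H"
    using P_sub H PH ab PC HC unfolding int_direct_def by blast
  have irr: "acts_irreducibly G S K" if S: "subgroup S G" "S \<subseteq> P" "S \<noteq> {\<one>}" for S
  proof -
    obtain s where s: "s \<in> S" "s \<noteq> \<one>" using S(3) subgroup_nontrivial[OF S(1)] by blast
    have sP: "s \<in> P" using s S(2) by blast
    obtain k where k: "ord s = p ^ k" using sylow_element_order[OF p P sP] by blast
    obtain m where m: "ord (s [^] (p ^ m)) = p"
      using ex_prime_order_power[OF subgroup.mem_carrier[OF P_sub sP] k s(2) p] by blast
    have "s [^] (p ^ m) \<in> S" using subgroup_pow_closed[OF S(1) s(1)] .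
    then show ?thesis using irreducible[OF _ m] S(2) PC by blast
  qed
  have "cyc_or_Q8_odd G H" using cycH by (simp add: cyc_or_Q8_odd_def)
  then show ?thesis
    using q P cycP dir int_semidirect_kernel frob irr by blast
qed

text \<open>Since the centralizer of z is abelian, some element moves z. Its p'-part t is the pivot:
  comparing t with the normal subgroups Z<a> of \<open>C\<close> gives P = Z, and N_C(<t>) is the
  complement H of Z.\<close>

lemma case_nonabelian:
  assumes nab: "a0 \<in> C" "b0 \<in> C" "a0 \<otimes> b0 \<noteq> b0 \<otimes> a0"
  shows "\<exists>q r V Z H C. Factorial_Ring.prime q \<and> q \<noteq> p \<and> r > 1 \<and>
           elem_abelian_sub G q r V \<and> sylow_sub G p Z \<and> card Z = p \<and>
           cyc_or_Q8_odd G H \<and> (\<exists>z\<in>Z. \<exists>h\<in>H. z \<otimes> h \<noteq> h \<otimes> z) \<and>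
           int_semidirect G C Z H \<and>
           int_semidirect G (carrier G) V C \<and> frobenius G V C \<and>
           acts_irreducibly G Z V"
proof -
  obtain q r where q: "Factorial_Ring.prime q" "q \<noteq> p" "r \<ge> 1" "elem_abelian_sub G q r K"
    using kernel_elementary_abelian[OF zC z(2)] by blast
  obtain t0 where t0: "t0 \<in> C" "t0 \<otimes> z \<noteq> z \<otimes> t0" using centralizer_z_abelian nab by blast
  obtain i j :: nat and k where ij: "t0 = t0 [^] i \<otimes> t0 [^] j" "ord (t0 [^] i) = p ^ k" "\<not> p dvd ord (t0 [^] j)"
    using prime_part_decomposition[OF C_carrier[OF t0(1)] p] by blast
  \<comment> \<open>The p-part of t0 lies in \<open>P\<close> and commutes with z, so the p'-part
    must move z.\<close>
  define t where "t = t0 [^] j"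
  have tC: "t \<in> C" unfolding t_def using subgroup_pow_closed[OF C t0(1)] .
  have tc: "t \<in> carrier G" using tC by simp
  have tp: "\<not> p dvd ord t" using ij by (simp add: t_def)
  have tz: "t \<otimes> z \<noteq> z \<otimes> t"
  proof
    assume e: "t \<otimes> z = z \<otimes> t"
    have iC: "t0 [^] i \<in> C" using subgroup_pow_closed[OF C t0(1)] .
    have "t0 [^] i \<in> P" using p_elements[OF iC ij(2)] .
    then have e': "t0 [^] i \<otimes> z = z \<otimes> t0 [^] i" by (rule z(3))
    have ic: "t0 [^] i \<in> carrier G" using iC by simp
    have "t0 \<otimes> z = t0 [^] i \<otimes> (t \<otimes> z)" using ij(1) ic tc by (metis m_assoc t_def zc)
    also have "\<dots> = t0 [^] i \<otimes> z \<otimes> t" using e ic tc by (simp add: m_assoc)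
    also have "\<dots> = z \<otimes> (t0 [^] i \<otimes> t)" using e' ic tc by (simp add: m_assoc)
    also have "\<dots> = z \<otimes> t0" using ij(1) by (simp add: t_def)
    finally show False using t0(2) by simp
  qed
  let ?T = "generate G {t}"
  have T: "subgroup ?T G" "?T \<subseteq> C" using subgroup_generate[OF tc] generate_subset[OF C tC] by auto
  have Tp: "\<not> p dvd ord s" if "s \<in> ?T" for s
  proof -
    have "ord s dvd ord t" using ord_dvd_card[OF T(1) that] generate_pow_card[OF tc] by simp
    then show ?thesis using tp dvd_trans by blast
  qed
  have TP: "s = \<one>" if "s \<in> ?T" "s \<in> P" for s
    using sylow_element_order[OF p P that(2)] coprime_order_trivial[of s p] Tp[OF that(1)] p T that by (auto simp: subsetD)
  have ZP: "Z \<subseteq> P" using generate_subset[OF P_sub z(1)] .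
  have ZA_normal: "normalizes G C (Z <#> generate G {a})" "subgroup (Z <#> generate G {a}) G" if a: "a \<in> C" for a
  proof -
    have A: "subgroup (generate G {a}) G" "generate G {a} \<subseteq> C"
      using subgroup_generate[OF C_carrier[OF a]] generate_subset[OF C a] by auto
    have n: "normalizes G (generate G {a}) Z" using CZ A(2) by (auto simp: normalizes_def)
    show S: "subgroup (Z <#> generate G {a}) G" using subgroup_set_mult[OF Z(1) A(1) n] .
    have "Z <#> generate G {a} \<subseteq> C" using Z(2) A(2) C by (auto simp: set_mult_def subgroup.m_closed subsetD)
    moreover have "p dvd card (Z <#> generate G {a})"
      using card_subgroup_dvd[OF Z(1) S subset_set_mult(1)[OF Z(1) A(1)]] Z(3) by simp
    ultimately show "normalizes G C (Z <#> generate G {a})" using complement_subgroup_normal[OF S] by blast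
  qed
  have Zcent: "w = \<one>" if w: "w \<in> Z" "t \<otimes> w = w \<otimes> t" for w
  proof (rule ccontr)
    assume "w \<noteq> \<one>"
    then have "z \<in> generate G {w}" using Z_nontrivial_element[OF w(1)] by simp
    moreover have wc: "w \<in> carrier G" using Z(1) w(1) by (rule subgroup.mem_carrier)
    ultimately obtain l :: nat where "z = w [^] l" using mem_generate_iff by blast
    then show False using tz group_commutes_pow[OF w(2)[symmetric] wc tc, of l] by simp
  qed
  \<comment> \<open>Otherwise \<open>P\<close>, abelian as part of the centralizer of z, is cyclic,
    say <y>. The commutator w of y and t lies in \<open>P\<close> and in Z<t>, hence in Z; so y^t =
    yw with w^p = 1, and t centralizes y^p. But z is a power of y^p unless y lies in Z, and t moves
    z.\<close>
  have PZ: "P = Z"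
  proof (rule ccontr)
    assume ne: "P \<noteq> Z"
    have Pab: "a \<otimes> b = b \<otimes> a" if "a \<in> P" "b \<in> P" for a b
      using centralizer_z_abelian[of a b] that PC z(3) by blast
    obtain y where y: "y \<in> P" "P = generate G {y}"
      using abelian_complement_cyclic[OF P_sub PC] Pab by blast
    have yC: "y \<in> C" using y(1) PC by blast
    have yc: "y \<in> carrier G" using yC by simp
    let ?c = "inv y \<otimes> cj G t y"
    let ?A = "Z <#> ?T"
    have cP: "?c \<in> P"
      using CP tC y(1) P_sub by (simp add: normalizes_def subgroup_closed)
    have tA: "t \<in> ?A" using subset_set_mult(2)[OF Z(1) T(1)] mem_generate by blast
    have "cj G y (inv t) \<in> ?A"
      using ZA_normal[OF tC] yC tA by (simp add: normalizes_def subgroup.m_inv_closed)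
    moreover have "?c = cj G y (inv t) \<otimes> t" using yc tc by (simp add: cj_def m_assoc)
    ultimately have "?c \<in> ?A" using ZA_normal(2)[OF tC] tA by (simp add: subgroup.m_closed)
    then obtain w s where ws: "w \<in> Z" "s \<in> ?T" "?c = w \<otimes> s" by (rule set_mult_memE)
    have wc: "w \<in> carrier G" and sc: "s \<in> carrier G" using ws Z(2) T(2) by auto
    have "s = inv w \<otimes> ?c" using ws wc sc by simp
    then have "s \<in> P" using ws(1) ZP cP P_sub by (auto simp: subgroup_closed)
    then have "s = \<one>" using TP[OF ws(2)] by blast
    then have "?c = w" using ws(3) wc by simp
    then have "y \<otimes> (inv y \<otimes> cj G t y) = y \<otimes> w" by simp
    then have ty: "cj G t y = y \<otimes> w" using yc tc by simp
    have "w [^] p = \<one>" using pow_card_eq_one[OF Z(1) ws(1)] Z(3) by simp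
    moreover have "y \<otimes> w = w \<otimes> y" using Pab y(1) ws(1) ZP by blast
    ultimately have "cj G t (y [^] p) = y [^] p"
      using ty yc tc wc pow_mult_distrib[of y w p] by (simp add: cj_pow_right)
    then have com_yp: "y [^] p \<otimes> t = t \<otimes> y [^] p" using cj_eq_self_iff[OF tc, of "y [^] p"] yc by simp
    obtain l :: nat where l: "z = y [^] l" using z(1) y(2) mem_generate_iff[OF yc] by blast
    show False
    proof (cases "p dvd l")
      case True
      then obtain l' where "l = p * l'" by blast
      then have "z = (y [^] p) [^] l'" using l yc by (simp add: nat_pow_pow)
      then have "z \<otimes> t = t \<otimes> z" using group_commutes_pow[OF com_yp _ tc, of l'] yc by simp
      then show False using tz by simp
    next
      case False
      obtain e where "ord y = p ^ e" using sylow_element_order[OF p P y(1)] by blast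
      then have "coprime l (ord y)" using False p by (metis coprime_commute coprime_power_right_iff prime_imp_coprime)
      then have "y \<in> Z" using mem_generate_pow_coprime[OF yc] l by simp
      then have "P \<subseteq> Z" using y(2) generate_subset[OF Z(1)] by simp
      then show False using ne ZP by blast
    qed
  qed
  let ?H = "normalizer_in C ?T"
  have H: "subgroup ?H G" using subgroup_normalizer_in[OF C subgroup.subset[OF T(1)]] .
  have HC: "?H \<subseteq> C" by (auto simp: normalizer_in_def)
  have normT: "h \<in> ?H" if h: "h \<in> C" "cj G h t \<in> ?T" for h
  proof -
    have "cj G h s \<in> ?T" if "s \<in> ?T" for s
    proof -
      obtain l :: nat where "s = t [^] l" using \<open>s \<in> ?T\<close> mem_generate_iff[OF tc] by blast
      then have "cj G h s = cj G h t [^] l" using h(1) tc by (simp add: cj_pow_right)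
      then show ?thesis using subgroup_pow_closed[OF T(1) h(2)] by simp
    qed
    then show ?thesis using h by (simp add: normalizer_in_def)
  qed
  have tH: "t \<in> ?H" using normT[OF tC] subgroup_cj_closed[OF T(1) mem_generate mem_generate] .
  \<comment> \<open>If w in Z normalizes <t>, the commutator of t and w lies in both <t> and Z,
    hence is trivial; but t fixes no non-identity element of Z.\<close>
  have ZH: "Z \<inter> ?H = {\<one>}"
  proof
    show "Z \<inter> ?H \<subseteq> {\<one>}"
    proof
      fix w assume w: "w \<in> Z \<inter> ?H"
      have wc: "w \<in> carrier G" using w Z(2) by auto
      have "cj G w t \<in> ?T" using w mem_generate by (auto simp: normalizer_in_def)
      then have "inv t \<otimes> cj G w t \<in> ?T" using T(1) by (simp add: subgroup_closed)
      moreover have "inv t \<otimes> cj G w t = cj G t (inv w) \<otimes> w" using wc tc by (simp add: cj_def m_assoc)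
      moreover have "cj G t (inv w) \<otimes> w \<in> Z"
        using w CZ tC Z(1) by (simp add: normalizes_def subgroup_closed)
      ultimately have "inv t \<otimes> cj G w t = \<one>" using TP ZP by auto
      then have "t \<otimes> (inv t \<otimes> cj G w t) = t" using tc by simp
      then have "cj G w t = t" using wc tc by simp
      then have "t \<otimes> w = w \<otimes> t" using cj_eq_self_iff[OF wc tc] by simp
      then show "w \<in> {\<one>}" using Zcent w by blast
    qed
    show "{\<one>} \<subseteq> Z \<inter> ?H" using Z(1) H subgroup.one_closed by blast
  qed
  have "Z <#> ?H = C"
  proof
    show "Z <#> ?H \<subseteq> C" using Z(2) HC C by (auto simp: set_mult_def subgroup.m_closed subsetD)
    show "C \<subseteq> Z <#> ?H"
    proof
      fix g assume g: "g \<in> C"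
      have gc: "g \<in> carrier G" using g by simp
      have "t \<in> Z <#> ?T" using subset_set_mult(2)[OF Z(1) T(1)] mem_generate by blast
      then have "cj G g t \<in> Z <#> ?T" using ZA_normal(1)[OF tC] g by (simp add: normalizes_def)
      \<comment> \<open>A Frattini argument. s acts without fixed points on Z, since an element of Z
        fixed by s commutes with t^g = ws. So w = u^-1 s u s^-1 for some u in Z, whence t^g = s^u,
        and g u^-1 normalizes <t>.\<close>
      then obtain w s where ws: "w \<in> Z" "s \<in> ?T" "cj G g t = w \<otimes> s" by (rule set_mult_memE)
      have wc: "w \<in> carrier G" and sc: "s \<in> carrier G" and sC: "s \<in> C" using ws Z(2) T(2) by auto
      have fpf: "u = \<one>" if u: "u \<in> Z" "cj G (inv s) u = u" for u
      proof (rule ccontr)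
        assume u1: "u \<noteq> \<one>"
        have uc: "u \<in> carrier G" using u Z(2) by auto
        have "cj G (inv g) u \<in> Z" using CZ g u(1) C by (simp add: normalizes_def subgroup.m_inv_closed)
        moreover have "t \<otimes> cj G (inv g) u = cj G (inv g) u \<otimes> t"
        proof -
          have "inv s \<otimes> u = u \<otimes> inv s" using cj_eq_self_iff[of "inv s" u] u(2) uc sc by simp
          then have "s \<otimes> (inv s \<otimes> u) \<otimes> s = s \<otimes> (u \<otimes> inv s) \<otimes> s" by simp
          then have us: "u \<otimes> s = s \<otimes> u" using uc sc by (simp add: m_assoc)
          have uw: "w \<otimes> u = u \<otimes> w" using generate_commute[OF zc ws(1) u(1)] .
          have "cj G g t \<otimes> u = w \<otimes> (s \<otimes> u)" using ws(3) wc sc uc by (simp add: m_assoc)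
          also have "\<dots> = w \<otimes> u \<otimes> s" using us wc sc uc by (simp add: m_assoc)
          also have "\<dots> = u \<otimes> cj G g t" unfolding uw ws(3) using wc sc uc by (simp add: m_assoc)
          finally have "cj G (inv g) (cj G g t \<otimes> u) = cj G (inv g) (u \<otimes> cj G g t)" by simp
          then show ?thesis using gc tc uc by (simp add: cj_mult_right)
        qed
        ultimately have "cj G (inv g) u = \<one>" using Zcent by blast
        then show False using u1 gc uc by simp
      qed
      have "(\<lambda>l. inv l \<otimes> cj G (inv s) l) ` Z = Z"
        by (rule commutator_image[OF Z(1)])
          (use CZ sC C fpf sc in \<open>auto simp: normalizes_def subgroup.m_inv_closed\<close>)
      then obtain u where u: "u \<in> Z" "w = inv u \<otimes> cj G (inv s) u" using ws(1) by blast
      have uC: "u \<in> C" and uc: "u \<in> carrier G" using u Z(2) by auto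
      have "cj G u s = w \<otimes> s" unfolding u(2) using uc sc by (simp add: cj_def m_assoc)
      then have "cj G g t = cj G u s" using ws(3) by simp
      then have "cj G (g \<otimes> inv u) t = s" using gc uc tc sc by (simp add: cj_mult_left)
      then have h: "g \<otimes> inv u \<in> ?H"
        using normT[of "g \<otimes> inv u"] ws(2) g uC C by (simp add: subgroup_closed)
      let ?h = "g \<otimes> inv u"
      have hc: "?h \<in> carrier G" using gc uc by simp
      have hC: "inv ?h \<in> C" using h HC C by (auto intro: subgroup.m_inv_closed)
      have "g = cj G (inv ?h) u \<otimes> ?h" using gc uc by (simp add: cj_def m_assoc inv_mult_group)
      moreover have "cj G (inv ?h) u \<in> Z" using CZ hC u(1) by (simp add: normalizes_def)
      ultimately show "g \<in> Z <#> ?H" using h set_mult_memI by metis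
    qed
  qed
  then have semi: "int_semidirect G C Z ?H"
    unfolding int_semidirect_def using C Z H HC ZH CZ normal_in_iff[OF C Z(1,2)] by blast
  \<comment> \<open>For a, h in the complement, a^h lies in Z<a>, and its component in Z is trivial
    because Z meets the complement trivially.\<close>
  have dedH: "dedekind ?H"
    unfolding dedekind_def
  proof (intro conjI H ballI)
    fix a h assume a: "a \<in> ?H" and h: "h \<in> ?H"
    have aC: "a \<in> C" and hC: "h \<in> C" using a h HC by auto
    let ?B = "generate G {a}"
    have B: "subgroup ?B G" using subgroup_generate aC by simp
    have BH: "?B \<subseteq> ?H" using generate_subset[OF H a] .
    have "a \<in> Z <#> ?B" using subset_set_mult(2)[OF Z(1) B] mem_generate by blast
    then have "cj G h a \<in> Z <#> ?B" using ZA_normal(1)[OF aC] hC by (simp add: normalizes_def)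
    then obtain w b where wb: "w \<in> Z" "b \<in> ?B" "cj G h a = w \<otimes> b" by (rule set_mult_memE)
    have wc: "w \<in> carrier G" and bc: "b \<in> carrier G" using wb Z(2) subgroup.mem_carrier[OF B] by auto
    have "cj G h a \<otimes> inv b = w" using wb(3) wc bc by (simp add: m_assoc)
    moreover have "cj G h a \<otimes> inv b \<in> ?H"
      using subgroup_cj_closed[OF H h a] wb(2) BH H by (auto intro: subgroup_closed)
    ultimately have "w = \<one>" using wb(1) ZH by auto
    then show "cj G h a \<in> ?B" using wb bc by simp
  qed
  have QH: "cyc_or_Q8_odd G ?H"
    using dedekind_rank_one_structure[OF dedH dedekind_rank_one[OF dedH HC]] .
  \<comment> \<open>On a kernel of prime order \<open>C\<close> would act by exponents, and these
    commute.\<close>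
  have r1: "r > 1"
  proof (rule ccontr)
    assume "\<not> r > 1"
    then have "r = 1" using q(3) by simp
    then have cK: "card K = q" using q(4) by (simp add: elem_abelian_sub_def)
    obtain v where v: "v \<in> K" "v \<noteq> \<one>" using K_nontrivial subgroup_nontrivial[OF K] by blast
    have vc: "v \<in> carrier G" using v by simp
    have "ord v dvd q" using ord_dvd_card[OF K v(1)] cK by simp
    then have "ord v = q" using q(1) v(2) ord_eq_1[OF vc] by (metis prime_nat_iff)
    then have "generate G {v} = K"
      using generate_subset[OF K v(1)] cK generate_pow_card[OF vc] finite_subgroup[OF K] by (intro card_subset_eq) auto
    then have pw: "\<exists>l::nat. cj G c v = v [^] l" if "c \<in> C" for c
      using K_cj[OF C_carrier[OF that] v(1)] mem_generate_iff[OF vc] by simp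
    obtain l m :: nat where lm: "cj G a0 v = v [^] l" "cj G b0 v = v [^] m" using pw nab by blast
    have m: "a0 \<in> carrier G" "b0 \<in> carrier G" using nab by auto
    have "cj G (a0 \<otimes> b0) v = cj G (b0 \<otimes> a0) v"
      using lm m vc by (simp add: cj_mult_left cj_pow_right nat_pow_pow mult.commute)
    then have "a0 \<otimes> b0 = b0 \<otimes> a0"
      using complement_element_eq[OF _ _ v] nab C by (simp add: subgroup.m_closed)
    then show False using nab by simp
  qed
  have "sylow_sub G p Z" using P PZ by simp
  moreover have "\<exists>z\<in>Z. \<exists>h\<in>?H. z \<otimes> h \<noteq> h \<otimes> z" using tz tH mem_generate by metis
  moreover have "acts_irreducibly G Z K" using irreducible[OF zC z(2) mem_generate] .
  ultimately show ?thesis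
    using q r1 Z(3) QH semi int_semidirect_kernel frob by blast
qed

end

section \<open>The characterization\<close>

lemma (in finite_group) ex_TI_complement:
  assumes p: "Factorial_Ring.prime p" and pd: "p dvd order G"
    and star: "\<And>H. subgroup H G \<Longrightarrow> p dvd card H \<Longrightarrow> TI_subgroup G H \<or> subnormal G H"
    and B: "subgroup B G" "p dvd card B" "\<not> subnormal G B"
  shows "\<exists>K C P. TI_complement G K C p P"
proof -
  have core: "N = {\<one>}" if "subgroup N G" "normalizes G (carrier G) N" "card N = p ^ n" for N n
    using subnormal_if_p_core[OF p star that _ B(1,2)] B(3) by blast
  \<comment> \<open>A nontrivial normal p-subgroup of a subnormal A would be subnormal in
    \<open>G\<close> and so would produce a nontrivial normal p-subgroup of
    \<open>G\<close>.\<close>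
  have no_sub: "\<not> subnormal G A" if A: "subgroup A G" and D: "subgroup D G" "D \<subseteq> A" "normalizes G A D" "card D = p ^ n" "D \<noteq> {\<one>}" for A D n
  proof
    assume "subnormal G A"
    then have "subnormal G D" using D by (intro subnormal_stepI[of A D])
    then show False using ex_p_core_if_subnormal[OF p _ D(4,5)] core by blast
  qed
  obtain P where P: "sylow_sub G p P" using ex_sylow[OF p] by blast
  have Ps: "subgroup P G" "card P = p ^ Factorial_Ring.multiplicity p (order G)" using P by (auto simp: sylow_sub_def)
  have Pc: "P \<subseteq> carrier G" using Ps(1) by (rule subgroup.subset)
  have "order G \<noteq> 0" using order_gt_0_iff_finite by simp
  then have "Factorial_Ring.multiplicity p (order G) > 0" using p pd by (simp add: prime_multiplicity_gt_zero_iff)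
  then have pP: "p dvd card P" using Ps(2) by simp
  then have P1: "P \<noteq> {\<one>}" using p by auto
  define C where "C = normalizer_in (carrier G) P"
  have C: "subgroup C G" unfolding C_def using subgroup_normalizer_in[OF subgroup_self Pc] .
  have CP: "normalizes G C P" unfolding C_def using normalizes_normalizer_in .
  have PC: "P \<subseteq> C" using subgroup_cj_closed[OF Ps(1)] Pc by (auto simp: C_def normalizer_in_def)
  have TI_C: "TI_subgroup G A" if A: "subgroup A G" "A \<subseteq> C" "p dvd card A" for A
  proof -
    obtain x where x: "x \<in> A" "ord x = p" using cauchy_in[OF p A(1,3)] by blast
    have "x \<in> P" using p_element_in_normal_sylow[OF p P C CP, of x 1] x A(2) by auto
    moreover have "x \<noteq> \<one>" using x p by auto
    ultimately have "A \<inter> P \<noteq> {\<one>}" using x(1) by blast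
    moreover have AP: "subgroup (A \<inter> P) G" using subgroup_Int[OF A(1) Ps(1)] .
    moreover obtain m where "card (A \<inter> P) = p ^ m" using subgroup_card_prime_power[OF AP Ps(1) _ Ps(2) p] by blast
    moreover have "normalizes G A (A \<inter> P)"
      using CP A(2) subgroup_cj_closed[OF A(1)] by (auto simp: normalizes_def)
    ultimately have "\<not> subnormal G A" using no_sub[OF A(1) AP] by blast
    then show ?thesis using star A by blast
  qed
  have pC: "p dvd card C" using card_subgroup_dvd[OF Ps(1) C PC] pP dvd_trans by blast
  have TIC: "TI_subgroup G C" using TI_C[OF C subset_refl pC] .
  \<comment> \<open>By TI, g carries all of C into C, hence the p-elements of C among themselves.
    These make up P, so g normalizes P and lies in C.\<close>
  have mal: "malnormal_in G (carrier G) C"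
    unfolding malnormal_in_def
  proof (intro conjI C subgroup.subset[OF C] ballI impI)
    fix g x assume g: "g \<in> carrier G" and x: "x \<in> C" "x \<noteq> \<one>" "cj G g x \<in> C"
    have "cj G g y \<in> P" if y: "y \<in> P" for y
    proof -
      have "cj G g y \<in> C" using TI_subgroup_cj[OF TIC g x] y PC by blast
      moreover obtain k where "ord y = p ^ k" using sylow_element_order[OF p P y] by blast
      moreover have "ord (cj G g y) = ord y" using ord_cj[OF g] y Pc by blast
      ultimately show ?thesis using p_element_in_normal_sylow[OF p P C CP] by simp
    qed
    then show "g \<in> C" using g by (simp add: C_def normalizer_in_def)
  qed
  have over_P: "normalizes G C A" if A: "subgroup A G" "P \<subseteq> A" "A \<subseteq> C" for A
    unfolding normalizes_def
  proof (intro ballI)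
    fix c a assume c: "c \<in> C" and a: "a \<in> A"
    obtain y where y: "y \<in> P" "y \<noteq> \<one>" using P1 subgroup_nontrivial[OF Ps(1)] by blast
    have TI: "TI_subgroup G A"
      using TI_C[OF A(1,3)] card_subgroup_dvd[OF Ps(1) A(1,2)] pP dvd_trans by blast
    have "cj G c y \<in> A" using CP c y(1) A(2) by (auto simp: normalizes_def)
    then show "cj G c a \<in> A"
      using TI_subgroup_cj[OF TI subgroup.mem_carrier[OF C c], of y a] y A(2) a by blast
  qed
  have aq: "abelian_quotients G C"
    unfolding abelian_quotients_def
  proof (intro allI impI, elim conjE)
    fix S assume S: "subgroup S G" "S \<subseteq> C" "S \<noteq> {\<one>}"
    show "\<exists>N. subgroup N G \<and> N \<subset> S \<and> normalizes G S N \<and> abelian_mod G S N"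
    proof (cases "S \<subseteq> P")
      case True
      then show ?thesis using abelian_quotients_prime_power[OF p Ps] S by (auto simp: abelian_quotients_def)
    next
      case False
      show ?thesis
      proof (rule ex_abelian_quotient[OF S(1) subgroup_Int[OF S(1) Ps(1)]])
        show "S \<inter> P \<subset> S" using False by blast
        fix M assume M: "subgroup M G" "S \<inter> P \<subseteq> M" "M \<subset> S"
        have MC: "M \<subseteq> C" using M(3) S(2) by blast
        have n: "normalizes G M P" using CP MC by (auto simp: normalizes_def)
        \<comment> \<open>PM is normal in C, and by the modular law its intersection with S is (P
          \<inter> S) M = M. So all of S normalizes M.\<close>
        let ?A = "P <#> M"
        have A: "subgroup ?A G" using subgroup_set_mult[OF Ps(1) M(1) n] .
        have AC: "?A \<subseteq> C" using PC MC C by (auto simp: set_mult_def subgroup.m_closed subsetD)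
        have nA: "normalizes G C ?A" using over_P[OF A subset_set_mult(1)[OF Ps(1) M(1)] AC] .
        obtain k where k: "k \<in> S - M" using M(3) by blast
        have "cj G k h \<in> M" if h: "h \<in> M" for h
        proof -
          have hS: "h \<in> S" using h M(3) by blast
          have "h \<in> ?A" using subset_set_mult(2)[OF Ps(1) M(1)] h by blast
          then have "cj G k h \<in> ?A" using nA k S(2) by (auto simp: normalizes_def)
          then obtain y m where ym: "y \<in> P" "m \<in> M" "cj G k h = y \<otimes> m" by (rule set_mult_memE)
          have yc: "y \<in> carrier G" and mc: "m \<in> carrier G" using ym Pc subgroup.mem_carrier[OF M(1)] by auto
          have "cj G k h \<in> S" using subgroup_cj_closed[OF S(1)] k hS by blast
          then have "cj G k h \<otimes> inv m \<in> S" using ym(2) M(3) S(1) by (auto intro: subgroup_closed)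
          moreover have "cj G k h \<otimes> inv m = y" using ym(3) yc mc by (simp add: m_assoc)
          ultimately have "y \<in> M" using ym(1) M(2) by auto
          then show ?thesis using ym M(1) by (simp add: subgroup.m_closed)
        qed
        then show "\<exists>k\<in>S - M. \<forall>h\<in>M. cj G k h \<in> M" using k by blast
      qed
    qed
  qed
  obtain K where K: "subgroup K G" "K \<inter> C = {\<one>}" "K <#> C = carrier G"
    using ex_malnormal_complement[OF subgroup_self mal aq] by blast
  have Keq: "K = frobenius_kernel G (carrier G) C" using complement_eq_frobenius_kernel[OF subgroup_self mal K] .
  have nK: "normalizes G (carrier G) K"
    unfolding normalizes_def
  proof (intro ballI)
    fix g x assume g: "g \<in> carrier G" and x: "x \<in> K"
    have img: "cj G g ` carrier G = carrier G" using g by (intro cj_image_eq_if_subset) auto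
    have "cj G (inv g \<otimes> g) ` C \<subseteq> C" using g subgroup.mem_carrier[OF C] by auto
    then have "\<exists>u\<in>carrier G. cj G (inv g \<otimes> u) ` C \<subseteq> C" using g by blast
    then show "cj G g x \<in> K"
      using frobenius_kernel_cj[OF subset_refl subgroup.subset[OF C] g img _ subgroup_self] x unfolding Keq by blast
  qed
  have K1: "K \<noteq> {\<one>}"
  proof
    assume "K = {\<one>}"
    then have "carrier G \<subseteq> C" using K(3) subgroup.mem_carrier[OF C] by (auto simp: set_mult_def)
    then have "normalizes G (carrier G) P" using CP by (auto simp: normalizes_def)
    then show False using core[OF Ps(1) _ Ps(2)] P1 by blast
  qed
  have "TI_complement G K C p P"
    by (intro TI_complement.intro TI_complement_axioms.intro frobenius_TI_group.intro frobenius_TI_group_axioms.intro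
        frobenius_group.intro frobenius_group_axioms.intro)
      (rule finite_group_axioms K nK mal K1 p P PC CP pd Keq | erule (1) star)+
  then show ?thesis by blast
qed

text \<open>The common converse, with <z> the only subgroup of order \<open>p\<close> in
  \<open>C\<close>. A conjugate B of \<open>A\<close> contains z, so B \<inter> K is invariant under
  <z> and equals 1 or \<open>K\<close>. If \<open>K\<close> lies in B, then B = K (B \<inter> C),
  which is normal in \<open>G\<close>. Otherwise B lies in \<open>C\<close>, and an element carrying
  part of B into B lies in \<open>C\<close>, which normalizes B.\<close>

lemma (in frobenius_group) TI_or_subnormal_if_irreducible:
  assumes p: "Factorial_Ring.prime p" and z: "z \<in> C" "ord z = p"
    and uniq: "\<And>y. y \<in> C \<Longrightarrow> ord y = p \<Longrightarrow> y \<in> generate G {z}"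
    and nrm: "\<And>A. subgroup A G \<Longrightarrow> A \<subseteq> C \<Longrightarrow> generate G {z} \<subseteq> A \<Longrightarrow> normalizes G C A"
    and irr: "acts_irreducibly G (generate G {z}) K"
    and frob: "frobenius G K C"
    and A: "subgroup A G" "p dvd card A"
  shows "TI_subgroup G A \<or> subnormal G A"
proof -
  let ?Z = "generate G {z}"
  have zc: "z \<in> carrier G" using z by simp
  have z1: "z \<noteq> \<one>" using z p by auto
  have Z: "subgroup ?Z G" "?Z \<subseteq> C" using subgroup_generate[OF zc] generate_subset[OF C z(1)] by auto
  have CZ: "normalizes G C ?Z" using nrm[OF Z] by blast
  obtain x where x: "x \<in> A" "ord x = p" using cauchy_in[OF p A] by blast
  have xc: "x \<in> carrier G" using A(1) x(1) by (rule subgroup.mem_carrier)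
  have "p dvd card C" using ord_dvd_card[OF C z(1)] z by simp
  then have "x \<notin> K" using prime_dvd_complement_not_kernel[OF p] ord_dvd_card[OF K, of x] x(2) by blast
  \<comment> \<open>x is outside the kernel, whose order is prime to \<open>p\<close>; so it is
    conjugate to an element of \<open>C\<close>.\<close>
  then obtain g c where gc: "g \<in> carrier G" "c \<in> C" "x = cj G g c"
    using frob xc unfolding frobenius_def conjugate_eq_image by blast
  have oc: "ord c = p" using ord_cj[OF gc(1) C_carrier[OF gc(2)]] gc(3) x(2) by simp
  define B where "B = cj G (inv g) ` A"
  have B: "subgroup B G" unfolding B_def using subgroup_cj_image[OF A(1)] gc by simp
  have Bc: "b \<in> carrier G" if "b \<in> B" for b using B that by (rule subgroup.mem_carrier)
  have cB: "c \<in> B" unfolding B_def using x(1) gc by (intro image_eqI[of _ _ x]) auto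
  have AB: "a \<in> A \<longleftrightarrow> (\<exists>b\<in>B. a = cj G g b)" for a
    using gc(1) subgroup.mem_carrier[OF A(1)] by (force simp: B_def)
  have "z \<in> generate G {c}" using generate_eq_if_ord_eq[OF zc uniq[OF gc(2) oc]] oc z by simp
  then have zB: "z \<in> B" using generate_subset[OF B cB] by blast
  have ZB: "?Z \<subseteq> B" using generate_subset[OF B zB] .
  have W: "subgroup (B \<inter> K) G" using subgroup_Int[OF B K] .
  have "cj G s ` (B \<inter> K) \<subseteq> B \<inter> K" if "s \<in> ?Z" for s
    using that ZB subgroup_cj_closed[OF B] Z(2) by auto
  then have "B \<inter> K = {\<one>} \<or> B \<inter> K = K"
    using irr W unfolding acts_irreducibly_def conjugate_eq_image by blast
  then show ?thesis
  proof
    assume "B \<inter> K = K"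
    then have KB: "K \<subseteq> B" by blast
    have BC: "normalizes G C (B \<inter> C)" using nrm[OF subgroup_Int[OF B C]] ZB Z(2) by blast
    have cb: "cj G d b \<in> B" if d: "d \<in> C" and b: "b \<in> B" for d b
    proof -
      obtain k e where ke: "k \<in> K" "e \<in> C" "b = k \<otimes> e" using Bc[OF b] K_mult_C by (metis set_mult_memE)
      have "e = inv k \<otimes> b" using ke by simp
      moreover have "inv k \<otimes> b \<in> B" using ke(1) KB b B by (auto intro: subgroup_closed)
      ultimately have "cj G d e \<in> B" using BC d ke(2) by (auto simp: normalizes_def)
      moreover have "cj G d k \<in> B" using K_cj[OF C_carrier[OF d] ke(1)] KB by blast
      ultimately show ?thesis using ke d B by (simp add: cj_mult_right subgroup.m_closed)
    qed
    have nB: "cj G h b \<in> B" if h: "h \<in> carrier G" and b: "b \<in> B" for h b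
    proof -
      obtain k d where kd: "k \<in> K" "d \<in> C" "h = k \<otimes> d" using h K_mult_C by (metis set_mult_memE)
      have "cj G k b \<in> B" using subgroup_cj_closed[OF B _ b] kd(1) KB by blast
      then show ?thesis using cb[OF kd(2)] kd Bc[OF b] by (simp add: cj_mult_left)
    qed
    have "normalizes G (carrier G) A"
      unfolding normalizes_def
    proof (intro ballI)
      fix h a assume h: "h \<in> carrier G" and a: "a \<in> A"
      then obtain b where b: "b \<in> B" "a = cj G g b" using AB by blast
      have bc: "b \<in> carrier G" using Bc[OF b(1)] .
      have "cj G h a = cj G g (cj G (g \<otimes> h \<otimes> inv g) b)"
        using b h gc(1) bc by (simp add: cj_mult_left)
      moreover have "cj G (g \<otimes> h \<otimes> inv g) b \<in> B" using nB b h gc(1) by simp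
      ultimately show "cj G h a \<in> A" using AB by blast
    qed
    then show ?thesis using subnormal_if_normal[OF A(1)] by blast
  next
    assume triv: "B \<inter> K = {\<one>}"
    \<comment> \<open>For b = kd, z^b = l^d z^d with l a commutator of k and z in \<open>K\<close>.
      Both z^b and z^d lie in B, so l^d is in B \<inter> K = 1 and z^b = z^d is in \<open>C\<close>;
      malnormality gives b in \<open>C\<close>.\<close>
    have BC: "B \<subseteq> C"
    proof
      fix b assume b: "b \<in> B"
      have bc: "b \<in> carrier G" using Bc[OF b] .
      obtain k d where kd: "k \<in> K" "d \<in> C" "b = k \<otimes> d" using bc K_mult_C by (metis set_mult_memE)
      let ?l = "inv k \<otimes> cj G (inv z) k"
      have l: "?l \<in> K" using kd(1) zc K by (simp add: subgroup_closed)
      have "cj G k z = ?l \<otimes> z" using kd(1) zc by (simp add: cj_def m_assoc)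
      then have e: "cj G b z = cj G d ?l \<otimes> cj G d z"
        using kd zc l by (simp add: cj_mult_left cj_mult_right)
      have dz: "cj G d z \<in> ?Z" using CZ kd(2) by (simp add: normalizes_def)
      have dzc: "cj G d z \<in> carrier G" using zc kd(2) by simp
      have dl: "cj G d ?l \<in> K" using l kd(2) by simp
      have "cj G b z \<otimes> inv (cj G d z) \<in> B"
        using subgroup_cj_closed[OF B b zB] dz ZB B by (auto intro: subgroup_closed)
      moreover have "cj G b z \<otimes> inv (cj G d z) = cj G d ?l"
        unfolding e using dzc K_carrier[OF dl] by (simp add: m_assoc)
      ultimately have "cj G d ?l = \<one>" using triv dl by auto
      then have "cj G b z = cj G d z" using e dzc by simp
      then have "cj G b z \<in> C" using dz Z(2) by auto
      then show "b \<in> C" using malnormal_inD[OF malnormal bc z(1) z1] by blast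
    qed
    have nB: "normalizes G C B" using nrm[OF B BC ZB] .
    have "TI_subgroup G A"
    proof (rule TI_subgroupI[OF A(1)])
      fix h y a assume h: "h \<in> carrier G" and y: "y \<in> A" "y \<noteq> \<one>" "cj G h y \<in> A" and a: "a \<in> A"
      obtain b where b: "b \<in> B" "y = cj G g b" using AB y(1) by blast
      obtain b' where b': "b' \<in> B" "cj G h y = cj G g b'" using AB y(3) by blast
      obtain d where d: "d \<in> B" "a = cj G g d" using AB a by blast
      have m: "b \<in> carrier G" "b' \<in> carrier G" "d \<in> carrier G" using b b' d Bc by auto
      let ?h = "g \<otimes> h \<otimes> inv g"
      have hc: "?h \<in> carrier G" using h gc(1) by simp
      have "cj G ?h b = cj G (inv g) (cj G h y)" using b h gc(1) m by (simp add: cj_mult_left)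
      also have "\<dots> = b'" using b' gc(1) m by simp
      finally have "cj G ?h b \<in> C" using b' BC by auto
      moreover have "b \<noteq> \<one>" using y(2) b(2) gc(1) by auto
      ultimately have "?h \<in> C" using malnormal_inD[OF malnormal hc, of b] b BC by blast
      then have "cj G ?h d \<in> B" using nB d by (simp add: normalizes_def)
      moreover have "cj G h a = cj G g (cj G ?h d)" using d h gc(1) m by (simp add: cj_mult_left)
      ultimately show "cj G h a \<in> A" using AB by blast
    qed
    then show ?thesis by blast
  qed
qed

section \<open>The converse for each of the cases (2), (3) and (4)\<close>

context finite_group
begin

lemma frobenius_groupI:
  assumes semi: "int_semidirect G (carrier G) V C" and frob: "frobenius G V C"
  shows "frobenius_group G V C"
proof (intro frobenius_group.intro frobenius_group_axioms.intro finite_group_axioms)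
  have C: "subgroup C G" "C \<noteq> carrier G" using frob by (auto simp: frobenius_def)
  have V: "subgroup V G" using semi by (simp add: int_semidirect_def)
  show "subgroup V G" "V \<inter> C = {\<one>}" and VC: "V <#> C = carrier G" using semi by (auto simp: int_semidirect_def)
  show "normalizes G (carrier G) V"
    using semi normal_in_iff[OF subgroup_self V subgroup.subset[OF V]] by (simp add: int_semidirect_def)
  show "malnormal_in G (carrier G) C"
    unfolding malnormal_in_def
  proof (intro conjI C(1) subgroup.subset[OF C(1)] ballI impI)
    fix g x assume g: "g \<in> carrier G" and x: "x \<in> C" "x \<noteq> \<one>" "cj G g x \<in> C"
    show "g \<in> C"
    proof (rule ccontr)
      assume "g \<notin> C"
      then have "C \<inter> cj G g ` C = {\<one>}" using frob g by (simp add: frobenius_def conjugate_eq_image)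
      then have "cj G g x = \<one>" using x by blast
      then show False using x(2) g subgroup.mem_carrier[OF C(1) x(1)] by simp
    qed
  qed
  show "V \<noteq> {\<one>}"
  proof
    assume "V = {\<one>}"
    then have "carrier G \<subseteq> C" using VC subgroup.mem_carrier[OF C(1)] by (auto simp: set_mult_def)
    then show False using C subgroup.subset by blast
  qed
qed

lemma dedekind_normalizes:
  assumes "dedekind C" "subgroup A G" "A \<subseteq> C"
  shows "normalizes G C A"
  using assms generate_subset[OF assms(2)] unfolding dedekind_def normalizes_def by blast

lemma irreducible_prime_order:
  assumes K: "subgroup K G" and q: "Factorial_Ring.prime (card K)"
  shows "acts_irreducibly G S K"
  unfolding acts_irreducibly_def
proof (intro conjI allI impI)
  show "K \<noteq> {\<one>}" using q by auto
  fix W assume "subgroup W G \<and> W \<subseteq> K \<and> (\<forall>s\<in>S. conjugate G W s \<subseteq> W)"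
  then have W: "subgroup W G" "W \<subseteq> K" by auto
  have "card W dvd card K" using card_subgroup_dvd[OF W(1) K W(2)] .
  then have "card W = 1 \<or> card W = card K" using q by (metis prime_nat_iff)
  then show "W = {\<one>} \<or> W = K"
    using subgroup_card_eq_one[OF W(1)] card_subset_eq[OF finite_subgroup[OF K] W(2)] by blast
qed

lemma TI_or_subnormal_case_two:
  assumes q: "Factorial_Ring.prime (card K)" and Kcyc: "cyclic_sub G K" and a: "a \<in> carrier G" "even (ord a)"
    and semi: "int_semidirect G (carrier G) K (generate G {a})" and frob: "frobenius G K (generate G {a})"
    and A: "subgroup A G" "even (card A)"
  shows "TI_subgroup G A \<or> subnormal G A"
proof -
  let ?C = "generate G {a}"
  have Ks: "subgroup K G" using Kcyc by (simp add: cyclic_sub_def)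
  interpret frobenius_group G K ?C using frobenius_groupI[OF semi frob] .
  obtain v where "v \<in> K" "K = generate G {v}" using cyclic_sub_imp_generate[OF Kcyc] by blast
  then have "x \<otimes> y = y \<otimes> x" if "x \<in> K" "y \<in> K" for x y
    using generate_commute[OF K_carrier] that by blast
  then interpret frobenius_abelian_kernel G K ?C by unfold_locales
  have "2 dvd card ?C" using generate_pow_card[OF a(1)] a(2) by simp
  then obtain z where z: "z \<in> ?C" "ord z = 2" using cauchy_in[OF two_is_prime_nat C] by blast
  have ded: "dedekind ?C" using cyclic_dedekind[OF cyclic_sub_generate[OF a(1)]] .
  show ?thesis
  proof (rule TI_or_subnormal_if_irreducible[OF two_is_prime_nat z])
    show "y \<in> generate G {z}" if "y \<in> ?C" "ord y = 2" for y
      using commuting_prime_order[OF two_is_prime_nat z that generate_commute[OF a(1) z(1) that(1)]] .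
  qed (use dedekind_normalizes[OF ded] irreducible_prime_order[OF Ks q] frob A in auto)
qed

text \<open>As the orders of \<open>P\<close> and \<open>H\<close> are coprime, \<open>C\<close> is
  again Dedekind. An element z of order \<open>p\<close> in the cyclic \<open>P\<close> commutes
  with \<open>P\<close> and \<open>H\<close>, hence with all of \<open>C\<close>, so <z> is the only
  subgroup of order \<open>p\<close>.\<close>

lemma TI_or_subnormal_case_direct:
  assumes p: "Factorial_Ring.prime p" "p dvd order G"
    and V: "elem_abelian_sub G q r V" and P: "sylow_sub G p P" "cyclic_sub G P"
    and H: "cyc_or_Q8_odd G H" and dir: "int_direct G C P H"
    and semi: "int_semidirect G (carrier G) V C" and frob: "frobenius G V C"
    and irr: "\<forall>S. subgroup S G \<and> S \<subseteq> P \<and> S \<noteq> {\<one>} \<longrightarrow> acts_irreducibly G S V"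
    and A: "subgroup A G" "p dvd card A"
  shows "TI_subgroup G A \<or> subnormal G A"
proof -
  interpret frobenius_group G V C using frobenius_groupI[OF semi frob] .
  interpret frobenius_abelian_kernel G V C using V by unfold_locales (auto simp: elem_abelian_sub_def)
  have Ps: "subgroup P G" "card P = p ^ Factorial_Ring.multiplicity p (order G)" using P by (auto simp: sylow_sub_def)
  have Hs: "subgroup H G" and com: "\<And>x h. x \<in> P \<Longrightarrow> h \<in> H \<Longrightarrow> x \<otimes> h = h \<otimes> x" and PH: "P \<inter> H = {\<one>}" "P <#> H = C"
    using dir by (auto simp: int_direct_def)
  have pos: "order G \<noteq> 0" using order_gt_0_iff_finite by simp
  have ord_eq: "order G = card V * (card P * card H)"
    using order_eq card_set_mult_disjoint[OF Ps(1) Hs PH(1)] PH(2) by simp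
  have pH: "\<not> p dvd card H"
  proof
    assume "p dvd card H"
    then have "p ^ Suc (Factorial_Ring.multiplicity p (order G)) dvd order G"
      unfolding ord_eq[THEN arg_cong, of "\<lambda>n. _ dvd n"] using Ps(2) by (metis dvd_mult mult.commute mult_dvd_mono dvd_refl power_Suc)
    then have "Suc (Factorial_Ring.multiplicity p (order G)) \<le> Factorial_Ring.multiplicity p (order G)"
      using pos p(1) by (intro multiplicity_geI) auto
    then show False by simp
  qed
  then have "coprime (card P) (card H)" using Ps(2) p(1) by (simp add: prime_imp_coprime)
  then have ded: "dedekind C"
    using dedekind_direct_product[OF cyclic_dedekind[OF P(2)] cyc_or_Q8_odd_dedekind[OF H] dir] by simp
  have "Factorial_Ring.multiplicity p (order G) > 0" using p pos by (simp add: prime_multiplicity_gt_zero_iff)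
  then have "p dvd card P" using Ps(2) by simp
  then obtain z where z: "z \<in> P" "ord z = p" using cauchy_in[OF p(1) Ps(1)] by blast
  have PC: "P \<subseteq> C" using subset_set_mult(1)[OF Ps(1) Hs] PH(2) by simp
  have zC: "z \<in> C" using z(1) PC by blast
  have zc: "z \<in> carrier G" using zC by simp
  obtain x where x: "x \<in> P" "P = generate G {x}" using cyclic_sub_imp_generate[OF P(2)] by blast
  have xc: "x \<in> carrier G" using Ps(1) x(1) by (rule subgroup.mem_carrier)
  have cent: "z \<otimes> y = y \<otimes> z" if y: "y \<in> C" for y
  proof -
    obtain u h where uh: "u \<in> P" "h \<in> H" "y = u \<otimes> h" using y PH(2) by (metis set_mult_memE)
    have m: "u \<in> carrier G" "h \<in> carrier G" using uh Ps(1) Hs by (auto intro: subgroup.mem_carrier)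
    have zu: "z \<otimes> u = u \<otimes> z" using generate_commute[OF xc] z(1) uh(1) x(2) by blast
    have zh: "z \<otimes> h = h \<otimes> z" using com z(1) uh(2) by blast
    have "z \<otimes> y = z \<otimes> u \<otimes> h" using uh m zc by (simp add: m_assoc)
    also have "\<dots> = u \<otimes> (z \<otimes> h)" unfolding zu using m zc by (simp add: m_assoc)
    also have "\<dots> = y \<otimes> z" unfolding zh using uh m zc by (simp add: m_assoc)
    finally show ?thesis .
  qed
  show ?thesis
  proof (rule TI_or_subnormal_if_irreducible[OF p(1) zC z(2)])
    show "y \<in> generate G {z}" if "y \<in> C" "ord y = p" for y
      using commuting_prime_order[OF p(1) zC z(2) that cent[OF that(1)]] .
    have "z \<noteq> \<one>" using z(2) p(1) by auto
    then have "generate G {z} \<noteq> {\<one>}" using mem_generate[of z] by (metis singletonD)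
    then show "acts_irreducibly G (generate G {z}) V"
      using irr[rule_format, of "generate G {z}"] subgroup_generate[OF zc] generate_subset[OF Ps(1) z(1)] by simp
  qed (use dedekind_normalizes[OF ded] frob A in auto)
qed

lemma TI_or_subnormal_case_semidirect:
  assumes p: "Factorial_Ring.prime p"
    and Z: "sylow_sub G p Z" "card Z = p"
    and H: "cyc_or_Q8_odd G H" and semiC: "int_semidirect G C Z H"
    and semi: "int_semidirect G (carrier G) V C" and frob: "frobenius G V C"
    and irr: "acts_irreducibly G Z V"
    and A: "subgroup A G" "p dvd card A"
  shows "TI_subgroup G A \<or> subnormal G A"
proof -
  interpret frobenius_group G V C using frobenius_groupI[OF semi frob] .
  have Zs: "subgroup Z G" "Z \<subseteq> C" and Hs: "subgroup H G" and ZH: "Z <#> H = C"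
    using semiC by (auto simp: int_semidirect_def)
  have CZ: "normalizes G C Z" using semiC normal_in_iff[OF C Zs] by (simp add: int_semidirect_def)
  have HC: "H \<subseteq> C" using semiC by (simp add: int_semidirect_def)
  have ded: "dedekind H" using cyc_or_Q8_odd_dedekind[OF H] .
  obtain z where z: "z \<in> Z" "ord z = p" using cauchy_in[OF p Zs(1)] Z(2) by auto
  have zC: "z \<in> C" using z Zs by blast
  have zc: "z \<in> carrier G" using zC by simp
  have gz: "generate G {z} = Z"
    using generate_subset[OF Zs(1) z(1)] finite_subgroup[OF Zs(1)] generate_pow_card[OF zc] z(2) Z(2)
    by (intro card_subset_eq) auto
  show ?thesis
  proof (rule TI_or_subnormal_if_irreducible[OF p zC z(2)])
    show "y \<in> generate G {z}" if "y \<in> C" "ord y = p" for y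
      using p_element_in_normal_sylow[OF p Z(1) C CZ, of y 1] that gz by simp
    \<comment> \<open>Write c = wh, with w already in Z and hence in B, and b^w = uk with u in Z and
      k in \<open>H\<close>. Then k is in B, k^h stays in <k> because \<open>H\<close> is Dedekind,
      and u^h stays in Z.\<close>
    show "normalizes G C B" if B: "subgroup B G" "B \<subseteq> C" "generate G {z} \<subseteq> B" for B
      unfolding normalizes_def
    proof (intro ballI)
      fix c b assume c: "c \<in> C" and b: "b \<in> B"
      have ZB: "Z \<subseteq> B" using B(3) gz by simp
      obtain w h where wh: "w \<in> Z" "h \<in> H" "c = w \<otimes> h" using c ZH by (metis set_mult_memE)
      have hC: "h \<in> C" using wh(2) HC by blast
      have "cj G w b \<in> B" using subgroup_cj_closed[OF B(1) _ b] wh(1) ZB by blast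
      then obtain u k where uk: "u \<in> Z" "k \<in> H" "cj G w b = u \<otimes> k" using B(2) ZH by (metis set_mult_memE subsetD)
      have m: "u \<in> carrier G" "k \<in> carrier G" "w \<in> carrier G" "h \<in> carrier G" "b \<in> carrier G"
        using uk wh Zs HC b B(2) by auto
      have "k = inv u \<otimes> cj G w b" using uk m by simp
      moreover have "inv u \<otimes> cj G w b \<in> B"
        using uk(1) ZB \<open>cj G w b \<in> B\<close> B(1) by (auto intro: subgroup_closed)
      ultimately have kB: "k \<in> B" by simp
      have "cj G h k \<in> generate G {k}" using ded uk(2) wh(2) by (simp add: dedekind_def)
      then have "cj G h k \<in> B" using generate_subset[OF B(1) kB] by blast
      moreover have "cj G h u \<in> B" using CZ hC uk(1) ZB by (auto simp: normalizes_def)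
      ultimately have "cj G h (u \<otimes> k) \<in> B" using m B(1) by (simp add: cj_mult_right subgroup.m_closed)
      then show "cj G c b \<in> B" using wh(3) uk(3) m by (simp add: cj_mult_left)
    qed
  qed (use irr gz frob A in auto)
qed

end

theorem theorem1p1:
  fixes G (structure) and p :: nat
  assumes "group G" and "finite (carrier G)" and "Factorial_Ring.prime p" and "p dvd order G"
  shows "(\<forall>H. subgroup H G \<longrightarrow> TI_subgroup G H \<or> subnormal G H \<or> \<not> p dvd card H)
    \<longleftrightarrow>
    ((\<forall>H. subgroup H G \<and> p dvd card H \<longrightarrow> subnormal G H)
     \<or> (p = 2 \<and> (\<exists>q K a. Factorial_Ring.prime q \<and> odd q \<and> a \<in> carrier G \<and>
           cyclic_sub G K \<and> card K = q \<and> even (group.ord G a) \<and>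
           int_semidirect G (carrier G) K (generate G {a}) \<and>
           frobenius G K (generate G {a})))
     \<or> (p > 2 \<and> (\<exists>q r V P H C. Factorial_Ring.prime q \<and> q \<noteq> p \<and> r \<ge> 1 \<and>
           elem_abelian_sub G q r V \<and> sylow_sub G p P \<and> cyclic_sub G P \<and>
           cyc_or_Q8_odd G H \<and> int_direct G C P H \<and>
           int_semidirect G (carrier G) V C \<and> frobenius G V C \<and>
           (\<forall>S. subgroup S G \<and> S \<subseteq> P \<and> S \<noteq> {\<one>} \<longrightarrow> acts_irreducibly G S V)))
     \<or> (p > 2 \<and> (\<exists>q r V Z H C. Factorial_Ring.prime q \<and> q \<noteq> p \<and> r > 1 \<and>
           elem_abelian_sub G q r V \<and> sylow_sub G p Z \<and> card Z = p \<and>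
           cyc_or_Q8_odd G H \<and> (\<exists>z\<in>Z. \<exists>h\<in>H. z \<otimes> h \<noteq> h \<otimes> z) \<and>
           int_semidirect G C Z H \<and>
           int_semidirect G (carrier G) V C \<and> frobenius G V C \<and>
           acts_irreducibly G Z V)))"
    (is "?L \<longleftrightarrow> ?R1 \<or> ?R2 \<or> ?R3 \<or> ?R4")
proof
  interpret finite_group G
    by (rule finite_group.intro[OF assms(1)]) (rule finite_group_axioms.intro[OF assms(2)])
  assume L: ?L
  show "?R1 \<or> ?R2 \<or> ?R3 \<or> ?R4"
  proof (cases ?R1)
    case False
    then obtain B where "subgroup B G" "p dvd card B" "\<not> subnormal G B" by blast
    then obtain K C P where "TI_complement G K C p P"
      using ex_TI_complement[OF assms(3,4)] L by blast
    then interpret TI_complement G K C p P .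
    show ?thesis
    \<comment> \<open>For p = 2 the complement is always abelian; for odd p its commutativity
      decides between (3) and (4).\<close>
    proof (cases "p = 2")
      case True
      then have ?R2 using case_two by simp
      then show ?thesis by blast
    next
      case False
      then have "p > 2" using prime_ge_2_nat[OF assms(3)] by simp
      then show ?thesis using case_abelian case_nonabelian by blast
    qed
  qed blast
next
  interpret finite_group G
    by (rule finite_group.intro[OF assms(1)]) (rule finite_group_axioms.intro[OF assms(2)])
  assume "?R1 \<or> ?R2 \<or> ?R3 \<or> ?R4"
  then have "TI_subgroup G A \<or> subnormal G A" if A: "subgroup A G" "p dvd card A" for A
  proof (elim disjE)
    assume ?R1
    then show ?thesis using A by blast
  next
    assume ?R2
    then show ?thesis using TI_or_subnormal_case_two[OF _ _ _ _ _ _ A(1)] A(2) by blast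
  next
    assume ?R3
    then obtain q r V P H C where "elem_abelian_sub G q r V" "sylow_sub G p P" "cyclic_sub G P"
      "cyc_or_Q8_odd G H" "int_direct G C P H" "int_semidirect G (carrier G) V C" "frobenius G V C"
      "\<forall>S. subgroup S G \<and> S \<subseteq> P \<and> S \<noteq> {\<one>} \<longrightarrow> acts_irreducibly G S V" by blast
    then show ?thesis using TI_or_subnormal_case_direct[OF assms(3,4)] A by blast
  next
    assume ?R4
    then obtain V Z H C where "sylow_sub G p Z" "card Z = p" "cyc_or_Q8_odd G H" "int_semidirect G C Z H"
      "int_semidirect G (carrier G) V C" "frobenius G V C" "acts_irreducibly G Z V" by blast
    then show ?thesis using TI_or_subnormal_case_semidirect[OF assms(3)] A by blast
  qed
  then show ?L by blast
qed

end
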